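(* There exists a universal constant $A_2$ such that for every even dimension $2n$ and any convex body $K\subset\mathbb{R}^{2n}$, $$\frac{c^Z_{lin}(K)}{c(B^{2n})}\le A_2\,\|\mathrm{Rad}\|_{X_K}^2\left(\frac{\mathrm{Vol}(K)}{\mathrm{Vol}(B^{2n})}\right)^{1/n},$$ where $X_K$ is the Banach space whose unit ball is the body $K$.
   Context: $\mathbb{R}^{2n}$ has coordinates $(x_1,y_1,\ldots,x_n,y_n)$, the standard symplectic form $\omega_{st}=\sum_{j=1}^n dx_j\wedge dy_j$ and the standard inner product. $B^{2n}$ is the open Euclidean unit ball in $\mathbb{R}^{2n}$, $B^{2k}(r)$ is the open ball of radius $r$ in $\mathbb{R}^{2k}$, and $Z^{2n}(r)=B^2(r)\times\mathbb{R}^{2n-2}$, where the factor $B^2(r)$ is in the $(x_1,y_1)$-plane. $\mathrm{Sp}(\mathbb{R}^{2n})$ is the group of linear maps of $\mathbb{R}^{2n}$ preserving $\omega_{st}$. The linearized cylindrical capacity of $U\subset\mathbb{R}^{2n}$ is $$c^Z_{lin}(U)=\inf\{\pi r^2 : \text{there exists }\psi\in\mathrm{Sp}(\mathbb{R}^{2n})\text{ with }\psi(U)\subset Z^{2n}(r)\}.$$ The quantity $c(B^{2n})$ is the common value $\pi$ taken on $B^{2n}$ by all (normalized) symplectic capacities $c$. A convex body is a bounded convex set with non-empty interior; since translations are symplectic, it is assumed throughout that the origin lies in its interior. $X_K$ is $\mathbb{R}^{2n}$ with $\|x\|_K=\inf\{r>0: x\in rK\}$. A convex body $K$ that is not centrally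 symmetric ($K\ne -K$) is treated by passing to the centrally symmetric difference body $K-K=\{x-y: x,y\in K\}$, at the cost of an extra factor $16$ in the inequality. $\mathrm{Vol}$ is the volume (Lebesgue measure) on $\mathbb{R}^{2n}$. Rademacher projection ($K$-convexity) constant: for $m\ge1$ let $\Omega^m=\{-1,1\}^m$ with uniform probability measure $\mu$, and $r_i(t)=t_i$ for $t\in\Omega^m$. For a Banach space $X$ let $L^2(\Omega^m,X)$ be the space of functions $f:\Omega^m\to X$ with norm $\left(\int_{\Omega^m}\|f\|_X^2\,d\mu\right)^{1/2}$. Define $\mathcal{R}_m(f)=\sum_{i=1}^m \left(\int_{\Omega^m} f r_i\,d\mu\right) r_i$, a linear operator from $L^2(\Omega^m,X)$ to its subspace $\{\sum_{i=1}^m x_ir_i: x_i\in X\}$ (with the $L^2$-norm). Then $\|\mathrm{Rad}\|_X=\sup_m\|\mathcal{R}_m\|$ (operator norms). A universal constant is a positive constant that does not depend on the dimension or on the body. *)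

theory Defs
  imports "HOL-Analysis.Analysis" "HOL-Library.Function_Algebras"
begin

text \<open>
  The dimension is quantified inside the statement (the constant must not depend on it), so
  it cannot be a type.  The space \<open>\<real>\<^sup>d\<close> is the carrier of the library topology
  \<^term>\<open>Euclidean_space d\<close>: the functions \<^typ>\<open>nat \<Rightarrow> real\<close> that vanish at all
  indices \<open>\<ge> d\<close>.  The coordinates \<open>(x\<^sub>1, y\<^sub>1, \<dots>, x\<^sub>n, y\<^sub>n)\<close> of \<open>v\<close> are
  \<open>v 0, v 1, \<dots>, v (2 * n - 2), v (2 * n - 1)\<close>.
  The vector space structure on functions is the pointwise one.
\<close>

instantiation "fun" :: (type, real_vector) real_vector
begin

definition scaleR_fun :: "real \<Rightarrow> ('a \<Rightarrow> 'b) \<Rightarrow> 'a \<Rightarrow> 'b" where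
  "scaleR_fun c f = (\<lambda>x. c *\<^sub>R f x)"

instance
  by standard (auto simp: scaleR_fun_def fun_eq_iff scaleR_right_distrib scaleR_left_distrib)

end

abbreviation RR :: "nat \<Rightarrow> (nat \<Rightarrow> real) set" where
  "RR d \<equiv> topspace (Euclidean_space d)"

definition enorm :: "nat \<Rightarrow> (nat \<Rightarrow> real) \<Rightarrow> real" where
  "enorm d x = L2_set x {..<d}"

definition Eball :: "nat \<Rightarrow> real \<Rightarrow> (nat \<Rightarrow> real) set" where
  "Eball d r = {x \<in> RR d. enorm d x < r}"

text \<open>
  The completion is needed because a convex set need not be Borel.  The product measure lives
  on functions that are \<^term>\<open>undefined\<close> outside \<open>{..<d}\<close>, hence \<^term>\<open>restrict\<close>.
\<close>

definition Vol :: "nat \<Rightarrow> (nat \<Rightarrow> real) set \<Rightarrow> real" where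
  "Vol d U = measure (completion (Pi\<^sub>M {..<d} (\<lambda>_. lborel))) ((\<lambda>x. restrict x {..<d}) ` U)"

text \<open>
  Boundedness is with respect to the Euclidean norm; the library constant \<^term>\<open>bounded\<close> on
  \<^typ>\<open>nat \<Rightarrow> real\<close> refers to a different (bounded) product metric.
\<close>

definition convex_body :: "nat \<Rightarrow> (nat \<Rightarrow> real) set \<Rightarrow> bool" where
  "convex_body d K \<longleftrightarrow> K \<subseteq> RR d \<and> convex K \<and> (\<exists>C. \<forall>x\<in>K. enorm d x \<le> C) \<and>
     Euclidean_space d interior_of K \<noteq> {}"


definition omega_st :: "nat \<Rightarrow> (nat \<Rightarrow> real) \<Rightarrow> (nat \<Rightarrow> real) \<Rightarrow> real" where
  "omega_st n u v = (\<Sum>j<n. u (2 * j) * v (2 * j + 1) - u (2 * j + 1) * v (2 * j))"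

definition Sp :: "nat \<Rightarrow> ((nat \<Rightarrow> real) \<Rightarrow> (nat \<Rightarrow> real)) set" where
  "Sp n = {\<psi>. \<psi> \<in> RR (2 * n) \<rightarrow> RR (2 * n) \<and>
     (\<forall>u\<in>RR (2 * n). \<forall>v\<in>RR (2 * n). \<psi> (u + v) = \<psi> u + \<psi> v) \<and>
     (\<forall>c. \<forall>u\<in>RR (2 * n). \<psi> (c *\<^sub>R u) = c *\<^sub>R \<psi> u) \<and>
     (\<forall>u\<in>RR (2 * n). \<forall>v\<in>RR (2 * n). omega_st n (\<psi> u) (\<psi> v) = omega_st n u v)}"

definition Zcyl :: "nat \<Rightarrow> real \<Rightarrow> (nat \<Rightarrow> real) set" where
  "Zcyl n r = {x \<in> RR (2 * n). enorm 2 x < r}"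

definition cZ_lin :: "nat \<Rightarrow> (nat \<Rightarrow> real) set \<Rightarrow> ereal" where
  "cZ_lin n U = Inf {ereal (pi * r\<^sup>2) | r. r > 0 \<and> (\<exists>\<psi>\<in>Sp n. \<psi> ` U \<subseteq> Zcyl n r)}"

text \<open>The common value of all normalized symplectic capacities on the unit ball of \<open>\<real>\<^sup>2\<^sup>n\<close>.\<close>

definition cap_unit_ball :: "nat \<Rightarrow> ereal" where
  "cap_unit_ball n = ereal pi"


text \<open>
  The norm of the space \<open>X\<^sub>K\<close>.  The gauge of \<open>K\<close> is a norm only if \<open>K = -K\<close>; for any other
  body, \<open>X\<^sub>K\<close> is understood as the normed space of the difference body \<open>K - K\<close>.
\<close>

definition sym_body :: "(nat \<Rightarrow> real) set \<Rightarrow> (nat \<Rightarrow> real) set" where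
  "sym_body K = (if uminus ` K = K then K else {x - y | x y. x \<in> K \<and> y \<in> K})"

definition gauge_norm :: "(nat \<Rightarrow> real) set \<Rightarrow> (nat \<Rightarrow> real) \<Rightarrow> real" where
  "gauge_norm B x = Inf {r. r > 0 \<and> x \<in> (\<lambda>y. r *\<^sub>R y) ` B}"

definition X_norm :: "(nat \<Rightarrow> real) set \<Rightarrow> (nat \<Rightarrow> real) \<Rightarrow> real" where
  "X_norm K = gauge_norm (sym_body K)"

definition Omega :: "nat \<Rightarrow> (nat \<Rightarrow> real) set" where
  "Omega m = {..<m} \<rightarrow>\<^sub>E {-1, 1}"

text \<open>Integration against the uniform probability measure on the finite set \<^term>\<open>Omega m\<close>.\<close>

definition mean :: "nat \<Rightarrow> ((nat \<Rightarrow> real) \<Rightarrow> 'b::real_vector) \<Rightarrow> 'b" where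
  "mean m F = (\<Sum>t\<in>Omega m. F t) /\<^sub>R real (card (Omega m))"

definition L2_X_norm :: "(nat \<Rightarrow> real) set \<Rightarrow> nat \<Rightarrow> ((nat \<Rightarrow> real) \<Rightarrow> (nat \<Rightarrow> real)) \<Rightarrow> real" where
  "L2_X_norm K m f = sqrt (mean m (\<lambda>t. (X_norm K (f t))\<^sup>2))"

definition Rad_op :: "nat \<Rightarrow> ((nat \<Rightarrow> real) \<Rightarrow> (nat \<Rightarrow> real)) \<Rightarrow> (nat \<Rightarrow> real) \<Rightarrow> (nat \<Rightarrow> real)" where
  "Rad_op m f = (\<lambda>s. \<Sum>i<m. s i *\<^sub>R mean m (\<lambda>t. t i *\<^sub>R f t))"

definition Rad_op_norm :: "nat \<Rightarrow> (nat \<Rightarrow> real) set \<Rightarrow> nat \<Rightarrow> ereal" where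
  "Rad_op_norm d K m =
     (SUP f \<in> {f. f \<in> Omega m \<rightarrow> RR d \<and> L2_X_norm K m f \<le> 1}. ereal (L2_X_norm K m (Rad_op m f)))"

definition Rad_const :: "nat \<Rightarrow> (nat \<Rightarrow> real) set \<Rightarrow> ereal" where
  "Rad_const d K = (SUP m\<in>{1..}. Rad_op_norm d K m)"

end

theory Submission
  imports Defs "Jordan_Normal_Form.Determinant" "HOL-Real_Asymp.Real_Asymp"
begin

text \<open>
  Write \<open>d = 2 * n\<close> and let \<open>L\<close> be the symmetric body \<open>sym_body K\<close>, with norm \<open>p\<close>, support
  function \<open>h\<close>, and \<open>J\<close> the standard complex structure.

  A linear symplectic map enters the cylindrical capacity only through the two functionals that are
  its first two coordinates, and any \<open>\<omega>(\<sqdot>, p\<^sub>1)\<close>, \<open>\<omega>(\<sqdot>, p\<^sub>2)\<close> with \<open>\<omega>(p\<^sub>1, p\<^sub>2) = 1\<close> occur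
  (\<open>Sp_pair_transitive\<close>).  After rescaling such a pair, the capacity of \<open>K\<close> is at most \<open>2 * pi / \<rho>\<close>
  whenever some functionals satisfy \<open>\<langle>v, J w\<rangle> > \<rho> * h w * h v\<close>.  If no pair does, the theorem of
  Hahn and Banach gives \<open>p (J w) \<le> \<rho> * h w\<close> for all \<open>w\<close>: the rotated polar body \<open>J L\<degree>\<close> lies in
  \<open>\<rho> L\<close>, hence \<open>vol L\<degree> \<le> \<rho>\<^sup>d * vol L\<close>.  So a lower bound for the volume product
  \<open>vol L * vol L\<degree>\<close> forbids small \<open>\<rho>\<close>.

  The lower bound comes from a position of \<open>L\<close> in the sense of Lewis, with random signs in the place of
  Gaussian variables.  Among the matrices \<open>A\<close> whose columns \<open>a\<^sub>j\<close> satisfy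
  \<open>E (p (\<Sum>j. t\<^sub>j a\<^sub>j))\<^sup>2 \<le> 1\<close>, choose one of maximal determinant.  The first order condition at the
  maximum (\<open>lewis_position\<close>) bounds the trace of \<open>A\<inverse> S\<close> by \<open>d\<close> times the same average for \<open>S\<close>; tested
  against Rademacher projections it says that the rows of \<open>A\<inverse>\<close> have average at most \<open>2 * d * Rad\<close>
  for the dual norm (\<open>dual_position_bound\<close>).  An average over signs bounds a volume from below: by the
  contraction principle every point \<open>x\<close> of the unit cube admits signs with
  \<open>p (\<Sum>j. t\<^sub>j x\<^sub>j a\<^sub>j) \<le> 1\<close>, so \<open>2\<^sup>d\<close> images of parts of the cube lie in \<open>L\<close> and
  \<open>\<bar>det A\<bar> \<le> 2\<^sup>d * vol L\<close>.  The same argument for \<open>J A\<inverse>\<^sup>T\<close> under the hypothesis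
  \<open>p (J w) \<le> \<rho> * h w\<close> and the product of the two estimates, in which the determinants cancel, give
  \<open>1 \<le> (8 * \<rho> * d * Rad)\<^sup>d * (vol L)\<^sup>2\<close> (\<open>det_le_volume_squared\<close>).

  Thus the capacity is at most a constant times \<open>d * Rad * (vol L)\<^bsup>1/n\<^esup>\<close>.  The unit ball satisfies
  \<open>d * (vol B)\<^bsup>1/n\<^esup> \<le> 4 * e\<^sup>2\<close>, and \<open>vol (K - K) \<le> 6\<^sup>d * vol K\<close> replaces \<open>L\<close> by \<open>K\<close>.  Finally
  \<open>Rad \<le> Rad\<^sup>2\<close> because \<open>Rad \<ge> 1\<close>.
\<close>

section \<open>Matrices of variable size and linear changes of variables\<close>

text \<open>
  Matrices are functions of two indices of which only the entries below \<open>d\<close> matter.  The functions on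
  \<open>nat \<Rightarrow> nat \<Rightarrow> real\<close> carry the product topology, in which the compactness argument for the Lewis
  position takes place; determinants are those of the carrier-based matrix library.
\<close>

definition mmul :: "nat \<Rightarrow> (nat \<Rightarrow> nat \<Rightarrow> real) \<Rightarrow> (nat \<Rightarrow> nat \<Rightarrow> real) \<Rightarrow> nat \<Rightarrow> nat \<Rightarrow> real" where
  "mmul d A B = (\<lambda>i j. \<Sum>k<d. A i k * B k j)"

definition mapp :: "nat \<Rightarrow> (nat \<Rightarrow> nat \<Rightarrow> real) \<Rightarrow> (nat \<Rightarrow> real) \<Rightarrow> nat \<Rightarrow> real" where
  "mapp d A x = (\<lambda>i\<in>{..<d}. \<Sum>j<d. A i j * x j)"

definition mdet :: "nat \<Rightarrow> (nat \<Rightarrow> nat \<Rightarrow> real) \<Rightarrow> real" where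
  "mdet d A = Determinant.det (Matrix.mat d d (\<lambda>(i, j). A i j))"

definition mone :: "nat \<Rightarrow> nat \<Rightarrow> real" where
  "mone i j = (if i = j then 1 else 0)"

lemma mdet_cong: "(\<And>i j. i < d \<Longrightarrow> j < d \<Longrightarrow> A i j = B i j) \<Longrightarrow> mdet d A = mdet d B"
  unfolding mdet_def by (rule arg_cong[where f = Determinant.det]) auto

lemma mdet_leibniz:
  "mdet d A = (\<Sum>p | p permutes {..<d}. of_int (sign p) * (\<Prod>i<d. A i (p i)))"
proof -
  have "mdet d A = (\<Sum>p | p permutes {0..<d}. of_int (sign p) * (\<Prod>i = 0..<d. Matrix.mat d d (\<lambda>(i, j). A i j) $$ (i, p i)))"
    unfolding mdet_def by (rule det_def') simp
  also have "\<dots> = (\<Sum>p | p permutes {0..<d}. of_int (sign p) * (\<Prod>i = 0..<d. A i (p i)))"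
  proof (rule sum.cong[OF refl])
    fix p assume "p \<in> {p. p permutes {0..<d}}"
    then have "(\<Prod>i = 0..<d. Matrix.mat d d (\<lambda>(i, j). A i j) $$ (i, p i)) = (\<Prod>i = 0..<d. A i (p i))"
      by (intro prod.cong refl) (auto dest: permutes_in_image)
    then show "of_int (sign p) * (\<Prod>i = 0..<d. Matrix.mat d d (\<lambda>(i, j). A i j) $$ (i, p i)) = of_int (sign p) * (\<Prod>i = 0..<d. A i (p i))"
      by simp
  qed
  finally show ?thesis by (simp add: atLeast0LessThan)
qed

lemma mdet_mmul: "mdet d (mmul d A B) = mdet d A * mdet d B"
proof -
  have "Matrix.mat d d (\<lambda>(i, j). mmul d A B i j) =
        Matrix.mat d d (\<lambda>(i, j). A i j) * Matrix.mat d d (\<lambda>(i, j). B i j)"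
    by (rule eq_matI) (auto simp: mmul_def scalar_prod_def atLeast0LessThan)
  then show ?thesis
    unfolding mdet_def by (simp add: det_mult[of _ d])
qed

lemma mdet_mone: "mdet d mone = 1"
proof -
  have "Matrix.mat d d (\<lambda>(i, j). mone i j) = 1\<^sub>m d"
    by (rule eq_matI) (auto simp: mone_def)
  then show ?thesis by (simp add: mdet_def)
qed

lemma permutes_not_id_moves_other:
  assumes p: "p permutes S" "p \<noteq> id"
  shows "\<exists>k\<in>S - {i}. p k \<noteq> k"
proof (rule ccontr)
  assume n: "\<not> ?thesis"
  have fx: "p k = k" if "k \<noteq> i" for k
  proof (cases "k \<in> S")
    case True
    with n that show ?thesis by blast
  next
    case False
    with permutes_not_in[OF p(1), of k] show ?thesis by simp
  qed
  moreover have "p i = i"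
  proof (rule ccontr)
    assume pi: "p i \<noteq> i"
    then have "p (p i) = p i" by (rule fx)
    with injD[OF permutes_inj[OF p(1)]] pi show False by blast
  qed
  ultimately have "p k = k" for k by (cases "k = i") simp_all
  then have "p = id" by (simp add: fun_eq_iff)
  with p(2) show False by simp
qed

lemma mdet_transpose: "mdet d (\<lambda>i j. A j i) = mdet d A"
proof -
  have "Matrix.mat d d (\<lambda>(i, j). A j i) = (Matrix.mat d d (\<lambda>(i, j). A i j))\<^sup>T"
    by (rule eq_matI) auto
  then show ?thesis unfolding mdet_def by (simp add: det_transpose[of _ d])
qed

text \<open>
  The elementary matrices below are all of the form \<open>mone(i := a)\<close>.  In the Leibniz formula a permutation
  that moves something moves an index other than \<open>i\<close>, where the row is a unit vector, so only the
  identity contributes.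
\<close>

lemma mdet_row_replace:
  assumes i: "i < d"
  shows "mdet d (mone(i := a)) = a i"
proof -
  have "(\<Prod>k<d. (mone(i := a)) k (p k)) = 0" if p: "p permutes {..<d}" "p \<noteq> id" for p
  proof -
    obtain k where "k \<in> {..<d} - {i}" "p k \<noteq> k"
      using permutes_not_id_moves_other[OF p] by blast
    then obtain k where "k \<in> {..<d}" "(mone(i := a)) k (p k) = 0"
      by (auto simp: mone_def)
    then show ?thesis by (intro prod_zero) blast+
  qed
  then have "(\<Sum>p\<in>{p. p permutes {..<d}} - {id}. of_int (sign p) * (\<Prod>k<d. (mone(i := a)) k (p k))) = 0"
    by (intro sum.neutral ballI) (simp del: prod_zero_iff fun_upd_apply)
  moreover have "mdet d (mone(i := a)) = of_int (sign (id :: nat \<Rightarrow> nat)) * (\<Prod>k<d. (mone(i := a)) k (id k))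
      + (\<Sum>p\<in>{p. p permutes {..<d}} - {id}. of_int (sign p) * (\<Prod>k<d. (mone(i := a)) k (p k)))"
    unfolding mdet_leibniz
    by (rule sum.remove[of "{p. p permutes {..<d}}" id "\<lambda>p. of_int (sign p) * (\<Prod>k<d. (mone(i := a)) k (p k))"])
      (simp_all add: finite_permutations permutes_id)
  moreover have "(\<Prod>k<d. (mone(i := a)) k (id k)) = (\<Prod>k<d. if k = i then a i else 1)"
    by (rule prod.cong) (auto simp: mone_def)
  ultimately show ?thesis using i by (simp add: sign_id)
qed

text \<open>
  If the rows below \<open>k\<close> are unit vectors and row \<open>k\<close> has no entry up to the diagonal, then row \<open>k\<close> is a
  combination of the later rows; the row operation that subtracts this combination produces a zero row.
\<close>

lemma mdet_zero_if_row_kernel: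
  assumes "k < d" "\<And>j. j < d \<Longrightarrow> A k j = (if j \<le> k then 0 else A k j)"
    and "\<And>i j. k < i \<Longrightarrow> i < d \<Longrightarrow> j < d \<Longrightarrow> A i j = mone i j"
  shows "mdet d A = 0"
proof -
  define r where "r = (\<lambda>j. if j = k then 1 else if k < j then - A k j else 0)"
  have "mdet d (mmul d (mone(k := r)) A) = 0"
  proof -
    have z: "mmul d (mone(k := r)) A k j = 0" if j: "j < d" for j
    proof -
      have "mmul d (mone(k := r)) A k j = (\<Sum>l<d. (if l = k then A k j else 0) + (if l = j then (if k < j then - A k j else 0) else 0))"
        unfolding mmul_def using assms j
        by (intro sum.cong refl) (auto simp: r_def mone_def)
      also have "\<dots> = A k j + (if k < j then - A k j else 0)"
        using assms(1) j by (simp add: sum.distrib)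
      also have "\<dots> = 0" using assms(2)[OF j] by (auto split: if_splits)
      finally show ?thesis .
    qed
    have "(\<Prod>i<d. mmul d (mone(k := r)) A i (p i)) = 0" if "p permutes {..<d}" for p
      using that assms(1) z permutes_in_image[OF that, of k] by (intro prod_zero) auto
    then show ?thesis unfolding mdet_leibniz by (intro sum.neutral ballI) (simp del: prod_zero_iff)
  qed
  moreover have "mdet d (mone(k := r)) = 1"
    using mdet_row_replace[OF assms(1)] by (simp add: r_def)
  ultimately show ?thesis by (simp add: mdet_mmul)
qed

abbreviation leb :: "nat \<Rightarrow> (nat \<Rightarrow> real) measure" where
  "leb d \<equiv> Pi\<^sub>M {..<d} (\<lambda>_. lborel)"

interpretation leb: product_sigma_finite "\<lambda>_::nat. lborel :: real measure"
  by standard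

lemma measurable_mapp [measurable]: "mapp d A \<in> measurable (leb d) (leb d)"
  unfolding mapp_def by measurable

lemma mapp_mapp: "mapp d A (mapp d B x) = mapp d (mmul d A B) x"
proof
  fix i
  have "(\<Sum>j<d. A i j * mapp d B x j) = (\<Sum>j<d. \<Sum>k<d. A i j * B j k * x k)"
    by (intro sum.cong refl) (simp add: mapp_def sum_distrib_left mult.assoc)
  also have "\<dots> = (\<Sum>k<d. \<Sum>j<d. A i j * B j k * x k)"
    by (rule sum.swap)
  also have "\<dots> = (\<Sum>k<d. mmul d A B i k * x k)"
    by (intro sum.cong refl) (simp add: mmul_def sum_distrib_right)
  finally have "(\<Sum>j<d. A i j * mapp d B x j) = (\<Sum>k<d. mmul d A B i k * x k)" .
  then show "mapp d A (mapp d B x) i = mapp d (mmul d A B) x i"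
    by (simp add: mapp_def[of d A] mapp_def[of d "mmul d A B"])
qed

text \<open>
  The change of variables formula for \<open>A\<close> on the product measure, for all integrands at once: in this
  form it passes to products of matrices.
\<close>

definition scales_leb :: "nat \<Rightarrow> (nat \<Rightarrow> nat \<Rightarrow> real) \<Rightarrow> bool" where
  "scales_leb d A \<longleftrightarrow> (\<forall>f \<in> borel_measurable (leb d).
     (\<integral>\<^sup>+x. f x \<partial>leb d) = ennreal \<bar>mdet d A\<bar> * (\<integral>\<^sup>+x. f (mapp d A x) \<partial>leb d))"

lemma scales_leb_mmul:
  assumes "scales_leb d A" "scales_leb d B"
  shows "scales_leb d (mmul d A B)"
  unfolding scales_leb_def
proof
  fix f :: "(nat \<Rightarrow> real) \<Rightarrow> ennreal" assume f [measurable]: "f \<in> borel_measurable (leb d)"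
  have "(\<integral>\<^sup>+x. f x \<partial>leb d) = ennreal \<bar>mdet d A\<bar> * (\<integral>\<^sup>+x. f (mapp d A x) \<partial>leb d)"
    using assms(1) f unfolding scales_leb_def by (rule bspec)
  also have "(\<integral>\<^sup>+x. f (mapp d A x) \<partial>leb d) = ennreal \<bar>mdet d B\<bar> * (\<integral>\<^sup>+x. f (mapp d A (mapp d B x)) \<partial>leb d)"
    using assms(2) unfolding scales_leb_def by (rule bspec) simp
  finally show "(\<integral>\<^sup>+x. f x \<partial>leb d) = ennreal \<bar>mdet d (mmul d A B)\<bar> * (\<integral>\<^sup>+x. f (mapp d (mmul d A B) x) \<partial>leb d)"
    by (simp add: mdet_mmul abs_mult ennreal_mult mult.assoc mapp_mapp)
qed

lemma scales_leb_cong: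
  assumes "\<And>i j. i < d \<Longrightarrow> j < d \<Longrightarrow> A i j = B i j" and "scales_leb d A"
  shows "scales_leb d B"
proof -
  have "mapp d A x = mapp d B x" for x
    using assms(1) by (auto simp: mapp_def fun_eq_iff restrict_def intro!: sum.cong)
  moreover have "mdet d A = mdet d B" by (rule mdet_cong) (rule assms(1))
  ultimately have "scales_leb d A = scales_leb d B" by (simp only: scales_leb_def)
  with assms(2) show ?thesis by simp
qed

lemma nn_integral_leb_split:
  assumes i: "i < d" and [measurable]: "f \<in> borel_measurable (leb d)"
  shows "(\<integral>\<^sup>+x. f x \<partial>leb d) = (\<integral>\<^sup>+x. (\<integral>\<^sup>+y. f (x(i := y)) \<partial>lborel) \<partial>Pi\<^sub>M ({..<d} - {i}) (\<lambda>_. lborel))"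
proof -
  have *: "insert i ({..<d} - {i}) = {..<d}" using i by auto
  show ?thesis
    using leb.product_nn_integral_insert[of "{..<d} - {i}" i f, unfolded *] by simp
qed

text \<open>
  For fixed other coordinates, the map \<open>mone(i := a)\<close> is an affine map of the \<open>i\<close>-th coordinate with
  slope \<open>a i\<close>, so the formula is Fubini and the one-dimensional case.
\<close>

lemma scales_leb_row_replace:
  assumes i: "i < d" and a: "a i \<noteq> 0"
  shows "scales_leb d (mone(i := a))"
  unfolding scales_leb_def
proof
  fix f :: "(nat \<Rightarrow> real) \<Rightarrow> ennreal" assume f [measurable]: "f \<in> borel_measurable (leb d)"
  let ?R = "mone(i := a)" and ?J = "{..<d} - {i}"
  have ins: "insert i ?J = {..<d}" using i by auto
  have upd: "mapp d ?R (x(i := y)) = x(i := (\<Sum>j\<in>?J. a j * x j) + a i * y)"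
    if x: "x \<in> space (Pi\<^sub>M ?J (\<lambda>_. lborel))" for x y
  proof
    fix k
    have "(\<Sum>j<d. mone k j * (x(i := y)) j) = x k" if "k < d" "k \<noteq> i"
    proof -
      have "(\<Sum>j<d. mone k j * (x(i := y)) j) = (\<Sum>j<d. if j = k then x k else 0)"
        using that by (intro sum.cong) (auto simp: mone_def)
      then show ?thesis using that by simp
    qed
    moreover have "(\<Sum>j<d. a j * (x(i := y)) j) = (\<Sum>j\<in>?J. a j * x j) + a i * y"
      using i by (subst sum.remove[of _ i]) auto
    moreover have "x k = undefined" if "\<not> k < d"
      using that x by (auto simp: space_PiM PiE_def extensional_def)
    ultimately show "mapp d ?R (x(i := y)) k = (x(i := (\<Sum>j\<in>?J. a j * x j) + a i * y)) k"
      using i by (auto simp: mapp_def restrict_def)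
  qed
  have "(\<integral>\<^sup>+x. f x \<partial>leb d) = (\<integral>\<^sup>+x. (\<integral>\<^sup>+y. f (x(i := y)) \<partial>lborel) \<partial>Pi\<^sub>M ?J (\<lambda>_. lborel))"
    by (rule nn_integral_leb_split[OF i]) simp
  also have "\<dots> = (\<integral>\<^sup>+x. ennreal \<bar>a i\<bar> * (\<integral>\<^sup>+y. f (mapp d ?R (x(i := y))) \<partial>lborel) \<partial>Pi\<^sub>M ?J (\<lambda>_. lborel))"
  proof (rule nn_integral_cong)
    fix x assume x: "x \<in> space (Pi\<^sub>M ?J (\<lambda>_. lborel :: real measure))"
    have "(\<lambda>y. x(i := y)) \<in> measurable lborel (Pi\<^sub>M (insert i ?J) (\<lambda>_. lborel))"
      using x by (intro measurable_component_update) auto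
    then have m: "(\<lambda>y. f (x(i := y))) \<in> borel_measurable borel"
      unfolding ins by (simp add: measurable_compose[OF _ f])
    show "(\<integral>\<^sup>+y. f (x(i := y)) \<partial>lborel) = ennreal \<bar>a i\<bar> * (\<integral>\<^sup>+y. f (mapp d ?R (x(i := y))) \<partial>lborel)"
      unfolding upd[OF x] by (rule nn_integral_real_affine[OF m a])
  qed
  also have "\<dots> = ennreal \<bar>a i\<bar> * (\<integral>\<^sup>+x. (\<integral>\<^sup>+y. f (mapp d ?R (x(i := y))) \<partial>lborel) \<partial>Pi\<^sub>M ?J (\<lambda>_. lborel))"
  proof (rule nn_integral_cmult)
    have upd_m: "(\<lambda>(x, y). x(i := y)) \<in> measurable (Pi\<^sub>M ?J (\<lambda>_. lborel) \<Otimes>\<^sub>M (lborel :: real measure)) (Pi\<^sub>M (insert i ?J) (\<lambda>_. lborel))"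
      by (rule measurable_add_dim)
    have "(\<lambda>(x, y). f (mapp d ?R (x(i := y)))) \<in> borel_measurable (Pi\<^sub>M ?J (\<lambda>_. lborel) \<Otimes>\<^sub>M (lborel :: real measure))"
      using measurable_compose[OF upd_m, unfolded ins, OF measurable_compose[OF measurable_mapp[of d ?R] f]]
      by (simp add: case_prod_beta')
    then show "(\<lambda>x. \<integral>\<^sup>+y. f (mapp d ?R (x(i := y))) \<partial>lborel) \<in> borel_measurable (Pi\<^sub>M ?J (\<lambda>_. lborel))"
      by (rule lborel.borel_measurable_nn_integral)
  qed
  also have "(\<integral>\<^sup>+x. (\<integral>\<^sup>+y. f (mapp d ?R (x(i := y))) \<partial>lborel) \<partial>Pi\<^sub>M ?J (\<lambda>_. lborel)) = (\<integral>\<^sup>+x. f (mapp d ?R x) \<partial>leb d)"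
    by (rule nn_integral_leb_split[OF i, symmetric]) simp
  finally show "(\<integral>\<^sup>+x. f x \<partial>leb d) = ennreal \<bar>mdet d ?R\<bar> * (\<integral>\<^sup>+x. f (mapp d ?R x) \<partial>leb d)"
    by (simp only: mdet_row_replace[OF i])
qed

lemma mmul_row_replace:
  assumes "k < d" "j < d"
  shows "mmul d A (mone(k := a)) i j = (if j = k then 0 else A i j) + A i k * a j"
proof -
  have "mmul d A (mone(k := a)) i j = (\<Sum>l<d. (if l = j then if j = k then 0 else A i j else 0) + (if l = k then A i k * a j else 0))"
    unfolding mmul_def by (intro sum.cong) (auto simp: mone_def)
  then show ?thesis using assms by (simp add: sum.distrib)
qed

text \<open>
  One step of Gaussian elimination: with a nonzero pivot at \<open>(k, k)\<close> the matrix \<open>A\<close> is \<open>B\<close> times the row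
  operation that installs row \<open>k\<close> of \<open>A\<close>, where \<open>B\<close> has one more unit row.
\<close>

lemma scales_leb_if_pivot:
  assumes k: "k < d" and piv: "A k k \<noteq> 0"
    and unit_rows: "\<And>i j. Suc k \<le> i \<Longrightarrow> i < d \<Longrightarrow> j < d \<Longrightarrow> A i j = mone i j"
    and det: "mdet d A \<noteq> 0"
    and IH: "\<And>B. (\<And>i j. k \<le> i \<Longrightarrow> i < d \<Longrightarrow> j < d \<Longrightarrow> B i j = mone i j) \<Longrightarrow> mdet d B \<noteq> 0 \<Longrightarrow> scales_leb d B"
  shows "scales_leb d A"
proof -
  define B where "B = (\<lambda>i j. if i = k then mone i j else if j = k then A i k / A k k else A i j - A i k / A k k * A k j)"
  let ?R = "mone(k := A k)"
  have AB: "mmul d B ?R i j = A i j" if "i < d" "j < d" for i j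
    using that k piv by (auto simp: mmul_row_replace B_def mone_def)
  have B1: "B i j = mone i j" if "k \<le> i" "i < d" "j < d" for i j
    using that unit_rows[of i j] unit_rows[of i k] k by (auto simp: B_def mone_def)
  have "mdet d (mmul d B ?R) = mdet d A" by (rule mdet_cong) (rule AB)
  with det have "mdet d B \<noteq> 0" by (auto simp: mdet_mmul)
  then have "scales_leb d B" using B1 by (intro IH) auto
  moreover have "scales_leb d ?R"
    by (rule scales_leb_row_replace) (rule k, rule piv)
  ultimately have "scales_leb d (mmul d B ?R)"
    by (rule scales_leb_mmul)
  with AB show ?thesis by (rule scales_leb_cong)
qed

text \<open>
  Induction on the number of rows that are not yet unit vectors.  A vanishing pivot is repaired by adding
  column \<open>j < k\<close> to column \<open>k\<close>, for some nonzero entry \<open>A k j\<close>; it exists since the determinant is nonzero.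
\<close>

lemma scales_leb_if_unit_rows:
  assumes "k \<le> d" "\<And>i j. k \<le> i \<Longrightarrow> i < d \<Longrightarrow> j < d \<Longrightarrow> A i j = mone i j" "mdet d A \<noteq> 0"
  shows "scales_leb d A"
  using assms
proof (induction k arbitrary: A)
  case 0
  have "mapp d A x = x" if "x \<in> space (leb d)" for x
  proof
    fix i
    have "(\<Sum>j<d. A i j * x j) = (\<Sum>j<d. if j = i then x i else 0)" if "i < d"
      using 0(2) that by (intro sum.cong) (auto simp: mone_def)
    then show "mapp d A x i = x i" using that
      by (auto simp: mapp_def restrict_def space_PiM PiE_def extensional_def)
  qed
  moreover have "mdet d A = 1"
    using mdet_cong[of d A mone, OF 0(2)] by (simp add: mdet_mone)
  ultimately show ?case by (auto simp: scales_leb_def intro!: nn_integral_cong)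
next
  case (Suc k)
  have IH: "scales_leb d B" if "\<And>i j. k \<le> i \<Longrightarrow> i < d \<Longrightarrow> j < d \<Longrightarrow> B i j = mone i j" "mdet d B \<noteq> 0" for B
    by (rule Suc.IH) (use Suc.prems(1) that in simp_all)
  have k: "k < d" using Suc.prems(1) by simp
  show ?case
  proof (cases "A k k = 0")
    case False
    show ?thesis
      by (rule scales_leb_if_pivot[OF k False Suc.prems(2,3) IH])
  next
    case True
    obtain j where j: "j < k" "A k j \<noteq> 0"
    proof (rule ccontr)
      assume "\<not> thesis"
      with that have "A k j = 0" if "j < k" for j using that by blast
      with True have "A k j = (if j \<le> k then 0 else A k j)" for j
        by (cases "j = k") auto
      then have "mdet d A = 0"
        by (rule mdet_zero_if_row_kernel[OF k]) (rule Suc.prems(2), auto)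
      with Suc.prems(3) show False by simp
    qed
    have jd: "j < d" using j k by simp
    let ?R = "mone(j := \<lambda>l. mone j l + mone k l)" and ?R' = "mone(j := \<lambda>l. mone j l - mone k l)"
    have C: "mmul d A ?R i l = A i l + (if l = k then A i j else 0)" if "l < d" for i l
      using that jd j by (auto simp: mmul_row_replace mone_def)
    have "mdet d ?R = 1" using mdet_row_replace[OF jd] j by (simp add: mone_def)
    then have "mdet d (mmul d A ?R) \<noteq> 0" using Suc.prems(3) by (simp add: mdet_mmul)
    moreover have "mmul d A ?R k k \<noteq> 0" using C[OF k, of k] True j by simp
    moreover have "mmul d A ?R i l = mone i l" if "Suc k \<le> i" "i < d" "l < d" for i l
      using C[of l i] Suc.prems(2)[of i l] Suc.prems(2)[of i j] that jd j by (auto simp: mone_def)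
    ultimately have "scales_leb d (mmul d A ?R)"
      by (intro scales_leb_if_pivot[OF k _ _ _ IH]) auto
    moreover have "scales_leb d ?R'"
      using jd j by (intro scales_leb_row_replace) (auto simp: mone_def)
    ultimately have "scales_leb d (mmul d (mmul d A ?R) ?R')"
      by (rule scales_leb_mmul)
    moreover have "mmul d (mmul d A ?R) ?R' i l = A i l" if "l < d" for i l
      using that jd j k by (auto simp: mmul_row_replace mone_def)
    ultimately show ?thesis by (intro scales_leb_cong[of d "mmul d (mmul d A ?R) ?R'" A]) auto
  qed
qed

lemma nn_integral_leb_linear:
  assumes "mdet d A \<noteq> 0" and "f \<in> borel_measurable (leb d)"
  shows "(\<integral>\<^sup>+x. f x \<partial>leb d) = ennreal \<bar>mdet d A\<bar> * (\<integral>\<^sup>+x. f (mapp d A x) \<partial>leb d)"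
proof -
  have "scales_leb d A"
    by (rule scales_leb_if_unit_rows[OF order_refl _ assms(1)]) simp
  then show ?thesis using assms(2) unfolding scales_leb_def by (rule bspec)
qed

section \<open>Norms on R^d and the volume of their balls\<close>

lemma RR_iff: "x \<in> RR d \<longleftrightarrow> (\<forall>i\<ge>d. x i = 0)"
  by (simp add: topspace_Euclidean_space)

lemma scaleR_fun_apply [simp]: "(c *\<^sub>R f) x = c *\<^sub>R f x"
  by (simp add: scaleR_fun_def)

lemma RR_zero [simp, intro]: "0 \<in> RR d"
  and RR_add [simp, intro]: "x \<in> RR d \<Longrightarrow> y \<in> RR d \<Longrightarrow> x + y \<in> RR d"
  and RR_diff [simp, intro]: "x \<in> RR d \<Longrightarrow> y \<in> RR d \<Longrightarrow> x - y \<in> RR d"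
  and RR_uminus [simp, intro]: "x \<in> RR d \<Longrightarrow> - x \<in> RR d"
  and RR_scaleR [simp, intro]: "x \<in> RR d \<Longrightarrow> c *\<^sub>R x \<in> RR d"
  by (simp_all add: RR_iff)

lemma sum_fun_apply: "(\<Sum>i\<in>I. f i) x = (\<Sum>i\<in>I. f i x)"
  by (induction I rule: infinite_finite_induct) auto

lemma RR_sum: "(\<And>i. i \<in> I \<Longrightarrow> f i \<in> RR d) \<Longrightarrow> (\<Sum>i\<in>I. f i) \<in> RR d"
  by (simp add: RR_iff sum_fun_apply)

definition basis_vec :: "nat \<Rightarrow> nat \<Rightarrow> real" where
  "basis_vec i = (\<lambda>j. if j = i then 1 else 0)"

lemma RR_basis_vec: "i < d \<Longrightarrow> basis_vec i \<in> RR d"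
  by (simp add: RR_iff basis_vec_def)

text \<open>
  The product measure lives on functions that are undefined from \<open>d\<close> on, while \<^term>\<open>RR d\<close> consists of
  functions that vanish there; this map translates the former into the latter.
\<close>

definition trunc :: "nat \<Rightarrow> (nat \<Rightarrow> real) \<Rightarrow> nat \<Rightarrow> real" where
  "trunc d x = (\<lambda>i. if i < d then x i else 0)"

lemma trunc_apply [simp]: "i < d \<Longrightarrow> trunc d x i = x i"
  by (simp add: trunc_def)

lemma trunc_RR [simp, intro]: "trunc d x \<in> RR d"
  by (simp add: trunc_def RR_iff)

lemma trunc_trunc [simp]: "trunc d (trunc d x) = trunc d x"
  by (auto simp: trunc_def)

lemma trunc_id: "x \<in> RR d \<Longrightarrow> trunc d x = x"
  by (auto simp: trunc_def RR_iff)

lemma trunc_restrict [simp]: "trunc d (restrict x {..<d}) = trunc d x"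
  by (auto simp: trunc_def)

lemma restrict_trunc: "x \<in> space (leb d) \<Longrightarrow> restrict (trunc d x) {..<d} = x"
  by (auto simp: space_PiM PiE_def extensional_def restrict_def trunc_def)

lemma RR_basis_expansion: "x \<in> RR d \<Longrightarrow> x = (\<Sum>i<d. x i *\<^sub>R basis_vec i)"
  by (auto simp: fun_eq_iff sum_fun_apply basis_vec_def RR_iff if_distrib cong: if_cong)

text \<open>
  Borel sets of the product topology on \<open>nat \<Rightarrow> real\<close> are the product \<open>\<sigma>\<close>-algebra, so continuity for that
  topology yields measurability of functions of \<open>d\<close> coordinates.
\<close>

lemma measurable_trunc_coords:
  assumes "continuous_on UNIV (\<lambda>x :: nat \<Rightarrow> real. F x :: real)"
  shows "(\<lambda>x. F (trunc d x)) \<in> borel_measurable (leb d)"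
proof -
  have "trunc d \<in> measurable (leb d) (Pi\<^sub>M UNIV (\<lambda>_. borel))"
  proof (rule measurable_PiM_single')
    show "(\<lambda>x. trunc d x i) \<in> borel_measurable (leb d)" for i
      by (cases "i < d") (auto simp: trunc_def)
  qed auto
  then have "trunc d \<in> measurable (leb d) borel"
    by (simp add: measurable_cong_sets[OF refl sets_PiM_equal_borel])
  then show ?thesis
    by (rule measurable_compose) (rule borel_measurable_continuous_onI[OF assms])
qed

text \<open>
  Norms on \<^term>\<open>RR d\<close> except that \<open>N (- x) = N x\<close> is not required, so that gauges of bodies that are not
  centrally symmetric are included.
\<close>

locale asym_norm =
  fixes d :: nat and N :: "(nat \<Rightarrow> real) \<Rightarrow> real"
  assumes N_add: "x \<in> RR d \<Longrightarrow> y \<in> RR d \<Longrightarrow> N (x + y) \<le> N x + N y"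
    and N_scale: "x \<in> RR d \<Longrightarrow> 0 \<le> c \<Longrightarrow> N (c *\<^sub>R x) = c * N x"
    and N_coercive: "\<exists>C. \<forall>x\<in>RR d. \<forall>i<d. \<bar>x i\<bar> \<le> C * N x"
    and N_nonneg: "x \<in> RR d \<Longrightarrow> 0 \<le> N x"
begin

lemma N_zero [simp]: "N 0 = 0"
  using N_scale[of 0 0] by simp

lemma N_sum: "finite I \<Longrightarrow> (\<And>i. i \<in> I \<Longrightarrow> f i \<in> RR d) \<Longrightarrow> N (\<Sum>i\<in>I. f i) \<le> (\<Sum>i\<in>I. N (f i))"
proof (induction I rule: finite_induct)
  case (insert i I)
  have "N (f i + (\<Sum>i\<in>I. f i)) \<le> N (f i) + N (\<Sum>i\<in>I. f i)"
    using insert by (intro N_add RR_sum) auto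
  moreover have "N (\<Sum>i\<in>I. f i) \<le> (\<Sum>i\<in>I. N (f i))"
    using insert by blast
  ultimately show ?case unfolding sum.insert[OF insert(1,2)] by linarith
qed simp

lemma N_upper: "\<exists>C>0. \<forall>x\<in>RR d. N x \<le> C * (\<Sum>i<d. \<bar>x i\<bar>)"
proof -
  define C where "C = 1 + (\<Sum>i<d. N (basis_vec i) + N (- basis_vec i))"
  have nn: "0 \<le> N (basis_vec i) + N (- basis_vec i)" if "i < d" for i
    using that by (simp add: N_nonneg RR_basis_vec)
  have "N x \<le> C * (\<Sum>i<d. \<bar>x i\<bar>)" if x: "x \<in> RR d" for x
  proof -
    have "N x = N (\<Sum>i<d. x i *\<^sub>R basis_vec i)" using RR_basis_expansion[OF x] by simp
    also have "\<dots> \<le> (\<Sum>i<d. N (x i *\<^sub>R basis_vec i))"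
      by (intro N_sum) (auto simp: RR_basis_vec)
    also have "\<dots> \<le> (\<Sum>i<d. C * \<bar>x i\<bar>)"
    proof (rule sum_mono)
      fix i assume "i \<in> {..<d}"
      then have i: "i < d" by simp
      have CC: "N (basis_vec i) + N (- basis_vec i) \<le> C"
        using member_le_sum[of i "{..<d}" "\<lambda>i. N (basis_vec i) + N (- basis_vec i)"] nn i
        by (auto simp: C_def)
      have u: "0 \<le> N (basis_vec i)" "0 \<le> N (- basis_vec i)"
        using i by (auto simp: N_nonneg RR_basis_vec)
      show "N (x i *\<^sub>R basis_vec i) \<le> C * \<bar>x i\<bar>"
      proof (cases "0 \<le> x i")
        case True
        then have "N (x i *\<^sub>R basis_vec i) = x i * N (basis_vec i)" using i by (simp add: N_scale RR_basis_vec)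
        also have "\<dots> \<le> x i * C" using True CC u by (intro mult_left_mono) auto
        finally show ?thesis using True by (simp add: mult.commute)
      next
        case False
        have "x i *\<^sub>R basis_vec i = (- x i) *\<^sub>R (- basis_vec i)" by simp
        then have "N (x i *\<^sub>R basis_vec i) = (- x i) * N (- basis_vec i)"
          using False i by (simp only: N_scale RR_basis_vec RR_uminus)
        also have "\<dots> \<le> (- x i) * C" using False CC u by (intro mult_left_mono) auto
        finally show ?thesis using False by (simp add: mult.commute)
      qed
    qed
    finally show ?thesis by (simp add: sum_distrib_left)
  qed
  moreover have "C > 0" unfolding C_def using nn by (intro add_pos_nonneg sum_nonneg) auto
  ultimately show ?thesis by blast
qed

lemma N_diff_le: "x \<in> RR d \<Longrightarrow> y \<in> RR d \<Longrightarrow> N x - N y \<le> N (x - y)"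
  using N_add[of "x - y" y] by simp

lemma continuous_N_trunc: "continuous_on UNIV (\<lambda>x. N (trunc d x))"
proof -
  obtain C where C: "C > 0" "\<And>x. x \<in> RR d \<Longrightarrow> N x \<le> C * (\<Sum>i<d. \<bar>x i\<bar>)"
    using N_upper by blast
  have lip: "\<bar>N (trunc d x) - N (trunc d a)\<bar> \<le> C * (\<Sum>i<d. \<bar>x i - a i\<bar>)" for x a
  proof -
    have "N (trunc d x) - N (trunc d a) \<le> C * (\<Sum>i<d. \<bar>x i - a i\<bar>)" for x a
    proof -
      have "N (trunc d x) - N (trunc d a) \<le> N (trunc d x - trunc d a)" by (intro N_diff_le) auto
      also have "\<dots> \<le> C * (\<Sum>i<d. \<bar>(trunc d x - trunc d a) i\<bar>)" by (intro C) auto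
      also have "(\<Sum>i<d. \<bar>(trunc d x - trunc d a) i\<bar>) = (\<Sum>i<d. \<bar>x i - a i\<bar>)" by simp
      finally show ?thesis .
    qed
    from this[of x a] this[of a x] show ?thesis by (simp add: abs_minus_commute abs_le_iff)
  qed
  show ?thesis
    unfolding continuous_on_def
  proof
    fix a :: "nat \<Rightarrow> real"
    have coord: "((\<lambda>x. x i) \<longlongrightarrow> a i) (at a)" for i
      using continuous_on_product_coordinates[of i] unfolding continuous_on_def by (metis UNIV_I)
    have "((\<lambda>x. C * (\<Sum>i<d. \<bar>x i - a i\<bar>)) \<longlongrightarrow> C * (\<Sum>i<d. \<bar>a i - a i\<bar>)) (at a)"
      by (intro tendsto_intros coord)
    then have "((\<lambda>x. C * (\<Sum>i<d. \<bar>x i - a i\<bar>)) \<longlongrightarrow> 0) (at a)"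
      by simp
    then have "((\<lambda>x. N (trunc d x) - N (trunc d a)) \<longlongrightarrow> 0) (at a)"
      by (rule Lim_null_comparison[rotated]) (intro always_eventually allI, unfold real_norm_def, rule lip)
    then show "((\<lambda>x. N (trunc d x)) \<longlongrightarrow> N (trunc d a)) (at a)"
      by (rule LIM_zero_cancel)
  qed
qed

lemma measurable_N_trunc [measurable]: "(\<lambda>x. N (trunc d x)) \<in> borel_measurable (leb d)"
  using measurable_trunc_coords[OF continuous_N_trunc, of d] by simp

definition sublevel :: "real \<Rightarrow> (nat \<Rightarrow> real) set" where
  "sublevel c = {x \<in> space (leb d). N (trunc d x) \<le> c}"

lemma sublevel_sets [measurable, simp]: "sublevel c \<in> sets (leb d)"
  unfolding sublevel_def by measurable

lemma sublevel_linear_ge: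
  assumes A: "mdet d A \<noteq> 0" and S: "S \<in> sets (leb d)"
    and le: "\<And>x. x \<in> S \<Longrightarrow> N (trunc d (mapp d A x)) \<le> c"
  shows "ennreal \<bar>mdet d A\<bar> * emeasure (leb d) S \<le> emeasure (leb d) (sublevel c)"
proof -
  have "emeasure (leb d) (sublevel c) = (\<integral>\<^sup>+x. indicator (sublevel c) x \<partial>leb d)"
    by simp
  also have "\<dots> = ennreal \<bar>mdet d A\<bar> * (\<integral>\<^sup>+x. indicator (sublevel c) (mapp d A x) \<partial>leb d)"
    by (rule nn_integral_leb_linear[OF A]) simp
  also have "\<dots> \<ge> ennreal \<bar>mdet d A\<bar> * (\<integral>\<^sup>+x. indicator S x \<partial>leb d)"
  proof (intro mult_left_mono nn_integral_mono)
    fix x assume "x \<in> space (leb d)"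
    then have "mapp d A x \<in> space (leb d)" using measurable_space[OF measurable_mapp] by blast
    then show "indicator S x \<le> (indicator (sublevel c) (mapp d A x) :: ennreal)"
      using le by (auto simp: indicator_def sublevel_def)
  qed simp
  finally show ?thesis using S by simp
qed

lemma emeasure_sublevel:
  assumes c: "0 < c"
  shows "emeasure (leb d) (sublevel c) = ennreal (c ^ d) * emeasure (leb d) (sublevel 1)"
proof -
  define A where "A = (\<lambda>i j. c * mone i j)"
  have "Matrix.mat d d (\<lambda>(i, j). A i j) = c \<cdot>\<^sub>m 1\<^sub>m d"
    by (rule eq_matI) (auto simp: A_def mone_def)
  then have det: "mdet d A = c ^ d" by (simp add: mdet_def)
  have app: "trunc d (mapp d A x) = c *\<^sub>R trunc d x" for x
  proof
    fix i
    have "(\<Sum>j<d. A i j * x j) = (\<Sum>j<d. if j = i then c * x i else 0)"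
      by (intro sum.cong) (auto simp: A_def mone_def)
    then show "trunc d (mapp d A x) i = (c *\<^sub>R trunc d x) i"
      by (auto simp: trunc_def mapp_def)
  qed
  have "emeasure (leb d) (sublevel c) = (\<integral>\<^sup>+x. indicator (sublevel c) x \<partial>leb d)"
    by simp
  also have "\<dots> = ennreal \<bar>mdet d A\<bar> * (\<integral>\<^sup>+x. indicator (sublevel c) (mapp d A x) \<partial>leb d)"
    using c det by (intro nn_integral_leb_linear) auto
  also have "(\<integral>\<^sup>+x. indicator (sublevel c) (mapp d A x) \<partial>leb d) = (\<integral>\<^sup>+x. indicator (sublevel 1) x \<partial>leb d)"
  proof (rule nn_integral_cong)
    fix x assume x: "x \<in> space (leb d)"
    then have "mapp d A x \<in> space (leb d)" using measurable_space[OF measurable_mapp] by blast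
    then show "indicator (sublevel c) (mapp d A x) = (indicator (sublevel 1) x :: ennreal)"
      using c x by (simp add: indicator_def sublevel_def app N_scale)
  qed
  finally show ?thesis using c det by simp
qed

lemma emeasure_sublevel_finite: "emeasure (leb d) (sublevel 1) < \<infinity>"
proof -
  obtain C where C: "\<And>x i. x \<in> RR d \<Longrightarrow> i < d \<Longrightarrow> \<bar>x i\<bar> \<le> C * N x"
    using N_coercive by blast
  have "sublevel 1 \<subseteq> (\<Pi>\<^sub>E i\<in>{..<d}. {-\<bar>C\<bar>..\<bar>C\<bar>})"
  proof
    fix x assume x: "x \<in> sublevel 1"
    have "x i \<in> {-\<bar>C\<bar>..\<bar>C\<bar>}" if "i < d" for i
    proof -
      have "\<bar>x i\<bar> \<le> C * N (trunc d x)" using C[of "trunc d x" i] that by simp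
      also have "\<dots> \<le> \<bar>C\<bar> * 1"
        using x N_nonneg[of "trunc d x"] by (intro mult_mono) (auto simp: sublevel_def)
      finally show ?thesis by auto
    qed
    then show "x \<in> (\<Pi>\<^sub>E i\<in>{..<d}. {-\<bar>C\<bar>..\<bar>C\<bar>})"
      using x by (auto simp: sublevel_def space_PiM PiE_def)
  qed
  then have "emeasure (leb d) (sublevel 1) \<le> emeasure (leb d) (\<Pi>\<^sub>E i\<in>{..<d}. {-\<bar>C\<bar>..\<bar>C\<bar>})"
    by (intro emeasure_mono sets_PiM_I_finite) auto
  also have "\<dots> = (\<Prod>i<d. emeasure lborel {-\<bar>C\<bar>..\<bar>C\<bar>})"
    by (subst leb.emeasure_PiM) auto
  also have "\<dots> < \<infinity>" by (simp add: ennreal_prod_eq_top less_top[symmetric] power_eq_top_ennreal)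
  finally show ?thesis .
qed

lemma emeasure_sublevel_pos: "0 < emeasure (leb d) (sublevel 1)"
proof -
  obtain C where C: "C > 0" "\<And>x. x \<in> RR d \<Longrightarrow> N x \<le> C * (\<Sum>i<d. \<bar>x i\<bar>)"
    using N_upper by blast
  define e where "e = 1 / (C * (real d + 1))"
  have "e > 0" using C(1) by (simp add: e_def)
  moreover have "C * (real d * e) = real d / (real d + 1)" using C(1) by (simp add: e_def)
  ultimately have e: "e > 0" "C * (real d * e) \<le> 1" by simp_all
  have "(\<Pi>\<^sub>E i\<in>{..<d}. {-e..e}) \<subseteq> sublevel 1"
  proof
    fix x assume x: "x \<in> (\<Pi>\<^sub>E i\<in>{..<d}. {-e..e})"
    have "N (trunc d x) \<le> C * (\<Sum>i<d. \<bar>trunc d x i\<bar>)" by (rule C) simp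
    also have "\<dots> \<le> C * (\<Sum>i<d. e)"
    proof (intro mult_left_mono sum_mono)
      fix i assume "i \<in> {..<d}"
      with x have "x i \<in> {-e..e}" by (rule PiE_mem)
      then show "\<bar>trunc d x i\<bar> \<le> e" using \<open>i \<in> {..<d}\<close> by auto
    qed (use C(1) in simp)
    also have "\<dots> \<le> 1" using e by simp
    finally show "x \<in> sublevel 1" using x by (auto simp: sublevel_def space_PiM PiE_def)
  qed
  then have "emeasure (leb d) (\<Pi>\<^sub>E i\<in>{..<d}. {-e..e}) \<le> emeasure (leb d) (sublevel 1)"
    by (intro emeasure_mono) auto
  moreover have "emeasure (leb d) (\<Pi>\<^sub>E i\<in>{..<d}. {-e..e}) = (\<Prod>i<d. emeasure lborel {-e..e})"
    by (subst leb.emeasure_PiM) auto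
  moreover have "\<dots> > 0" using e by (simp add: ennreal_power)
  ultimately show ?thesis by auto
qed

lemma measure_sublevel_pos: "0 < measure (leb d) (sublevel 1)"
  using emeasure_sublevel_pos emeasure_sublevel_finite by (simp add: measure_def enn2real_positive_iff)

lemma emeasure_eq_measure_sublevel:
  assumes "0 < c"
  shows "emeasure (leb d) (sublevel c) = ennreal (c ^ d * measure (leb d) (sublevel 1))"
proof -
  have "emeasure (leb d) (sublevel 1) = ennreal (measure (leb d) (sublevel 1))"
    using emeasure_sublevel_finite by (intro emeasure_eq_ennreal_measure) auto
  then show ?thesis
    using assms by (simp only: emeasure_sublevel[OF assms]) (simp add: ennreal_mult)
qed

text \<open>
  A body between the open and the closed unit ball of \<open>N\<close> need not be Borel.  Its boundary is null since
  by homogeneity the open ball contains the closed balls of radius \<open>t < 1\<close>, whose volume tends to that of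
  the closed unit ball; hence the body is measurable for the completed measure.
\<close>

lemma Vol_eq_measure_sublevel:
  assumes L: "L \<subseteq> RR d" and inner: "\<And>x. x \<in> RR d \<Longrightarrow> N x < 1 \<Longrightarrow> x \<in> L"
    and outer: "\<And>x. x \<in> L \<Longrightarrow> N x \<le> 1"
  shows "Vol d L = measure (leb d) (sublevel 1)"
proof -
  let ?L = "(\<lambda>x. restrict x {..<d}) ` L" and ?v = "measure (leb d) (sublevel 1)"
  define I where "I = {x \<in> space (leb d). N (trunc d x) < 1}"
  have I_sets: "I \<in> sets (leb d)" unfolding I_def by measurable
  have IL: "I \<subseteq> ?L"
  proof
    fix x assume x: "x \<in> I"
    then have "restrict (trunc d x) {..<d} = x" by (intro restrict_trunc) (simp add: I_def)
    moreover have "trunc d x \<in> L" using x inner[of "trunc d x"] by (simp add: I_def)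
    ultimately show "x \<in> ?L" by (metis imageI)
  qed
  have LS: "?L \<subseteq> sublevel 1"
  proof
    fix y assume "y \<in> ?L"
    then obtain x where "x \<in> L" and y: "y = restrict x {..<d}" by auto
    then have "N (trunc d y) \<le> 1" using outer[of x] L by (simp add: trunc_id subset_iff)
    then show "y \<in> sublevel 1" unfolding y sublevel_def by (auto simp: space_PiM)
  qed
  have "emeasure (leb d) (sublevel 1) \<le> emeasure (leb d) I"
  proof -
    have "ennreal (t ^ d * ?v) \<le> emeasure (leb d) I" if "0 < t" "t < 1" for t
    proof -
      have "sublevel t \<subseteq> I" using that by (auto simp: sublevel_def I_def)
      then have "emeasure (leb d) (sublevel t) \<le> emeasure (leb d) I"
        by (intro emeasure_mono I_sets)
      then show ?thesis using emeasure_eq_measure_sublevel[of t] that by simp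
    qed
    then have "eventually (\<lambda>t. ennreal (t ^ d * ?v) \<le> emeasure (leb d) I) (at_left (1::real))"
      by (intro eventually_at_leftI[of 0]) auto
    moreover have "((\<lambda>t. ennreal (t ^ d * ?v)) \<longlongrightarrow> ennreal (1 ^ d * ?v)) (at_left (1::real))"
      by (rule tendsto_ennrealI[OF tendsto_mult[OF tendsto_power[OF tendsto_ident_at] tendsto_const]])
    ultimately have "ennreal (1 ^ d * ?v) \<le> emeasure (leb d) I"
      by (intro tendsto_upperbound) auto
    then show ?thesis using emeasure_eq_measure_sublevel[of 1] by simp
  qed
  moreover have "emeasure (leb d) I \<le> emeasure (leb d) (sublevel 1)"
    using IL LS by (intro emeasure_mono) auto
  ultimately have eq: "emeasure (leb d) I = emeasure (leb d) (sublevel 1)" by simp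
  have null: "sublevel 1 - I \<in> null_sets (leb d)"
  proof (rule null_setsI)
    show "sublevel 1 - I \<in> sets (leb d)" using I_sets by simp
    have "emeasure (leb d) (sublevel 1 - I) = emeasure (leb d) (sublevel 1) - emeasure (leb d) I"
      using IL LS I_sets emeasure_sublevel_finite eq by (intro emeasure_Diff) auto
    then show "emeasure (leb d) (sublevel 1 - I) = 0" using eq emeasure_sublevel_finite
      by (simp add: diff_eq_0_iff_ennreal)
  qed
  have Lset: "?L = I \<union> (?L - I)" using IL by auto
  have sub: "?L - I \<subseteq> sublevel 1 - I" using LS by auto
  have "?L - I \<in> null_sets (completion (leb d))"
    by (rule null_sets_completion_subset[OF sub]) (simp add: null_sets_completionI[OF null])
  then have "emeasure (completion (leb d)) (I \<union> (?L - I)) = emeasure (completion (leb d)) I"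
    using I_sets by (intro emeasure_Un_null_set) auto
  then have "emeasure (completion (leb d)) ?L = emeasure (leb d) (sublevel 1)"
    by (simp only: Lset[symmetric]) (use I_sets eq in simp)
  then show ?thesis unfolding Vol_def by (simp add: measure_def)
qed

end

section \<open>Gauges of convex bodies\<close>

lemma Euclidean_space_zero_box:
  assumes "0 \<in> Euclidean_space d interior_of K"
  obtains e where "e > 0" "\<And>x. x \<in> RR d \<Longrightarrow> (\<And>i. i < d \<Longrightarrow> \<bar>x i\<bar> < e) \<Longrightarrow> x \<in> K"
proof -
  obtain U where U: "openin (Euclidean_space d) U" "0 \<in> U" "U \<subseteq> K"
    using assms by (auto simp: interior_of_def)
  then obtain S where S: "openin (powertop_real UNIV) S" "U = S \<inter> {x. \<forall>i\<ge>d. x i = 0}"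
    by (auto simp: Euclidean_space_def openin_subtopology)
  then have "0 \<in> S" using U by auto
  then obtain V where V: "\<And>i. open (V i)" "0 \<in> Pi\<^sub>E UNIV V" "Pi\<^sub>E UNIV V \<subseteq> S"
  proof -
    have "\<exists>V. finite {i \<in> UNIV. V i \<noteq> topspace euclideanreal} \<and> (\<forall>i\<in>UNIV. openin euclideanreal (V i)) \<and>
        0 \<in> Pi\<^sub>E UNIV V \<and> Pi\<^sub>E UNIV V \<subseteq> S"
      using S(1) \<open>0 \<in> S\<close> unfolding openin_product_topology_alt by (rule bspec)
    then obtain V where "\<And>i. openin euclideanreal (V i)" "0 \<in> Pi\<^sub>E UNIV V" "Pi\<^sub>E UNIV V \<subseteq> S"
      by blast
    then show thesis by (intro that[of V]) simp_all
  qed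
  have "\<exists>e>0. ball 0 e \<subseteq> V i" for i
  proof -
    have "0 i \<in> V i" using V(2) by (rule PiE_mem) simp
    then show ?thesis using V(1)[of i] unfolding open_contains_ball zero_fun_apply by blast
  qed
  then obtain e where e: "\<And>i. e i > 0" "\<And>i. ball 0 (e i) \<subseteq> V i" by metis
  define m where "m = Min (insert 1 (e ` {..<d}))"
  have m: "m > 0" "\<And>i. i < d \<Longrightarrow> m \<le> e i"
    using e(1) by (auto simp: m_def)
  show thesis
  proof (rule that[OF m(1)])
    fix x assume x: "x \<in> RR d" "\<And>i. i < d \<Longrightarrow> \<bar>x i\<bar> < m"
    have "x i \<in> V i" for i
    proof (cases "i < d")
      case True
      then have "x i \<in> ball 0 (e i)" using x(2)[of i] m(2)[of i] by simp
      then show ?thesis using e(2) by blast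
    next
      case False
      then have "x i = 0" using x(1) by (simp add: RR_iff)
      then show ?thesis using V(2) by (auto simp: PiE_iff)
    qed
    then have "x \<in> S" using V(3) by (auto simp: PiE_iff)
    then show "x \<in> K" using x(1) S(2) U(3) by (auto simp: RR_iff)
  qed
qed

locale centered_body =
  fixes d :: nat and L :: "(nat \<Rightarrow> real) set"
  assumes body: "convex_body d L" and zero_interior: "0 \<in> Euclidean_space d interior_of L"
begin

abbreviation "p \<equiv> gauge_norm L"

lemma subset_RR: "L \<subseteq> RR d" and convex_L: "convex L" and zero_mem: "0 \<in> L"
  using body zero_interior interior_of_subset[of "Euclidean_space d" L] by (auto simp: convex_body_def)

definition scales :: "(nat \<Rightarrow> real) \<Rightarrow> real set" where
  "scales x = {r. r > 0 \<and> (1 / r) *\<^sub>R x \<in> L}"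

lemma gauge_norm_eq: "p x = Inf (scales x)"
proof -
  have "x \<in> (\<lambda>y. r *\<^sub>R y) ` L \<longleftrightarrow> (1 / r) *\<^sub>R x \<in> L" if "r > 0" for r
  proof
    assume "(1 / r) *\<^sub>R x \<in> L"
    moreover have "x = r *\<^sub>R ((1 / r) *\<^sub>R x)" using that by simp
    ultimately show "x \<in> (\<lambda>y. r *\<^sub>R y) ` L" by blast
  qed (use that in auto)
  then have "{r. r > 0 \<and> x \<in> (\<lambda>y. r *\<^sub>R y) ` L} = scales x" unfolding scales_def by blast
  then show ?thesis by (simp add: gauge_norm_def)
qed

lemma bdd_below_scales: "bdd_below (scales x)"
  by (rule bdd_belowI[of _ 0]) (simp add: scales_def)

lemma scales_nonempty: "x \<in> RR d \<Longrightarrow> scales x \<noteq> {}"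
proof -
  assume x: "x \<in> RR d"
  obtain e where e: "e > 0" "\<And>x. x \<in> RR d \<Longrightarrow> (\<And>i. i < d \<Longrightarrow> \<bar>x i\<bar> < e) \<Longrightarrow> x \<in> L"
    using Euclidean_space_zero_box[OF zero_interior] by blast
  define r where "r = (1 + (\<Sum>i<d. \<bar>x i\<bar>)) / e"
  have r: "r > 0" using e(1) by (auto simp: r_def intro!: divide_pos_pos add_pos_nonneg sum_nonneg)
  have "(1 / r) *\<^sub>R x \<in> L"
  proof (rule e(2))
    fix i assume "i < d"
    then have "\<bar>x i\<bar> \<le> (\<Sum>i<d. \<bar>x i\<bar>)" by (intro member_le_sum) auto
    also have "\<dots> < e * r" using e(1) by (simp add: r_def)
    finally show "\<bar>((1 / r) *\<^sub>R x) i\<bar> < e" using r by (simp add: field_simps)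
  qed (use x in auto)
  with r show ?thesis by (auto simp: scales_def)
qed

lemma scales_up: "r \<in> scales x \<Longrightarrow> r \<le> s \<Longrightarrow> s \<in> scales x"
proof -
  assume r: "r \<in> scales x" and s: "r \<le> s"
  have "r > 0" using r by (simp add: scales_def)
  then have "(r / s) *\<^sub>R ((1 / r) *\<^sub>R x) + (1 - r / s) *\<^sub>R 0 \<in> L"
    using r s by (intro convexD[OF convex_L _ zero_mem]) (auto simp: scales_def)
  moreover have "(r / s) *\<^sub>R ((1 / r) *\<^sub>R x) + (1 - r / s) *\<^sub>R 0 = (1 / s) *\<^sub>R x"
    using \<open>r > 0\<close> s by simp
  ultimately show ?thesis using \<open>r > 0\<close> s by (simp add: scales_def)
qed

lemma gauge_le: "r > 0 \<Longrightarrow> (1 / r) *\<^sub>R x \<in> L \<Longrightarrow> p x \<le> r"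
  unfolding gauge_norm_eq by (rule cInf_lower[OF _ bdd_below_scales]) (simp add: scales_def)

lemma gauge_less:
  assumes "x \<in> RR d" "p x < r"
  shows "r \<in> scales x"
proof -
  obtain s where "s \<in> scales x" "s < r"
    using cInf_lessD[OF scales_nonempty[OF assms(1)]] assms(2) unfolding gauge_norm_eq by blast
  then show ?thesis using scales_up[of s x r] by simp
qed

lemma gauge_le_one: "x \<in> L \<Longrightarrow> p x \<le> 1"
  using gauge_le[of 1 x] by simp

lemma gauge_less_one: "x \<in> RR d \<Longrightarrow> p x < 1 \<Longrightarrow> x \<in> L"
  using gauge_less[of x 1] by (simp add: scales_def)

lemma gauge_nonneg: "x \<in> RR d \<Longrightarrow> 0 \<le> p x"
  unfolding gauge_norm_eq by (rule cInf_greatest[OF scales_nonempty]) (auto simp: scales_def)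

lemma gauge_scale_le: "x \<in> RR d \<Longrightarrow> c > 0 \<Longrightarrow> p (c *\<^sub>R x) \<le> c * p x"
proof (rule field_le_epsilon)
  fix e :: real assume x: "x \<in> RR d" and c: "c > 0" and e: "e > 0"
  have "p x + e / c \<in> scales x" using x c e by (intro gauge_less) auto
  then have "p (c *\<^sub>R x) \<le> c * (p x + e / c)"
    using c by (intro gauge_le) (auto simp: scales_def)
  then show "p (c *\<^sub>R x) \<le> c * p x + e" using c by (simp add: distrib_left)
qed

sublocale asym_norm d p
proof
  fix x y assume x: "x \<in> RR d" and y: "y \<in> RR d"
  show "p (x + y) \<le> p x + p y"
  proof (rule field_le_epsilon)
    fix e :: real assume e: "e > 0"
    define a b where "a = p x + e / 2" and "b = p y + e / 2"
    have ab: "a \<in> scales x" "b \<in> scales y"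
      unfolding a_def b_def using x y e by (auto intro!: gauge_less)
    then have pos: "a > 0" "b > 0" by (auto simp: scales_def)
    have "(a / (a + b)) *\<^sub>R ((1 / a) *\<^sub>R x) + (b / (a + b)) *\<^sub>R ((1 / b) *\<^sub>R y) \<in> L"
      using ab pos by (intro convexD[OF convex_L]) (auto simp: scales_def add_divide_distrib[symmetric])
    moreover have "(a / (a + b)) *\<^sub>R ((1 / a) *\<^sub>R x) + (b / (a + b)) *\<^sub>R ((1 / b) *\<^sub>R y) = (1 / (a + b)) *\<^sub>R (x + y)"
      using pos by (simp add: scaleR_add_right)
    ultimately have "p (x + y) \<le> a + b" using pos by (intro gauge_le) auto
    then show "p (x + y) \<le> p x + p y + e" by (simp add: a_def b_def)
  qed
next
  fix x and c :: real assume x: "x \<in> RR d" and c: "0 \<le> c"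
  have pos: "p (c *\<^sub>R x) = c * p x" if "c > 0"
  proof (rule antisym)
    show "p (c *\<^sub>R x) \<le> c * p x" using x that by (rule gauge_scale_le)
    have "p ((1 / c) *\<^sub>R (c *\<^sub>R x)) \<le> (1 / c) * p (c *\<^sub>R x)"
      using x that by (intro gauge_scale_le) auto
    then show "c * p x \<le> p (c *\<^sub>R x)" using that by (simp add: field_simps)
  qed
  have "p 0 \<le> 0"
    by (rule field_le_epsilon) (use gauge_le[of _ 0] zero_mem in simp)
  then have "p 0 = 0" using gauge_nonneg[of 0] by simp
  with pos c show "p (c *\<^sub>R x) = c * p x" by (cases "c = 0") auto
next
  obtain C where C: "\<And>x. x \<in> L \<Longrightarrow> enorm d x \<le> C"
    using body by (auto simp: convex_body_def)
  have "\<bar>x i\<bar> \<le> \<bar>C\<bar> * p x" if x: "x \<in> RR d" and i: "i < d" for x i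
  proof (rule field_le_epsilon)
    fix e :: real assume e: "e > 0"
    define r where "r = p x + e / (\<bar>C\<bar> + 1)"
    have r: "r \<in> scales x" unfolding r_def using x e by (intro gauge_less) (auto intro!: divide_pos_pos add_nonneg_pos)
    then have r0: "r > 0" and rL: "(1 / r) *\<^sub>R x \<in> L" by (auto simp: scales_def)
    have "\<bar>((1 / r) *\<^sub>R x) i\<bar> \<le> enorm d ((1 / r) *\<^sub>R x)"
      using i member_le_L2_set[of "{..<d}" i "\<lambda>i. \<bar>((1 / r) *\<^sub>R x) i\<bar>"] by (simp add: enorm_def L2_set_def power_divide)
    also have "\<dots> \<le> \<bar>C\<bar>" using C[OF rL] by linarith
    finally have "\<bar>x i\<bar> \<le> \<bar>C\<bar> * r" using r0 by (simp add: field_simps)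
    also have "\<dots> = \<bar>C\<bar> * p x + e * (\<bar>C\<bar> / (\<bar>C\<bar> + 1))" by (simp add: r_def distrib_left)
    also have "\<dots> \<le> \<bar>C\<bar> * p x + e"
      using e by (intro add_left_mono mult_left_le) auto
    finally show "\<bar>x i\<bar> \<le> \<bar>C\<bar> * p x + e" .
  qed
  then show "\<exists>C. \<forall>x\<in>RR d. \<forall>i<d. \<bar>x i\<bar> \<le> C * p x" by blast
qed (rule gauge_nonneg)

lemma Vol_eq: "Vol d L = measure (leb d) (sublevel 1)"
  using subset_RR gauge_less_one gauge_le_one by (rule Vol_eq_measure_sublevel)

lemma Vol_pos: "0 < Vol d L"
  unfolding Vol_eq by (rule measure_sublevel_pos)

lemma centered_body_diff: "centered_body d {x - y | x y. x \<in> L \<and> y \<in> L}" (is "centered_body d ?D")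
proof
  have sub: "L \<subseteq> ?D"
  proof
    fix x assume "x \<in> L"
    then show "x \<in> ?D" using zero_mem by (intro CollectI exI[of _ x] exI[of _ 0]) simp
  qed
  have D: "?D \<subseteq> RR d" using subset_RR by (auto simp: subset_iff)
  show z: "0 \<in> Euclidean_space d interior_of ?D"
    using zero_interior interior_of_mono[OF sub] by blast
  have "?D = (\<Union>x\<in>L. \<Union>y\<in>L. {x - y})" by auto
  then have conv: "convex ?D" using convex_differences[OF convex_L convex_L] by simp
  obtain C where C: "\<And>x. x \<in> L \<Longrightarrow> enorm d x \<le> C"
    using body by (auto simp: convex_body_def)
  have "enorm d (x - y) \<le> C + C" if "x \<in> L" "y \<in> L" for x y
  proof -
    have "enorm d (x - y) \<le> enorm d x + L2_set (\<lambda>i. - y i) {..<d}"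
      unfolding enorm_def using L2_set_triangle_ineq[of x "\<lambda>i. - y i" "{..<d}"]
      by (simp add: L2_set_def)
    also have "L2_set (\<lambda>i. - y i) {..<d} = enorm d y" by (simp add: enorm_def L2_set_def)
    finally show ?thesis using C[OF that(1)] C[OF that(2)] by linarith
  qed
  then have "\<exists>C. \<forall>x\<in>?D. enorm d x \<le> C" by (intro exI[of _ "C + C"]) auto
  then show "convex_body d ?D"
    unfolding convex_body_def using D conv z by auto
qed

end

section \<open>The volume of the difference body\<close>

lemma lborel_distr_affine:
  assumes "\<bar>s\<bar> = 1"
  shows "distr lborel borel (\<lambda>t. a + s * t) = (lborel :: real measure)"
proof -
  have "lborel = density (distr lborel borel (\<lambda>t. a + s * t)) (\<lambda>_. ennreal \<bar>s\<bar>)"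
    using assms by (intro lborel_real_affine) auto
  then show ?thesis using assms by (simp add: density_1)
qed

lemma nn_integral_leb_affine:
  assumes s: "\<bar>s\<bar> = 1" and f: "f \<in> borel_measurable (leb d)"
  shows "(\<integral>\<^sup>+x. f (\<lambda>i\<in>{..<d}. a i + s * x i) \<partial>leb d) = (\<integral>\<^sup>+x. f x \<partial>leb d)"
proof -
  let ?T = "\<lambda>x. \<lambda>i\<in>{..<d}. a i + s * x i"
  have T [measurable]: "?T \<in> measurable (leb d) (leb d)" by measurable
  have "distr (leb d) (leb d) ?T = leb d"
  proof (rule leb.PiM_eqI)
    fix A :: "nat \<Rightarrow> real set" assume A: "\<And>i. i \<in> {..<d} \<Longrightarrow> A i \<in> sets lborel"
    have "emeasure (distr (leb d) (leb d) ?T) (Pi\<^sub>E {..<d} A) = emeasure (leb d) (?T -` Pi\<^sub>E {..<d} A \<inter> space (leb d))"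
      using A by (intro emeasure_distr T sets_PiM_I_finite) auto
    also have "?T -` Pi\<^sub>E {..<d} A \<inter> space (leb d) = Pi\<^sub>E {..<d} (\<lambda>i. (\<lambda>t. a i + s * t) -` A i)"
      by (auto simp: space_PiM PiE_iff)
    also have "emeasure (leb d) \<dots> = (\<Prod>i<d. emeasure lborel ((\<lambda>t. a i + s * t) -` A i))"
    proof (rule leb.emeasure_PiM)
      fix i assume "i \<in> {..<d}"
      then have "A i \<in> sets borel" using A by simp
      then have "(\<lambda>t. a i + s * t) -` A i \<inter> space borel \<in> sets borel"
        by (intro measurable_sets[of _ borel borel]) auto
      then show "(\<lambda>t. a i + s * t) -` A i \<in> sets lborel" by simp
    qed simp
    also have "\<dots> = (\<Prod>i<d. emeasure lborel (A i))"
    proof (rule prod.cong[OF refl])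
      fix i assume "i \<in> {..<d}"
      then have "A i \<in> sets borel" using A by simp
      then have "emeasure (distr lborel borel (\<lambda>t. a i + s * t)) (A i) = emeasure lborel ((\<lambda>t. a i + s * t) -` A i)"
        by (subst emeasure_distr) auto
      then show "emeasure lborel ((\<lambda>t. a i + s * t) -` A i) = emeasure lborel (A i)"
        by (simp add: lborel_distr_affine[OF s])
    qed
    finally show "emeasure (distr (leb d) (leb d) ?T) (Pi\<^sub>E {..<d} A) = (\<Prod>i<d. emeasure lborel (A i))" .
  qed auto
  then have "(\<integral>\<^sup>+x. f x \<partial>leb d) = (\<integral>\<^sup>+x. f x \<partial>distr (leb d) (leb d) ?T)" by simp
  also have "\<dots> = (\<integral>\<^sup>+x. f (?T x) \<partial>leb d)"
    by (rule nn_integral_distr[OF T]) (use f in simp)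
  finally show ?thesis ..
qed

lemma sigma_finite_leb: "sigma_finite_measure (leb d)"
  by (rule leb.sigma_finite) simp

context centered_body begin

text \<open>
  Integrate the volume of \<open>L \<inter> (x + L)\<close> over \<open>x\<close>: by Fubini the integral is the square of the volume
  of \<open>L\<close>.  On the other hand, if \<open>x = a / 2 - b / 2\<close> with \<open>a, b\<close> in \<open>L\<close>, then the intersection contains
  \<open>a / 2 + L / 2\<close>.  Such \<open>x\<close> form the difference body scaled by a half; working with the gauge ball of
  radius a third inside it avoids a discussion of the boundary and gives \<open>6 = 2 * 3\<close>.
\<close>

lemma Vol_difference_le: "Vol d {x - y | x y. x \<in> L \<and> y \<in> L} \<le> 6 ^ d * Vol d L"
proof -
  let ?D = "{x - y | x y. x \<in> L \<and> y \<in> L}"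
  interpret D: centered_body d ?D by (rule centered_body_diff)
  interpret pr: pair_sigma_finite "leb d" "leb d"
    by (intro pair_sigma_finite.intro sigma_finite_leb)
  let ?S = "sublevel 1"
  define sub where "sub = (\<lambda>a (y :: nat \<Rightarrow> real). \<lambda>i\<in>{..<d}. a i + (-1) * y i)"
  have sub_space: "sub a y \<in> space (leb d)" for a y by (auto simp: sub_def space_PiM)
  have [measurable]: "(\<lambda>(x, y). sub x y) \<in> measurable (leb d \<Otimes>\<^sub>M leb d) (leb d)"
    unfolding sub_def by measurable
  define f where "f = (\<lambda>x y. indicator ?S y * indicator ?S (sub y x) :: ennreal)"
  have f_meas: "case_prod f \<in> borel_measurable (leb d \<Otimes>\<^sub>M leb d)"
    unfolding f_def by measurable
  have low: "emeasure (leb d) (sublevel (1/2)) * indicator (D.sublevel (1/3)) x \<le> (\<integral>\<^sup>+y. f x y \<partial>leb d)"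
    if x: "x \<in> space (leb d)" for x
  proof (cases "x \<in> D.sublevel (1/3)")
    case True
    then have "D.p (trunc d x) < 1 / 2" by (simp add: D.sublevel_def)
    then have "(1 / (1/2)) *\<^sub>R trunc d x \<in> ?D" using D.gauge_less[of "trunc d x" "1/2"] by (simp add: D.scales_def)
    then obtain a b where ab: "a \<in> L" "b \<in> L" "2 *\<^sub>R trunc d x = a - b" by auto
    then have ab_RR: "a \<in> RR d" "b \<in> RR d" using subset_RR by auto
    have x_eq: "trunc d x = (1/2) *\<^sub>R a - (1/2) *\<^sub>R b"
    proof -
      have "trunc d x = (1/2) *\<^sub>R (2 *\<^sub>R trunc d x)" by simp
      then show ?thesis unfolding ab(3) by (simp only: scaleR_diff_right)
    qed
    define t where "t = (\<lambda>(y :: nat \<Rightarrow> real). \<lambda>i\<in>{..<d}. (- (1/2) *\<^sub>R a) i + 1 * y i)"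
    have tr_t: "trunc d (t y) = trunc d y - (1/2) *\<^sub>R a" for y
      using ab_RR by (auto simp: t_def trunc_def fun_eq_iff RR_iff)
    have tr_sub: "trunc d (sub y x) = trunc d y - trunc d x" for y
      by (auto simp: sub_def trunc_def fun_eq_iff)
    have "emeasure (leb d) (sublevel (1/2)) = (\<integral>\<^sup>+y. indicator (sublevel (1/2)) y \<partial>leb d)"
      by simp
    also have "\<dots> = (\<integral>\<^sup>+y. indicator (sublevel (1/2)) (t y) \<partial>leb d)"
      unfolding t_def by (rule nn_integral_leb_affine[symmetric]) auto
    also have "\<dots> \<le> (\<integral>\<^sup>+y. f x y \<partial>leb d)"
    proof (rule nn_integral_mono)
      fix y assume y: "y \<in> space (leb d)"
      have "y \<in> ?S \<and> sub y x \<in> ?S" if "t y \<in> sublevel (1/2)"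
      proof -
        let ?z = "trunc d y - (1/2) *\<^sub>R a"
        have z: "p ?z \<le> 1/2" using that by (simp add: sublevel_def tr_t)
        have half: "p ((1/2) *\<^sub>R u) \<le> 1/2" if "u \<in> L" for u
          using N_scale[of u "1/2"] gauge_le_one[OF that] that subset_RR by auto
        have "p (?z + (1/2) *\<^sub>R a) \<le> p ?z + p ((1/2) *\<^sub>R a)"
          using ab_RR by (intro N_add) auto
        moreover have "p (?z + (1/2) *\<^sub>R b) \<le> p ?z + p ((1/2) *\<^sub>R b)"
          using ab_RR by (intro N_add) auto
        moreover have "?z + (1/2) *\<^sub>R a = trunc d y" by simp
        moreover have "?z + (1/2) *\<^sub>R b = trunc d (sub y x)"
          unfolding tr_sub x_eq by simp
        ultimately show ?thesis
          using z half[OF ab(1)] half[OF ab(2)] y sub_space by (simp add: sublevel_def)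
      qed
      then show "indicator (sublevel (1/2)) (t y) \<le> f x y"
        by (auto simp: f_def indicator_def)
    qed
    finally show ?thesis using True by simp
  qed simp
  have "emeasure (leb d) (sublevel (1/2)) * emeasure (leb d) (D.sublevel (1/3))
      = (\<integral>\<^sup>+x. emeasure (leb d) (sublevel (1/2)) * indicator (D.sublevel (1/3)) x \<partial>leb d)"
    by (simp add: nn_integral_cmult_indicator)
  also have "\<dots> \<le> (\<integral>\<^sup>+x. \<integral>\<^sup>+y. f x y \<partial>leb d \<partial>leb d)"
    by (rule nn_integral_mono) (rule low)
  also have "\<dots> = (\<integral>\<^sup>+y. \<integral>\<^sup>+x. f x y \<partial>leb d \<partial>leb d)"
    using f_meas by (rule pr.Fubini'[symmetric])
  also have "\<dots> = (\<integral>\<^sup>+y. indicator ?S y * emeasure (leb d) ?S \<partial>leb d)"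
  proof (rule nn_integral_cong)
    fix y
    have m: "(\<lambda>x. indicator ?S (sub y x) :: ennreal) \<in> borel_measurable (leb d)"
      unfolding sub_def by measurable
    have "(\<integral>\<^sup>+x. f x y \<partial>leb d) = indicator ?S y * (\<integral>\<^sup>+x. indicator ?S (sub y x) \<partial>leb d)"
      unfolding f_def by (rule nn_integral_cmult[OF m])
    also have "(\<integral>\<^sup>+x. indicator ?S (sub y x) \<partial>leb d) = (\<integral>\<^sup>+x. indicator ?S x \<partial>leb d)"
      unfolding sub_def by (rule nn_integral_leb_affine) auto
    finally show "(\<integral>\<^sup>+x. f x y \<partial>leb d) = indicator ?S y * emeasure (leb d) ?S" by simp
  qed
  also have "\<dots> = emeasure (leb d) ?S * emeasure (leb d) ?S"
    by (subst nn_integral_multc) auto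
  finally have "emeasure (leb d) (sublevel (1/2)) * emeasure (leb d) (D.sublevel (1/3)) \<le> emeasure (leb d) ?S * emeasure (leb d) ?S" .
  then have "((1/2) ^ d * Vol d L) * ((1/3) ^ d * Vol d ?D) \<le> Vol d L * Vol d L"
    using Vol_pos D.Vol_pos
    by (simp add: emeasure_eq_measure_sublevel D.emeasure_eq_measure_sublevel Vol_eq[symmetric] D.Vol_eq[symmetric]
        ennreal_mult[symmetric] del: One_nat_def)
  then have "(1/2) ^ d * (1/3) ^ d * Vol d ?D \<le> Vol d L"
    using Vol_pos by (simp add: mult_ac)
  moreover have "(1/2) ^ d * (1/3) ^ d = (1 / 6 ^ d :: real)"
    by (simp add: power_mult_distrib[symmetric] power_one_over)
  ultimately show ?thesis by (simp add: field_simps)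
qed

end

section \<open>Random signs and lower bounds for volumes\<close>

definition mvec :: "nat \<Rightarrow> (nat \<Rightarrow> nat \<Rightarrow> real) \<Rightarrow> (nat \<Rightarrow> real) \<Rightarrow> nat \<Rightarrow> real" where
  "mvec d A x = (\<lambda>i. if i < d then \<Sum>j<d. A i j * x j else 0)"

lemma mvec_RR [simp, intro]: "mvec d A x \<in> RR d"
  by (simp add: mvec_def RR_iff)

lemma trunc_mapp [simp]: "trunc d (mapp d A x) = mvec d A x"
  by (auto simp: trunc_def mapp_def mvec_def)

lemma finite_Omega [simp, intro]: "finite (Omega m)"
  by (simp add: Omega_def finite_PiE)

lemma card_Omega: "card (Omega m) = 2 ^ m"
  by (simp add: Omega_def card_PiE numeral_2_eq_2)

lemma Omega_sign: "t \<in> Omega m \<Longrightarrow> i < m \<Longrightarrow> t i = 1 \<or> t i = -1"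
  by (auto simp: Omega_def PiE_iff)

lemma Omega_abs: "t \<in> Omega m \<Longrightarrow> i < m \<Longrightarrow> \<bar>t i\<bar> = 1"
  using Omega_sign by fastforce

lemma Omega_square: "t \<in> Omega m \<Longrightarrow> i < m \<Longrightarrow> t i * t i = 1"
  using Omega_sign by fastforce

lemma Omega_flip: "t \<in> Omega m \<Longrightarrow> i < m \<Longrightarrow> t(i := - t i) \<in> Omega m"
  by (auto simp: Omega_def PiE_iff extensional_def)

lemma sum_Omega_flip:
  assumes "i < m"
  shows "(\<Sum>t\<in>Omega m. g (t(i := - t i))) = (\<Sum>t\<in>Omega m. g t)"
  by (rule sum.reindex_bij_witness[where i = "\<lambda>t. t(i := - t i)" and j = "\<lambda>t. t(i := - t i)"])
    (use assms Omega_flip in auto)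

lemma sum_Omega_orthogonal:
  assumes "i < m" "j < m"
  shows "(\<Sum>t\<in>Omega m. t i * t j) = (if i = j then real (card (Omega m)) else 0)"
proof (cases "i = j")
  case True
  then show ?thesis using assms Omega_square by simp
next
  case False
  have "(\<Sum>t\<in>Omega m. t i * t j) = (\<Sum>t\<in>Omega m. (t(i := - t i)) i * (t(i := - t i)) j)"
    by (rule sum_Omega_flip[OF assms(1), symmetric])
  also have "\<dots> = - (\<Sum>t\<in>Omega m. t i * t j)" using False by (simp add: sum_negf)
  finally show ?thesis using False by simp
qed

lemma mdet_scale_columns: "mdet d (\<lambda>i j. A i j * t j) = (\<Prod>j<d. t j) * mdet d A"
proof -
  have "(\<Prod>i<d. A i (p i) * t (p i)) = (\<Prod>j<d. t j) * (\<Prod>i<d. A i (p i))"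
    if "p permutes {..<d}" for p
    using prod.permute[OF that, of t] by (simp add: prod.distrib comp_def mult.commute)
  then have "mdet d (\<lambda>i j. A i j * t j) = (\<Sum>p | p permutes {..<d}. (\<Prod>j<d. t j) * (of_int (sign p) * (\<Prod>i<d. A i (p i))))"
    unfolding mdet_leibniz by (intro sum.cong refl) (simp add: mult_ac)
  then show ?thesis by (simp add: mdet_leibniz sum_distrib_left)
qed

context asym_norm begin

text \<open>
  The unit cube is covered by the \<open>2\<^sup>d\<close> sets, one for each choice of signs \<open>t\<close>, on which \<open>A\<close> with columns
  multiplied by \<open>t\<close> maps into the ball of radius \<open>c\<close>; the signs do not change \<open>\<bar>mdet d A\<bar>\<close>.
\<close>

lemma det_le_sublevel_if_signs:
  assumes det: "mdet d A \<noteq> 0"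
    and signs: "\<And>x. (\<And>i. i < d \<Longrightarrow> x i \<in> {0..1}) \<Longrightarrow> \<exists>t\<in>Omega d. N (mvec d A (\<lambda>i. t i * x i)) \<le> c"
    and c: "c > 0"
  shows "\<bar>mdet d A\<bar> \<le> 2 ^ d * (c ^ d * measure (leb d) (sublevel 1))"
proof -
  define At where "At = (\<lambda>t i j. A i j * t j :: real)"
  define G where "G = (\<lambda>t. {x \<in> space (leb d). x \<in> (\<Pi>\<^sub>E i\<in>{..<d}. {0..1}) \<and> N (trunc d (mapp d (At t) x)) \<le> c})"
  have cube_sets [measurable]: "(\<Pi>\<^sub>E i\<in>{..<d}. {0..1::real}) \<in> sets (leb d)"
    by (rule sets_PiM_I_finite) auto
  have G_sets [measurable]: "G t \<in> sets (leb d)" for t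
    unfolding G_def by measurable
  have det_At: "\<bar>mdet d (At t)\<bar> = \<bar>mdet d A\<bar>" if "t \<in> Omega d" for t
    unfolding At_def mdet_scale_columns using Omega_abs[OF that] by (simp add: abs_mult abs_prod)
  have At_apply: "mvec d (At t) x = mvec d A (\<lambda>i. t i * x i)" for t x
    by (auto simp: mvec_def At_def mult.assoc fun_eq_iff)
  have cover: "(\<Pi>\<^sub>E i\<in>{..<d}. {0..1}) \<subseteq> (\<Union>t\<in>Omega d. G t)"
  proof
    fix x :: "nat \<Rightarrow> real" assume x: "x \<in> (\<Pi>\<^sub>E i\<in>{..<d}. {0..1})"
    then have "x i \<in> {0..1}" if "i < d" for i using that by (intro PiE_mem[OF x]) auto
    then obtain t where "t \<in> Omega d" "N (mvec d A (\<lambda>i. t i * x i)) \<le> c" using signs by blast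
    then show "x \<in> (\<Union>t\<in>Omega d. G t)"
      using x by (auto simp: G_def At_apply space_PiM PiE_iff)
  qed
  have "emeasure (leb d) (\<Pi>\<^sub>E i\<in>{..<d}. {0..1}) = (\<Prod>i<d. emeasure lborel {0..1::real})"
    by (rule leb.emeasure_PiM) auto
  then have "1 = emeasure (leb d) (\<Pi>\<^sub>E i\<in>{..<d}. {0..1})" by simp
  also have "\<dots> \<le> emeasure (leb d) (\<Union>t\<in>Omega d. G t)"
    using cover by (intro emeasure_mono) auto
  also have "\<dots> \<le> (\<Sum>t\<in>Omega d. emeasure (leb d) (G t))"
    by (rule emeasure_subadditive_finite) auto
  finally have "ennreal \<bar>mdet d A\<bar> * 1 \<le> ennreal \<bar>mdet d A\<bar> * (\<Sum>t\<in>Omega d. emeasure (leb d) (G t))"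
    by (rule mult_left_mono) simp
  also have "\<dots> = (\<Sum>t\<in>Omega d. ennreal \<bar>mdet d (At t)\<bar> * emeasure (leb d) (G t))"
    unfolding sum_distrib_left by (intro sum.cong refl) (simp add: det_At)
  also have "\<dots> \<le> (\<Sum>t\<in>Omega d. emeasure (leb d) (sublevel c))"
  proof (rule sum_mono)
    fix t assume t: "t \<in> Omega d"
    show "ennreal \<bar>mdet d (At t)\<bar> * emeasure (leb d) (G t) \<le> emeasure (leb d) (sublevel c)"
      using det det_At[OF t] by (intro sublevel_linear_ge G_sets) (auto simp: G_def)
  qed
  also have "\<dots> = ennreal (2 ^ d * (c ^ d * measure (leb d) (sublevel 1)))"
    using c by (simp add: card_Omega emeasure_eq_measure_sublevel ennreal_mult ennreal_power[symmetric] del: One_nat_def)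
  finally show ?thesis
    using c by (simp add: ennreal_le_iff)
qed

end

text \<open>
  The contraction principle in one coordinate: \<open>t k * y k\<close> is a convex combination of \<open>t k\<close> and
  \<open>- t k\<close>, and both have the same distribution.
\<close>

lemma sum_Omega_contraction_step:
  assumes k: "k < d" and y: "0 \<le> y k" "y k \<le> 1"
    and cvx: "\<And>x a b s. 0 \<le> s \<Longrightarrow> s \<le> 1 \<Longrightarrow>
       F (x(k := s * a + (1 - s) * b)) \<le> s * F (x(k := a)) + (1 - s) * F (x(k := b))"
  shows "(\<Sum>t\<in>Omega d. F (\<lambda>i. t i * y i)) \<le> (\<Sum>t\<in>Omega d. F (\<lambda>i. t i * (y(k := 1)) i :: real) :: real)"
proof -
  define s where "s = (1 + y k) / 2"
  have s: "0 \<le> s" "s \<le> 1" "1 - s = (1 - y k) / 2" using y by (auto simp: s_def field_simps)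
  have plus: "(\<lambda>i. t i * y i)(k := t k) = (\<lambda>i. t i * (y(k := 1)) i)" for t by auto
  let ?g = "\<lambda>t. F ((\<lambda>i. t i * y i)(k := - t k))"
  have "(\<Sum>t\<in>Omega d. ?g t) = (\<Sum>t\<in>Omega d. ?g (t(k := - t k)))"
    by (rule sum_Omega_flip[OF k, symmetric])
  also have "\<dots> = (\<Sum>t\<in>Omega d. F (\<lambda>i. t i * (y(k := 1)) i))"
  proof (rule sum.cong[OF refl])
    fix t
    have "(\<lambda>i. (t(k := - t k)) i * y i)(k := - (t(k := - t k)) k) = (\<lambda>i. t i * (y(k := 1)) i)"
      by auto
    then show "?g (t(k := - t k)) = F (\<lambda>i. t i * (y(k := 1)) i)" by (rule arg_cong)
  qed
  finally have minus: "(\<Sum>t\<in>Omega d. ?g t) = (\<Sum>t\<in>Omega d. F (\<lambda>i. t i * (y(k := 1)) i))" .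
  have "(\<Sum>t\<in>Omega d. F (\<lambda>i. t i * y i)) \<le> (\<Sum>t\<in>Omega d. s * F ((\<lambda>i. t i * y i)(k := t k)) + (1 - s) * ?g t)"
  proof (rule sum_mono)
    fix t :: "nat \<Rightarrow> real"
    have "t k * y k = s * t k + (1 - s) * (- t k)" by (simp add: s_def field_simps)
    then have "(\<lambda>i. t i * y i)(k := s * t k + (1 - s) * (- t k)) = (\<lambda>i. t i * y i)" by auto
    then show "F (\<lambda>i. t i * y i) \<le> s * F ((\<lambda>i. t i * y i)(k := t k)) + (1 - s) * ?g t"
      using cvx[OF s(1,2), of "\<lambda>i. t i * y i" "t k" "- t k"] by simp
  qed
  also have "\<dots> = s * (\<Sum>t\<in>Omega d. F (\<lambda>i. t i * (y(k := 1)) i)) + (1 - s) * (\<Sum>t\<in>Omega d. ?g t)"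
    by (simp only: plus sum.distrib sum_distrib_left)
  also have "\<dots> = (\<Sum>t\<in>Omega d. F (\<lambda>i. t i * (y(k := 1)) i))"
    unfolding minus by (simp add: algebra_simps)
  finally show ?thesis .
qed

lemma sum_Omega_contraction:
  assumes y: "\<And>i. i < d \<Longrightarrow> y i \<in> {0..1}"
    and cvx: "\<And>k x a b s. k < d \<Longrightarrow> 0 \<le> s \<Longrightarrow> s \<le> 1 \<Longrightarrow>
       F (x(k := s * a + (1 - s) * b)) \<le> s * F (x(k := a)) + (1 - s) * F (x(k := b))"
    and local: "\<And>x x'. (\<And>i. i < d \<Longrightarrow> x i = x' i) \<Longrightarrow> F x = F x'"
  shows "(\<Sum>t\<in>Omega d. F (\<lambda>i. t i * y i)) \<le> (\<Sum>t\<in>Omega d. F t :: real)"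
proof -
  have "(\<Sum>t\<in>Omega d. F (\<lambda>i. t i * y i)) \<le> (\<Sum>t\<in>Omega d. F (\<lambda>i. t i * (if i < k then 1 else y i)))"
    if "k \<le> d" for k using that
  proof (induction k)
    case (Suc k)
    let ?z = "\<lambda>i. if i < k then 1 else y i"
    have "(\<Sum>t\<in>Omega d. F (\<lambda>i. t i * ?z i)) \<le> (\<Sum>t\<in>Omega d. F (\<lambda>i. t i * (?z(k := 1)) i))"
      using Suc.prems y[of k] by (intro sum_Omega_contraction_step cvx) auto
    moreover have "?z(k := 1) = (\<lambda>i. if i < Suc k then 1 else y i)" by auto
    ultimately show ?case using Suc by simp
  qed simp
  from this[of d] have "(\<Sum>t\<in>Omega d. F (\<lambda>i. t i * y i)) \<le> (\<Sum>t\<in>Omega d. F (\<lambda>i. t i * (if i < d then 1 else y i)))"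
    by simp
  also have "\<dots> = (\<Sum>t\<in>Omega d. F t)"
    by (intro sum.cong refl local) simp
  finally show ?thesis .
qed

text \<open>
  A point of the cube and the vertex \<open>(1, \<dots>, 1)\<close> are compared by the contraction principle; if the bound
  failed for all signs, the mean over the signs would exceed \<open>M\<close>, against the inequality of Cauchy and
  Schwarz.
\<close>

lemma exists_sign_le:
  assumes add: "\<And>x y. x \<in> RR d \<Longrightarrow> y \<in> RR d \<Longrightarrow> G (x + y) \<le> G x + G y"
    and scale: "\<And>x c. x \<in> RR d \<Longrightarrow> 0 \<le> c \<Longrightarrow> G (c *\<^sub>R x) = c * G x"
    and M: "0 \<le> M" "mean d (\<lambda>t. (G (mvec d A t))\<^sup>2) \<le> M\<^sup>2"
    and y: "\<And>i. i < d \<Longrightarrow> y i \<in> {0..1}"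
  shows "\<exists>t\<in>Omega d. G (mvec d A (\<lambda>i. t i * y i)) \<le> (M :: real)"
proof (rule ccontr)
  let ?F = "\<lambda>x. G (mvec d A x)" and ?c = "real (card (Omega d))"
  assume "\<not> ?thesis"
  then have gt: "?F (\<lambda>i. t i * y i) > M" if "t \<in> Omega d" for t using that by (auto simp: not_le)
  have c: "?c > 0" by (simp add: card_Omega)
  have cvx: "?F (x(k := s * a + (1 - s) * b)) \<le> s * ?F (x(k := a)) + (1 - s) * ?F (x(k := b))"
    if "0 \<le> s" "s \<le> 1" for k x a b s
  proof -
    have "mvec d A (x(k := s * a + (1 - s) * b)) = s *\<^sub>R mvec d A (x(k := a)) + (1 - s) *\<^sub>R mvec d A (x(k := b))"
    proof
      fix i
      have "(\<Sum>j<d. A i j * (x(k := s * a + (1 - s) * b)) j)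
          = (\<Sum>j<d. s * (A i j * (x(k := a)) j) + (1 - s) * (A i j * (x(k := b)) j))"
        by (intro sum.cong) (auto simp: algebra_simps)
      then show "mvec d A (x(k := s * a + (1 - s) * b)) i = (s *\<^sub>R mvec d A (x(k := a)) + (1 - s) *\<^sub>R mvec d A (x(k := b))) i"
        by (simp add: mvec_def sum.distrib sum_distrib_left)
    qed
    then have "?F (x(k := s * a + (1 - s) * b)) \<le> G (s *\<^sub>R mvec d A (x(k := a))) + G ((1 - s) *\<^sub>R mvec d A (x(k := b)))"
      using add by simp
    then show ?thesis using that by (simp add: scale)
  qed
  have local: "?F x = ?F x'" if "\<And>i. i < d \<Longrightarrow> x i = x' i" for x x'
  proof -
    have "mvec d A x = mvec d A x'" using that by (auto simp: mvec_def fun_eq_iff intro!: sum.cong)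
    then show ?thesis by simp
  qed
  have "?c * M = (\<Sum>t\<in>Omega d. M)" by simp
  also have "\<dots> < (\<Sum>t\<in>Omega d. ?F (\<lambda>i. t i * y i))"
    using gt c by (intro sum_strict_mono) auto
  also have "\<dots> \<le> (\<Sum>t\<in>Omega d. ?F t)"
    using y cvx local by (rule sum_Omega_contraction)
  finally have lt: "?c * M < (\<Sum>t\<in>Omega d. ?F t)" .
  then have "(?c * M)\<^sup>2 < (\<Sum>t\<in>Omega d. ?F t)\<^sup>2"
    using M(1) by (intro power_strict_mono) auto
  also have "\<dots> \<le> (\<Sum>t\<in>Omega d. (?F t)\<^sup>2) * ?c"
    by (rule sum_squared_le_sum_of_squares)
  also have "(\<Sum>t\<in>Omega d. (?F t)\<^sup>2) = ?c * mean d (\<lambda>t. (?F t)\<^sup>2)"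
    using c by (simp add: mean_def field_simps)
  also have "\<dots> * ?c \<le> (?c * M\<^sup>2) * ?c"
    using M(2) c by (intro mult_right_mono mult_left_mono) auto
  finally show False by (simp add: power2_eq_square mult_ac)
qed

section \<open>The volume of the Euclidean ball\<close>

lemma nn_integral_exp_abs:
  assumes s: "s > 0"
  shows "(\<integral>\<^sup>+y. ennreal (exp (- s * \<bar>y\<bar>)) \<partial>lborel) \<le> ennreal (2 / s)"
proof -
  let ?e = "\<lambda>y. ennreal (exp (- s * y)) * indicator {0..} y"
  have lim: "((\<lambda>y. - exp (- s * y) / s) \<longlongrightarrow> 0) at_top"
    using s by real_asymp
  have half: "(\<integral>\<^sup>+y. ?e y \<partial>lborel) = ennreal (0 - (- exp (- s * 0) / s))"
    using s by (intro nn_integral_FTC_atLeast[where F = "\<lambda>y. - exp (- s * y) / s"] lim)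
      (auto intro!: derivative_eq_intros)
  have "(\<integral>\<^sup>+y. ennreal (exp (- s * \<bar>y\<bar>)) \<partial>lborel) \<le> (\<integral>\<^sup>+y. ?e y + ?e (0 + (-1) * y) \<partial>lborel)"
    by (rule nn_integral_mono) (auto simp: indicator_def abs_if)
  also have "\<dots> = (\<integral>\<^sup>+y. ?e y \<partial>lborel) + (\<integral>\<^sup>+y. ?e (0 + (-1) * y) \<partial>lborel)"
    by (rule nn_integral_add) auto
  also have "(\<integral>\<^sup>+y. ?e (0 + (-1) * y) \<partial>lborel) = (\<integral>\<^sup>+y. ?e y \<partial>lborel)"
    using nn_integral_real_affine[of ?e "-1" 0] by simp
  also have "(\<integral>\<^sup>+y. ?e y \<partial>lborel) + (\<integral>\<^sup>+y. ?e y \<partial>lborel) = ennreal (2 / s)"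
    unfolding half using s by (simp add: ennreal_plus[symmetric] del: ennreal_plus)
  finally show ?thesis .
qed

lemma asym_norm_enorm: "asym_norm d (enorm d)"
proof
  fix x y :: "nat \<Rightarrow> real"
  show "enorm d (x + y) \<le> enorm d x + enorm d y"
    using L2_set_triangle_ineq[of x y "{..<d}"] by (simp add: enorm_def L2_set_def)
next
  fix x :: "nat \<Rightarrow> real" and c :: real assume "0 \<le> c"
  then show "enorm d (c *\<^sub>R x) = c * enorm d x"
    by (simp add: enorm_def L2_set_def power_mult_distrib sum_distrib_left[symmetric] real_sqrt_mult)
next
  have "\<bar>x i\<bar> \<le> 1 * enorm d x" if "i < d" for x i
    using that member_le_L2_set[of "{..<d}" i "\<lambda>i. \<bar>x i\<bar>"] by (simp add: enorm_def L2_set_def)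
  then show "\<exists>C. \<forall>x\<in>RR d. \<forall>i<d. \<bar>x i\<bar> \<le> C * enorm d x" by blast
qed (simp add: enorm_def L2_set_nonneg)

text \<open>
  On the unit ball the sum of the \<open>\<bar>x i\<bar>\<close> is at most \<open>sqrt d\<close>, so the indicator function of the ball is
  bounded by the product of the functions \<open>exp (1 - sqrt d * \<bar>x i\<bar>)\<close>.
\<close>

lemma Vol_Eball_pos: "0 < Vol d (Eball d 1)"
  and Vol_Eball_le: "d > 0 \<Longrightarrow> Vol d (Eball d 1) \<le> (exp 1 * 2 / sqrt (real d)) ^ d"
proof -
  interpret E: asym_norm d "enorm d" by (rule asym_norm_enorm)
  have eq: "Vol d (Eball d 1) = measure (leb d) (E.sublevel 1)"
    by (rule E.Vol_eq_measure_sublevel) (auto simp: Eball_def)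
  show "0 < Vol d (Eball d 1)" unfolding eq by (rule E.measure_sublevel_pos)
  assume d: "d > 0"
  define s where "s = sqrt (real d)"
  have s: "s > 0" "s * s = real d" using d by (auto simp: s_def)
  have "emeasure (leb d) (E.sublevel 1) = (\<integral>\<^sup>+x. indicator (E.sublevel 1) x \<partial>leb d)"
    by simp
  also have "\<dots> \<le> (\<integral>\<^sup>+x. (\<Prod>i<d. ennreal (exp 1 * exp (- s * \<bar>x i\<bar>))) \<partial>leb d)"
  proof (rule nn_integral_mono)
    fix x assume "x \<in> space (leb d)"
    show "indicator (E.sublevel 1) x \<le> (\<Prod>i<d. ennreal (exp 1 * exp (- s * \<bar>x i\<bar>)))"
    proof (cases "x \<in> E.sublevel 1")
      case True
      then have "L2_set x {..<d} \<le> 1" by (simp add: E.sublevel_def enorm_def L2_set_def)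
      then have sq: "(\<Sum>i<d. (x i)\<^sup>2) \<le> 1" by (simp add: L2_set_def)
      have "(\<Sum>i<d. \<bar>x i\<bar>)\<^sup>2 \<le> (\<Sum>i<d. \<bar>x i\<bar>\<^sup>2) * card {..<d}"
        by (rule sum_squared_le_sum_of_squares)
      also have "\<dots> \<le> 1 * real d" using sq by (intro mult_mono) auto
      also have "\<dots> = s\<^sup>2" using s by (simp add: power2_eq_square)
      finally have "(\<Sum>i<d. \<bar>x i\<bar>) \<le> s" using s(1) by (rule power2_le_imp_le[OF _ less_imp_le])
      then have "s * (\<Sum>i<d. \<bar>x i\<bar>) \<le> real d" using s by (metis less_imp_le mult_left_mono)
      then have "1 \<le> exp (\<Sum>i<d. 1 - s * \<bar>x i\<bar>)"
        by (simp add: sum_subtractf sum_distrib_left)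
      also have "\<dots> = (\<Prod>i<d. exp 1 * exp (- s * \<bar>x i\<bar>))"
        by (simp add: exp_sum exp_diff exp_minus field_simps)
      finally have "ennreal 1 \<le> ennreal (\<Prod>i<d. exp 1 * exp (- s * \<bar>x i\<bar>))"
        by (rule ennreal_leI)
      then show ?thesis using True by (simp add: prod_ennreal)
    qed simp
  qed
  also have "\<dots> = (\<Prod>i<d. \<integral>\<^sup>+y. ennreal (exp 1 * exp (- s * \<bar>y\<bar>)) \<partial>lborel)"
    by (rule leb.product_nn_integral_prod) auto
  also have "\<dots> \<le> (\<Prod>i<d. ennreal (exp 1 * (2 / s)))"
  proof (rule prod_mono_ennreal)
    fix i
    have "(\<integral>\<^sup>+y. ennreal (exp 1 * exp (- s * \<bar>y\<bar>)) \<partial>lborel) = ennreal (exp 1) * (\<integral>\<^sup>+y. ennreal (exp (- s * \<bar>y\<bar>)) \<partial>lborel)"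
      by (subst nn_integral_cmult[symmetric]) (auto simp: ennreal_mult)
    also have "\<dots> \<le> ennreal (exp 1) * ennreal (2 / s)"
      by (intro mult_left_mono nn_integral_exp_abs s) simp
    finally show "(\<integral>\<^sup>+y. ennreal (exp 1 * exp (- s * \<bar>y\<bar>)) \<partial>lborel) \<le> ennreal (exp 1 * (2 / s))"
      by (subst ennreal_mult) (use s in auto)
  qed
  also have "\<dots> = ennreal ((exp 1 * (2 / s)) ^ d)" using s by (simp add: ennreal_power)
  finally have "ennreal (measure (leb d) (E.sublevel 1)) \<le> ennreal ((exp 1 * (2 / s)) ^ d)"
    using E.emeasure_eq_measure_sublevel[of 1] by simp
  then show "Vol d (Eball d 1) \<le> (exp 1 * 2 / sqrt (real d)) ^ d"
    unfolding eq s_def[symmetric] using s by (simp add: ennreal_le_iff)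
qed

section \<open>The Lewis position\<close>

lemma mdet_inverse:
  assumes "mdet d A \<noteq> 0"
  obtains B where "\<And>i j. i < d \<Longrightarrow> j < d \<Longrightarrow> mmul d A B i j = mone i j"
    and "\<And>i j. i < d \<Longrightarrow> j < d \<Longrightarrow> mmul d B A i j = mone i j"
proof
  let ?M = "Matrix.mat d d (\<lambda>(i, j). A i j)"
  let ?B = "\<lambda>i j. adj_mat ?M $$ (i, j) / mdet d A"
  have M: "?M \<in> carrier_mat d d" by simp
  note adj = adj_mat[OF M]
  have dim: "dim_row (adj_mat ?M) = d" "dim_col (adj_mat ?M) = d" using adj(1) by auto
  fix i j assume ij: "i < d" "j < d"
  have "(?M * adj_mat ?M) $$ (i, j) = (Determinant.det ?M \<cdot>\<^sub>m 1\<^sub>m d) $$ (i, j)"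
    by (simp only: adj(2))
  then have "(\<Sum>k<d. A i k * adj_mat ?M $$ (k, j)) = mdet d A * mone i j"
    using ij dim by (simp add: scalar_prod_def mdet_def mone_def atLeast0LessThan)
  then show "mmul d A ?B i j = mone i j"
    using assms by (simp add: mmul_def sum_divide_distrib[symmetric])
  have "(adj_mat ?M * ?M) $$ (i, j) = (Determinant.det ?M \<cdot>\<^sub>m 1\<^sub>m d) $$ (i, j)"
    by (simp only: adj(3))
  then have "(\<Sum>k<d. adj_mat ?M $$ (i, k) * A k j) = mdet d A * mone i j"
    using ij dim by (simp add: scalar_prod_def mdet_def mone_def atLeast0LessThan)
  then show "mmul d ?B A i j = mone i j"
    using assms by (simp add: mmul_def sum_divide_distrib[symmetric])
qed

text \<open>
  The derivative of the determinant at the identity is the trace: in the Leibniz formula a permutation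
  other than the identity moves at least two indices and contributes to second order only.
\<close>

lemma mdet_one_plus_deriv:
  "((\<lambda>s. mdet d (\<lambda>i j. mone i j + s * E i j)) has_real_derivative (\<Sum>i<d. E i i)) (at 0)"
proof -
  let ?P = "{p. p permutes {..<d}}"
  define D where "D = (\<lambda>p. \<Sum>i<d. E i (p i) * (\<Prod>k\<in>{..<d} - {i}. mone k (p k)))"
  have "((\<lambda>s. mdet d (\<lambda>i j. mone i j + s * E i j)) has_real_derivative (\<Sum>p\<in>?P. of_int (sign p) * D p)) (at 0)"
    unfolding mdet_leibniz
  proof (intro DERIV_sum DERIV_cmult)
    fix p
    have "((\<lambda>s. \<Prod>i<d. mone i (p i) + s * E i (p i)) has_real_derivative
        (\<Sum>i<d. E i (p i) * (\<Prod>k\<in>{..<d} - {i}. mone k (p k) + 0 * E k (p k)))) (at 0)"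
      by (rule has_field_derivative_prod) (auto intro!: derivative_eq_intros)
    then show "((\<lambda>s. \<Prod>i<d. mone i (p i) + s * E i (p i)) has_real_derivative D p) (at 0)"
      by (simp add: D_def)
  qed
  moreover have "D p = 0" if p: "p \<in> ?P - {id}" for p
    unfolding D_def
  proof (intro sum.neutral ballI)
    fix i assume i: "i \<in> {..<d}"
    obtain k where k: "k \<in> {..<d} - {i}" "p k \<noteq> k"
      using permutes_not_id_moves_other[of p "{..<d}" i] p by blast
    then have "mone k (p k) = 0" by (auto simp: mone_def)
    with k have "\<exists>k\<in>{..<d} - {i}. mone k (p k) = 0" by blast
    then have "(\<Prod>k\<in>{..<d} - {i}. mone k (p k)) = 0" by (intro prod_zero) auto
    then show "E i (p i) * (\<Prod>k\<in>{..<d} - {i}. mone k (p k)) = 0" by simp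
  qed
  then have "(\<Sum>p\<in>?P - {id}. of_int (sign p) * D p) = 0" by (intro sum.neutral) simp
  moreover have "(\<Sum>p\<in>?P. of_int (sign p) * D p) = of_int (sign (id :: nat \<Rightarrow> nat)) * D id + (\<Sum>p\<in>?P - {id}. of_int (sign p) * D p)"
    by (rule sum.remove) (simp_all add: finite_permutations permutes_id)
  moreover have "D id = (\<Sum>i<d. E i i)" by (simp add: D_def mone_def)
  ultimately show ?thesis by (simp add: sign_id)
qed

lemma continuous_mdet: "continuous_on UNIV (\<lambda>A. mdet d A)"
proof -
  have "continuous_on UNIV (\<lambda>A :: nat \<Rightarrow> nat \<Rightarrow> real. A i j)" for i j
    by (rule continuous_on_product_then_coordinatewise[OF continuous_on_product_coordinates])
  then show ?thesis
    unfolding mdet_leibniz by (intro continuous_intros)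
qed

lemma mean_real: "mean m F = (\<Sum>t\<in>Omega m. F t :: real) / real (card (Omega m))"
  by (simp add: mean_def field_simps)

lemma mean_mono: "(\<And>t. t \<in> Omega m \<Longrightarrow> F t \<le> (G t :: real)) \<Longrightarrow> mean m F \<le> mean m G"
  unfolding mean_real by (intro divide_right_mono sum_mono) auto

lemma mean_nonneg: "(\<And>t. t \<in> Omega m \<Longrightarrow> 0 \<le> (F t :: real)) \<Longrightarrow> 0 \<le> mean m F"
  unfolding mean_real by (intro divide_nonneg_nonneg sum_nonneg) auto

lemma mean_fun_apply: "mean m F i = mean m (\<lambda>t. F t i)"
  by (simp add: mean_def sum_fun_apply)

lemma mvec_add_scaled: "mvec d (\<lambda>i j. A i j + s * B i j) x = mvec d A x + s *\<^sub>R mvec d B x"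
  by (auto simp: mvec_def fun_eq_iff distrib_right sum.distrib sum_distrib_left mult.assoc)

context asym_norm begin

definition Omega_norm :: "nat \<Rightarrow> ((nat \<Rightarrow> real) \<Rightarrow> nat \<Rightarrow> real) \<Rightarrow> real" where
  "Omega_norm m f = sqrt (mean m (\<lambda>t. (N (f t))\<^sup>2))"

lemma Omega_norm_L2_set: "Omega_norm m f = L2_set (\<lambda>t. N (f t)) (Omega m) / sqrt (real (card (Omega m)))"
  by (simp add: Omega_norm_def mean_real L2_set_def real_sqrt_divide)

lemma Omega_norm_nonneg: "0 \<le> Omega_norm m f"
  by (simp add: Omega_norm_L2_set L2_set_nonneg)

lemma Omega_norm_add:
  assumes f: "\<And>t. t \<in> Omega m \<Longrightarrow> f t \<in> RR d" and g: "\<And>t. t \<in> Omega m \<Longrightarrow> g t \<in> RR d"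
  shows "Omega_norm m (\<lambda>t. f t + g t) \<le> Omega_norm m f + Omega_norm m g"
proof -
  have "L2_set (\<lambda>t. N (f t + g t)) (Omega m) \<le> L2_set (\<lambda>t. N (f t) + N (g t)) (Omega m)"
    using f g by (intro L2_set_mono N_add N_nonneg) auto
  also have "\<dots> \<le> L2_set (\<lambda>t. N (f t)) (Omega m) + L2_set (\<lambda>t. N (g t)) (Omega m)"
    by (rule L2_set_triangle_ineq)
  finally show ?thesis
    unfolding Omega_norm_L2_set add_divide_distrib[symmetric] by (rule divide_right_mono) simp
qed

lemma Omega_norm_scale:
  assumes f: "\<And>t. t \<in> Omega m \<Longrightarrow> f t \<in> RR d" and c: "0 \<le> c"
  shows "Omega_norm m (\<lambda>t. c *\<^sub>R f t) = c * Omega_norm m f"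
proof -
  have "mean m (\<lambda>t. (N (c *\<^sub>R f t))\<^sup>2) = c\<^sup>2 * mean m (\<lambda>t. (N (f t))\<^sup>2)"
    unfolding mean_real using f c by (simp add: N_scale power_mult_distrib sum_distrib_left)
  then show ?thesis using c by (simp add: Omega_norm_def real_sqrt_mult)
qed

text \<open>
  The second moment norm of the Rademacher sum of the columns.
\<close>

definition position_norm :: "(nat \<Rightarrow> nat \<Rightarrow> real) \<Rightarrow> real" where
  "position_norm A = Omega_norm d (mvec d A)"

lemma position_norm_add_scaled: "0 \<le> s \<Longrightarrow> position_norm (\<lambda>i j. A i j + s * B i j) \<le> position_norm A + s * position_norm B"
  unfolding position_norm_def mvec_add_scaled
  using Omega_norm_add[of d "mvec d A" "\<lambda>t. s *\<^sub>R mvec d B t"] Omega_norm_scale[of d "mvec d B" s]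
  by simp

lemma position_norm_scale: "0 \<le> s \<Longrightarrow> position_norm (\<lambda>i j. s * A i j) = s * position_norm A"
proof -
  assume s: "0 \<le> s"
  have "mvec d (\<lambda>i j. s * A i j) = (\<lambda>t. s *\<^sub>R mvec d A t)"
    by (auto simp: mvec_def fun_eq_iff sum_distrib_left mult.assoc)
  then show ?thesis unfolding position_norm_def using Omega_norm_scale[OF _ s] by simp
qed

lemma position_norm_cong: "(\<And>i j. i < d \<Longrightarrow> j < d \<Longrightarrow> A i j = B i j) \<Longrightarrow> position_norm A = position_norm B"
  unfolding position_norm_def mvec_def by (intro arg_cong[where f = "Omega_norm d"]) (auto simp: fun_eq_iff)

text \<open>
  The entries are recovered from the Rademacher sum by orthogonality of the signs.
\<close>

lemma position_norm_bounds_entries: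
  obtains C where "\<And>A i j. i < d \<Longrightarrow> j < d \<Longrightarrow> \<bar>A i j\<bar> \<le> C * position_norm A"
proof -
  obtain C where C: "\<And>x i. x \<in> RR d \<Longrightarrow> i < d \<Longrightarrow> \<bar>x i\<bar> \<le> C * N x"
    using N_coercive by blast
  let ?c = "real (card (Omega d))"
  have c: "?c > 0" by (simp add: card_Omega)
  show thesis
  proof
    fix A :: "nat \<Rightarrow> nat \<Rightarrow> real" and i j assume ij: "i < d" "j < d"
    have "(\<Sum>t\<in>Omega d. t j * mvec d A t i) = (\<Sum>t\<in>Omega d. \<Sum>l<d. A i l * (t j * t l))"
      using ij by (simp add: mvec_def sum_distrib_left mult_ac)
    also have "\<dots> = (\<Sum>l<d. A i l * (\<Sum>t\<in>Omega d. t j * t l))"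
      by (subst sum.swap) (simp add: sum_distrib_left)
    also have "\<dots> = (\<Sum>l<d. if l = j then A i j * ?c else 0)"
      using ij by (intro sum.cong) (auto simp: sum_Omega_orthogonal)
    also have "\<dots> = A i j * ?c" using ij by simp
    finally have "\<bar>A i j\<bar> * ?c = \<bar>\<Sum>t\<in>Omega d. t j * mvec d A t i\<bar>"
      using c by (simp add: abs_mult)
    also have "\<dots> \<le> (\<Sum>t\<in>Omega d. \<bar>C\<bar> * N (mvec d A t))"
    proof (rule order_trans[OF sum_abs sum_mono])
      fix t assume t: "t \<in> Omega d"
      have "\<bar>t j * mvec d A t i\<bar> = \<bar>mvec d A t i\<bar>" using Omega_abs[OF t ij(2)] by (simp add: abs_mult)
      also have "\<dots> \<le> C * N (mvec d A t)" using ij by (intro C) auto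
      also have "\<dots> \<le> \<bar>C\<bar> * N (mvec d A t)" by (intro mult_right_mono N_nonneg) auto
      finally show "\<bar>t j * mvec d A t i\<bar> \<le> \<bar>C\<bar> * N (mvec d A t)" .
    qed
    also have "\<dots> = \<bar>C\<bar> * (\<Sum>t\<in>Omega d. N (mvec d A t))" by (simp add: sum_distrib_left)
    also have "\<dots> \<le> \<bar>C\<bar> * (?c * position_norm A)"
    proof (rule mult_left_mono)
      have "(\<Sum>t\<in>Omega d. N (mvec d A t))\<^sup>2 \<le> (\<Sum>t\<in>Omega d. (N (mvec d A t))\<^sup>2) * ?c"
        by (rule sum_squared_le_sum_of_squares)
      also have "\<dots> = (?c * position_norm A)\<^sup>2"
        using c mean_nonneg[of d "\<lambda>t. (N (mvec d A t))\<^sup>2"]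
        by (simp add: position_norm_def Omega_norm_def power_mult_distrib) (simp add: mean_real power2_eq_square)
      finally show "(\<Sum>t\<in>Omega d. N (mvec d A t)) \<le> ?c * position_norm A"
        by (rule power2_le_imp_le) (simp add: position_norm_def Omega_norm_nonneg)
    qed simp
    finally have "\<bar>A i j\<bar> * ?c \<le> (\<bar>C\<bar> * position_norm A) * ?c" by (simp add: mult_ac)
    then show "\<bar>A i j\<bar> \<le> \<bar>C\<bar> * position_norm A" using c by simp
  qed
qed

lemma continuous_position_norm: "continuous_on UNIV position_norm"
proof -
  have coord: "continuous_on UNIV (\<lambda>A :: nat \<Rightarrow> nat \<Rightarrow> real. A i j)" for i j
    by (rule continuous_on_product_then_coordinatewise[OF continuous_on_product_coordinates])
  have "continuous_on UNIV (\<lambda>A. N (mvec d A t))" for t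
  proof -
    have "continuous_on UNIV (\<lambda>A. mvec d A t)"
    proof (rule continuous_on_coordinatewise_then_product)
      show "continuous_on UNIV (\<lambda>A. mvec d A t i)" for i
        unfolding mvec_def by (cases "i < d") (auto intro!: continuous_intros coord)
    qed
    then have "continuous_on UNIV (\<lambda>A. N (trunc d (mvec d A t)))"
      by (rule continuous_on_compose2[OF continuous_N_trunc]) simp
    then show ?thesis by (simp add: trunc_id)
  qed
  then show ?thesis
    unfolding position_norm_def Omega_norm_def mean_real by (intro continuous_intros) (auto simp: card_Omega)
qed

definition position_ball :: "(nat \<Rightarrow> nat \<Rightarrow> real) set" where
  "position_ball = {A. (\<forall>i j. d \<le> i \<or> d \<le> j \<longrightarrow> A i j = 0) \<and> position_norm A \<le> 1}"

lemma compact_position_ball: "compact position_ball"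
proof -
  obtain C where C: "\<And>A i j. i < d \<Longrightarrow> j < d \<Longrightarrow> \<bar>A i j\<bar> \<le> C * position_norm A"
    using position_norm_bounds_entries by blast
  define B where "B = (\<lambda>i j. if i < d \<and> j < d then {-\<bar>C\<bar>..\<bar>C\<bar>} else {0 :: real})"
  let ?box = "Pi\<^sub>E UNIV (\<lambda>i. Pi\<^sub>E UNIV (B i))"
  have "compactin (product_topology (\<lambda>_. euclideanreal) UNIV) (Pi\<^sub>E UNIV (B i))" for i
    unfolding compactin_PiE by (auto simp: B_def)
  then have row: "compact (Pi\<^sub>E UNIV (B i))" for i
    by (simp add: euclidean_product_topology)
  have "compactin (product_topology (\<lambda>_. euclidean) UNIV) ?box"
    unfolding compactin_PiE using row by simp
  then have box: "compact ?box" by (simp add: euclidean_product_topology)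
  have "closed {A. position_norm A \<le> 1}"
    by (rule closed_Collect_le[OF continuous_position_norm]) simp
  then have "compact (?box \<inter> {A. position_norm A \<le> 1})"
    by (rule compact_Int_closed[OF box])
  moreover have "position_ball = ?box \<inter> {A. position_norm A \<le> 1}"
  proof (intro Set.set_eqI iffI)
    fix A assume A: "A \<in> position_ball"
    have "A i j \<in> B i j" for i j
    proof (cases "i < d \<and> j < d")
      case True
      then have "\<bar>A i j\<bar> \<le> C * position_norm A" by (intro C) auto
      also have "\<dots> \<le> \<bar>C\<bar> * 1"
        using A by (intro mult_mono) (auto simp: position_ball_def position_norm_def Omega_norm_nonneg)
      finally show ?thesis using True by (auto simp: B_def)
    next
      case False
      then show ?thesis using A by (auto simp: B_def position_ball_def)
    qed
    then show "A \<in> ?box \<inter> {A. position_norm A \<le> 1}" using A by (auto simp: position_ball_def)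
  next
    fix A assume A: "A \<in> ?box \<inter> {A. position_norm A \<le> 1}"
    have "A i j = 0" if "d \<le> i \<or> d \<le> j" for i j
    proof -
      have "A i j \<in> B i j" using A by (auto simp: PiE_iff)
      then show ?thesis using that by (auto simp: B_def)
    qed
    then show "A \<in> position_ball" using A by (simp add: position_ball_def)
  qed
  ultimately show ?thesis by simp
qed

text \<open>
  \<open>A\<close> maximizes the determinant on the unit ball of \<open>position_norm\<close>.  For \<open>s \<ge> 0\<close> the matrix \<open>A + s S\<close>
  divided by \<open>1 + s * position_norm S\<close> competes with \<open>A\<close>, so the determinant of \<open>1 + s B S\<close> is at most
  \<open>(1 + s * position_norm S)\<^sup>d\<close>, with equality at \<open>s = 0\<close>; compare the derivatives there.
\<close>

lemma lewis_position:
  obtains A B where "mdet d A \<noteq> 0" "position_norm A \<le> 1"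
    and "\<And>i j. i < d \<Longrightarrow> j < d \<Longrightarrow> mmul d B A i j = mone i j"
    and "\<And>S. (\<Sum>i<d. mmul d B S i i) \<le> real d * position_norm S"
proof -
  have cut: "mdet d S \<le> b ^ d * mdet d A"
    if A: "\<And>A'. A' \<in> position_ball \<Longrightarrow> mdet d A' \<le> mdet d A" and b: "b > 0" "position_norm S \<le> b" for A S b
  proof -
    define T where "T = (\<lambda>i j. if i < d \<and> j < d then (1 / b) * S i j else 0)"
    have "position_norm T = position_norm (\<lambda>i j. (1 / b) * S i j)" by (rule position_norm_cong) (simp add: T_def)
    also have "\<dots> \<le> 1" using b by (subst position_norm_scale) (auto simp: divide_le_eq_1)
    finally have "T \<in> position_ball" by (auto simp: position_ball_def T_def)
    then have T: "mdet d T \<le> mdet d A" by (rule A)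
    have "mdet d S = mdet d (\<lambda>i j. T i j * b)" using b by (intro mdet_cong) (simp add: T_def)
    also have "\<dots> = b ^ d * mdet d T" using mdet_scale_columns[of d T "\<lambda>_. b"] by simp
    also have "\<dots> \<le> b ^ d * mdet d A" using T b by (intro mult_left_mono) auto
    finally show ?thesis .
  qed
  have "0 \<in> position_ball"
  proof -
    have "position_norm 0 = 0" using position_norm_scale[of 0 0] by (simp add: zero_fun_def)
    then show ?thesis by (simp add: position_ball_def)
  qed
  then obtain A where A: "A \<in> position_ball" "\<And>A'. A' \<in> position_ball \<Longrightarrow> mdet d A' \<le> mdet d A"
    using continuous_attains_sup[OF compact_position_ball _ continuous_on_subset[OF continuous_mdet]]
    by (metis empty_iff subset_UNIV)
  have "mdet d mone \<le> (1 + position_norm mone) ^ d * mdet d A"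
    using A(2) by (rule cut) (auto simp: position_norm_def Omega_norm_nonneg add_pos_nonneg)
  moreover have "0 < (1 + position_norm mone) ^ d" by (simp add: position_norm_def Omega_norm_nonneg add_pos_nonneg)
  ultimately have det: "mdet d A > 0"
    by (simp add: mdet_mone) (smt (verit) zero_less_mult_pos)
  obtain B where AB: "\<And>i j. i < d \<Longrightarrow> j < d \<Longrightarrow> mmul d A B i j = mone i j"
    and BA: "\<And>i j. i < d \<Longrightarrow> j < d \<Longrightarrow> mmul d B A i j = mone i j"
    using mdet_inverse[of d A] det by auto
  show thesis
  proof (rule that[OF _ _ BA])
    show "mdet d A \<noteq> 0" using det by simp
    show "position_norm A \<le> 1" using A(1) by (simp add: position_ball_def)
    fix S
    define E where "E = mmul d B S"
    define g where "g = (\<lambda>s. (1 + s * position_norm S) ^ d - mdet d (\<lambda>i j. mone i j + s * E i j))"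
    have g_pos: "0 \<le> g s" if s: "0 < s" for s
    proof -
      have "mdet d A * mdet d (\<lambda>i j. mone i j + s * E i j) = mdet d (mmul d A (\<lambda>i j. mone i j + s * E i j))"
        by (simp add: mdet_mmul)
      also have "\<dots> = mdet d (\<lambda>i j. A i j + s * S i j)"
      proof (rule mdet_cong)
        fix i j assume ij: "i < d" "j < d"
        have "(\<Sum>k<d. A i k * E k j) = (\<Sum>k<d. \<Sum>l<d. A i k * B k l * S l j)"
          by (simp add: E_def mmul_def sum_distrib_left mult.assoc)
        also have "\<dots> = (\<Sum>l<d. \<Sum>k<d. A i k * B k l * S l j)" by (rule sum.swap)
        also have "\<dots> = (\<Sum>l<d. mmul d A B i l * S l j)" by (simp add: mmul_def sum_distrib_right)
        also have "\<dots> = (\<Sum>l<d. if l = i then S i j else 0)"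
          using ij AB by (intro sum.cong) (auto simp: mone_def)
        also have "\<dots> = S i j" using ij by simp
        finally have AE: "(\<Sum>k<d. A i k * E k j) = S i j" .
        have "(\<Sum>k<d. A i k * mone k j) = (\<Sum>k<d. if k = j then A i j else 0)"
          by (intro sum.cong) (auto simp: mone_def)
        also have "\<dots> = A i j" using ij by simp
        finally have Aone: "(\<Sum>k<d. A i k * mone k j) = A i j" .
        have "mmul d A (\<lambda>i j. mone i j + s * E i j) i j = (\<Sum>k<d. A i k * mone k j) + s * (\<Sum>k<d. A i k * E k j)"
          by (simp add: mmul_def distrib_left sum.distrib sum_distrib_left mult_ac)
        then show "mmul d A (\<lambda>i j. mone i j + s * E i j) i j = A i j + s * S i j"
          by (simp only: AE Aone)
      qed
      also have "\<dots> \<le> (1 + s * position_norm S) ^ d * mdet d A"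
      proof (rule cut[OF A(2)])
        show "0 < 1 + s * position_norm S" using s by (simp add: position_norm_def Omega_norm_nonneg add_pos_nonneg)
        show "position_norm (\<lambda>i j. A i j + s * S i j) \<le> 1 + s * position_norm S"
          using position_norm_add_scaled[of s A S] s \<open>position_norm A \<le> 1\<close> by simp
      qed
      finally show ?thesis using det by (simp add: g_def mult.commute)
    qed
    have "g 0 = 0" by (simp add: g_def mdet_mone)
    have "((\<lambda>s. (1 + s * position_norm S) ^ d) has_real_derivative real d * position_norm S) (at 0)"
      by (auto intro!: derivative_eq_intros)
    then have "(g has_real_derivative real d * position_norm S - (\<Sum>i<d. E i i)) (at 0)"
      unfolding g_def by (intro DERIV_diff mdet_one_plus_deriv)
    moreover have "\<not> real d * position_norm S - (\<Sum>i<d. E i i) < 0"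
    proof
      assume "real d * position_norm S - (\<Sum>i<d. E i i) < 0"
      then obtain e where "e > 0" "\<And>h. h > 0 \<Longrightarrow> h < e \<Longrightarrow> g (0 + h) < g 0"
        using DERIV_neg_dec_right[OF \<open>(g has_real_derivative _) _\<close>] by blast
      from this(2)[of "e / 2"] this(1) g_pos[of "e / 2"] \<open>g 0 = 0\<close> show False by simp
    qed
    ultimately show "(\<Sum>i<d. mmul d B S i i) \<le> real d * position_norm S" by (simp add: E_def)
  qed
qed

end

section \<open>Supporting functionals and the dual position\<close>

definition dot :: "nat \<Rightarrow> (nat \<Rightarrow> real) \<Rightarrow> (nat \<Rightarrow> real) \<Rightarrow> real" where
  "dot d w x = (\<Sum>i<d. w i * x i)"

lemma dot_add_left: "dot d (v + w) x = dot d v x + dot d w x"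
  and dot_add_right: "dot d w (x + y) = dot d w x + dot d w y"
  and dot_scale_left: "dot d (c *\<^sub>R w) x = c * dot d w x"
  and dot_scale_right: "dot d w (c *\<^sub>R x) = c * dot d w x"
  and dot_uminus_right: "dot d w (- x) = - dot d w x"
  by (simp_all add: dot_def algebra_simps sum.distrib sum_distrib_left sum_negf)

lemma dot_zero_right [simp]: "dot d w 0 = 0"
  by (simp add: dot_def)

lemma mvec_mvec: "mvec d A (mvec d B x) = mvec d (mmul d A B) x"
proof
  fix i
  have "(\<Sum>j<d. A i j * mvec d B x j) = (\<Sum>j<d. \<Sum>k<d. A i j * B j k * x k)"
    by (intro sum.cong refl) (simp add: mvec_def sum_distrib_left mult.assoc)
  also have "\<dots> = (\<Sum>k<d. \<Sum>j<d. A i j * B j k * x k)"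
    by (rule sum.swap)
  also have "\<dots> = (\<Sum>k<d. mmul d A B i k * x k)"
    by (intro sum.cong refl) (simp add: mmul_def sum_distrib_right)
  finally have "(\<Sum>j<d. A i j * mvec d B x j) = (\<Sum>k<d. mmul d A B i k * x k)" .
  then show "mvec d A (mvec d B x) i = mvec d (mmul d A B) x i"
    by (simp add: mvec_def[of d A] mvec_def[of d "mmul d A B"])
qed

lemma RR_mono: "k \<le> d \<Longrightarrow> x \<in> RR k \<Longrightarrow> x \<in> RR d"
  by (auto simp: RR_iff)

lemma mean_sum: "mean m (\<lambda>t. \<Sum>i\<in>I. F i t :: real) = (\<Sum>i\<in>I. mean m (F i))"
  unfolding mean_real by (subst sum.swap) (rule sum_divide_distrib)

lemma mean_cmult: "mean m (\<lambda>t. c * F t :: real) = c * mean m F"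
  unfolding mean_real by (simp add: sum_distrib_left)

context asym_norm begin

text \<open>
  The extension step of the theorem of Hahn and Banach: a functional on the span of \<open>y\<close> and the first
  \<open>k\<close> coordinate vectors, dominated by \<open>N\<close> and equal to \<open>N y\<close> at \<open>y\<close>, extends to one more coordinate
  vector.  The functional is written with a separate coefficient \<open>t\<close> for \<open>y\<close>, even if \<open>y\<close> depends on the
  other vectors; domination makes it well defined.
\<close>

lemma supporting_functional_extend:
  assumes k: "k < d" and y: "y \<in> RR d"
    and dom: "\<And>t x. x \<in> RR k \<Longrightarrow> t * N y + dot k a x \<le> N (t *\<^sub>R y + x)"
  shows "\<exists>c. \<forall>t. \<forall>x\<in>RR (Suc k). t * N y + dot (Suc k) (a(k := c)) x \<le> N (t *\<^sub>R y + x)"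
proof -
  let ?e = "basis_vec k"
  have e: "?e \<in> RR d" using k by (rule RR_basis_vec)
  have Rk: "x \<in> RR d" if "x \<in> RR k" for x using RR_mono[OF less_imp_le[OF k] that] .
  define lo where "lo = (\<lambda>(t, x). t * N y + dot k a x - N (t *\<^sub>R y + x - ?e))"
  define hi where "hi = (\<lambda>(t, x). N (t *\<^sub>R y + x + ?e) - (t * N y + dot k a x))"
  define P where "P = (UNIV :: real set) \<times> RR k"
  have lo_hi: "lo p \<le> hi q" if p: "p \<in> P" and q: "q \<in> P" for p q
  proof -
    obtain t x t' x' where pq: "p = (t, x)" "q = (t', x')" and x: "x \<in> RR k" "x' \<in> RR k"
      using p q by (auto simp: P_def)
    have "(t + t') * N y + dot k a (x + x') \<le> N ((t + t') *\<^sub>R y + (x + x'))"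
      by (rule dom) (rule RR_add[OF x])
    also have "(t + t') *\<^sub>R y + (x + x') = (t *\<^sub>R y + x - ?e) + (t' *\<^sub>R y + x' + ?e)"
      by (simp add: scaleR_add_left)
    also have "N \<dots> \<le> N (t *\<^sub>R y + x - ?e) + N (t' *\<^sub>R y + x' + ?e)"
      using x y e Rk by (intro N_add) auto
    finally show ?thesis
      by (simp only: pq lo_def hi_def prod.case dot_add_right distrib_right)
  qed
  have P0: "(0, 0) \<in> P" by (simp add: P_def)
  \<comment> \<open>any number between the values of \<open>lo\<close> and those of \<open>hi\<close> would do\<close>
  define c where "c = Sup (lo ` P)"
  have bdd: "bdd_above (lo ` P)" using lo_hi[OF _ P0] by (intro bdd_aboveI2) auto
  have c_lo: "lo p \<le> c" if "p \<in> P" for p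
    unfolding c_def using that bdd by (intro cSup_upper) auto
  have c_hi: "c \<le> hi p" if "p \<in> P" for p
    unfolding c_def using lo_hi[OF _ that] P0 by (intro cSup_least) auto
  have scaled: "t * N y + dot k a x + r * c \<le> N (t *\<^sub>R y + x + r *\<^sub>R ?e)" if x: "x \<in> RR k" for t r x
  proof (cases "r = 0")
    case True
    then show ?thesis using dom[OF x, of t] by simp
  next
    case False
    define u where "u = \<bar>r\<bar>"
    have u: "u > 0" using False by (simp add: u_def)
    let ?t = "t / u" and ?x = "(1 / u) *\<^sub>R x"
    have P: "(?t, ?x) \<in> P" using x by (simp add: P_def)
    define z where "z = ?t *\<^sub>R y + ?x + (r / u) *\<^sub>R ?e"
    have "?t * N y + dot k a ?x + (r / u) * c \<le> N z"
    proof (cases "r > 0")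
      case True
      then have "r / u = 1" using u by (simp add: u_def)
      then show ?thesis using c_hi[OF P] by (simp add: hi_def z_def)
    next
      case neg: False
      then have "r / u = -1" using False by (simp add: u_def)
      then show ?thesis using c_lo[OF P] by (simp add: lo_def z_def)
    qed
    then have "u * (?t * N y + dot k a ?x + (r / u) * c) \<le> u * N z"
      using u by (intro mult_left_mono) auto
    also have "u * N z = N (u *\<^sub>R z)"
      using u y e Rk[OF x] by (intro N_scale[symmetric]) (auto simp: z_def)
    also have "u *\<^sub>R z = t *\<^sub>R y + x + r *\<^sub>R ?e"
      using u by (simp add: z_def scaleR_add_right)
    also have "u * (?t * N y + dot k a ?x + (r / u) * c) = t * N y + dot k a x + r * c"
      using u by (simp add: dot_scale_right distrib_left)
    finally show ?thesis .
  qed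
  show ?thesis
  proof (intro exI allI ballI)
    fix t x assume x: "x \<in> RR (Suc k)"
    let ?x = "x(k := 0)"
    have x': "?x \<in> RR k" using x by (auto simp: RR_iff)
    have "?x + x k *\<^sub>R ?e = x" by (auto simp: fun_eq_iff basis_vec_def)
    then have "N (t *\<^sub>R y + ?x + x k *\<^sub>R ?e) = N (t *\<^sub>R y + x)" by (simp only: add.assoc)
    moreover have "dot (Suc k) (a(k := c)) x = dot k a ?x + x k * c"
      by (simp add: dot_def mult.commute)
    ultimately show "t * N y + dot (Suc k) (a(k := c)) x \<le> N (t *\<^sub>R y + x)"
      using scaled[OF x', of t "x k"] by linarith
  qed
qed

lemma supporting_functional:
  assumes y: "y \<in> RR d"
  shows "\<exists>a\<in>RR d. (\<forall>x\<in>RR d. dot d a x \<le> N x) \<and> N y \<le> dot d a y"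
proof -
  have "\<exists>a. \<forall>t. \<forall>x\<in>RR k. t * N y + dot k a x \<le> N (t *\<^sub>R y + x)" if "k \<le> d" for k
    using that
  proof (induction k)
    case 0
    have "t * N y \<le> N (t *\<^sub>R y)" for t
    proof (cases "0 \<le> t")
      case True
      then show ?thesis using N_scale[OF y, of t] by simp
    next
      case False
      then have "t * N y \<le> 0" using N_nonneg[OF y] by (intro mult_nonpos_nonneg) auto
      also have "0 \<le> N (t *\<^sub>R y)" using y by (intro N_nonneg) auto
      finally show ?thesis .
    qed
    moreover have "x = 0" if "x \<in> RR 0" for x using that by (auto simp: RR_iff fun_eq_iff)
    ultimately have "t * N y + dot 0 a x \<le> N (t *\<^sub>R y + x)" if "x \<in> RR 0" for a t x
      using that[THEN \<open>\<And>x. x \<in> RR 0 \<Longrightarrow> x = 0\<close>] by (simp add: dot_def)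
    then show ?case by blast
  next
    case (Suc k)
    then have "k \<le> d" "k < d" by simp_all
    with Suc.IH obtain a where "\<And>t x. x \<in> RR k \<Longrightarrow> t * N y + dot k a x \<le> N (t *\<^sub>R y + x)" by blast
    from supporting_functional_extend[OF \<open>k < d\<close> y this] show ?case by blast
  qed
  then obtain a where a: "\<And>t x. x \<in> RR d \<Longrightarrow> t * N y + dot d a x \<le> N (t *\<^sub>R y + x)" by blast
  have tr: "dot d (trunc d a) x = dot d a x" for x by (simp add: dot_def)
  have "dot d a x \<le> N x" if "x \<in> RR d" for x using a[of x 0] that by simp
  moreover have "N y \<le> dot d a y" using a[of "- y" 1] y by (simp add: dot_uminus_right)
  ultimately show ?thesis by (intro bexI[of _ "trunc d a"]) (auto simp: tr)
qed

end

context centered_body begin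

definition support :: "(nat \<Rightarrow> real) \<Rightarrow> real" where
  "support w = Sup (dot d w ` L)"

lemma bdd_above_dot: "bdd_above (dot d w ` L)"
proof -
  obtain C where C: "\<And>x i. x \<in> RR d \<Longrightarrow> i < d \<Longrightarrow> \<bar>x i\<bar> \<le> C * p x"
    using N_coercive by blast
  show ?thesis
  proof (rule bdd_aboveI2)
    fix x assume x: "x \<in> L"
    then have xR: "x \<in> RR d" using subset_RR by blast
    show "dot d w x \<le> (\<Sum>i<d. \<bar>w i\<bar> * \<bar>C\<bar>)"
      unfolding dot_def
    proof (rule sum_mono)
      fix i assume i: "i \<in> {..<d}"
      have "\<bar>x i\<bar> \<le> C * p x" using C[OF xR] i by simp
      also have "\<dots> \<le> \<bar>C\<bar> * 1"
        using gauge_le_one[OF x] N_nonneg[OF xR] by (intro mult_mono) auto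
      finally have "\<bar>w i * x i\<bar> \<le> \<bar>w i\<bar> * \<bar>C\<bar>" by (simp add: abs_mult mult_left_mono)
      then show "w i * x i \<le> \<bar>w i\<bar> * \<bar>C\<bar>" by linarith
    qed
  qed
qed

lemma dot_le_support: "x \<in> L \<Longrightarrow> dot d w x \<le> support w"
  unfolding support_def by (rule cSup_upper[OF imageI bdd_above_dot])

lemma support_least: "(\<And>x. x \<in> L \<Longrightarrow> dot d w x \<le> b) \<Longrightarrow> support w \<le> b"
  unfolding support_def using zero_mem by (intro cSup_least) auto

lemma support_nonneg: "0 \<le> support w"
  using dot_le_support[OF zero_mem, of w] by simp

lemma support_add: "support (v + w) \<le> support v + support w"
  by (rule support_least) (simp add: dot_add_left add_mono dot_le_support)

lemma support_scale: "0 \<le> c \<Longrightarrow> support (c *\<^sub>R w) = c * support w"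
proof -
  assume c: "0 \<le> c"
  have le: "support (c *\<^sub>R w) \<le> c * support w" if "0 \<le> c" for c w
    by (rule support_least) (simp add: dot_scale_left mult_left_mono dot_le_support that)
  show ?thesis
  proof (cases "c = 0")
    case True
    then show ?thesis using le[of 0 w] support_nonneg[of 0] by simp
  next
    case False
    with c have "support w \<le> (1 / c) * support (c *\<^sub>R w)" using le[of "1 / c" "c *\<^sub>R w"] by simp
    with c False have "c * support w \<le> support (c *\<^sub>R w)" by (simp add: field_simps)
    with le[OF c] show ?thesis by (intro antisym)
  qed
qed

lemma dot_le_support_gauge:
  assumes x: "x \<in> RR d"
  shows "dot d w x \<le> support w * p x"
proof (rule field_le_epsilon)
  fix e :: real assume e: "e > 0"
  define r where "r = p x + e / (support w + 1)"
  have "r \<in> scales x"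
    unfolding r_def using x e support_nonneg[of w] by (intro gauge_less) (auto intro!: divide_pos_pos)
  then have r: "r > 0" "(1 / r) *\<^sub>R x \<in> L" by (auto simp: scales_def)
  have "dot d w ((1 / r) *\<^sub>R x) \<le> support w" using r(2) by (rule dot_le_support)
  then have "dot d w x \<le> support w * r" using r(1) by (simp add: dot_scale_right field_simps)
  also have "\<dots> = support w * p x + e * (support w / (support w + 1))" by (simp add: r_def distrib_left)
  also have "\<dots> \<le> support w * p x + e"
    using e support_nonneg[of w] by (intro add_left_mono mult_left_le) auto
  finally show "dot d w x \<le> support w * p x + e" .
qed

lemma support_half_attained: "\<exists>x\<in>L. support w / 2 \<le> dot d w x"
proof (cases "support w = 0")
  case True
  then show ?thesis using zero_mem by (intro bexI[of _ 0]) auto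
next
  case False
  then have "support w / 2 < Sup (dot d w ` L)" using support_nonneg[of w] by (simp add: support_def)
  then obtain z where "z \<in> dot d w ` L" "support w / 2 < z"
    using less_cSupD[of "dot d w ` L"] zero_mem by (metis empty_iff image_is_empty)
  then show ?thesis by force
qed

text \<open>
  A half of the bipolar theorem: test the hypothesis with a functional that supports the
  body in the direction of \<open>z\<close>, whose support function value is at most one.
\<close>

lemma gauge_le_if_pairing_le_support:
  assumes pair: "\<And>v. v \<in> RR d \<Longrightarrow> dot d v z \<le> c * support v" and c: "0 \<le> c" and z: "z \<in> RR d"
  shows "p z \<le> c"
proof -
  obtain a where a: "a \<in> RR d" "\<And>x. x \<in> RR d \<Longrightarrow> dot d a x \<le> p x" "p z \<le> dot d a z"
    using supporting_functional[OF z] by blast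
  have "support a \<le> 1"
  proof (rule support_least)
    fix x assume x: "x \<in> L"
    then show "dot d a x \<le> 1" using a(2)[of x] gauge_le_one[OF x] subset_RR by force
  qed
  then have "c * support a \<le> c" using c by (simp add: mult_left_le)
  with a(3) pair[OF a(1)] show ?thesis by linarith
qed

lemma Rad_op_mvec:
  assumes "\<And>t. t \<in> Omega d \<Longrightarrow> f t \<in> RR d"
  shows "Rad_op d f = mvec d (\<lambda>i j. mean d (\<lambda>t. t j * f t i))"
proof (intro ext)
  fix s i
  have "mean d (\<lambda>t. t j *\<^sub>R f t) i = (if i < d then mean d (\<lambda>t. t j * f t i) else 0)" for j
    using assms by (auto simp: mean_fun_apply RR_iff mean_real)
  then show "Rad_op d f s i = mvec d (\<lambda>i j. mean d (\<lambda>t. t j * f t i)) s i"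
    by (simp add: Rad_op_def sum_fun_apply mvec_def mult.commute)
qed

text \<open>
  For the inverse \<open>B\<close> of a Lewis position, this bounds the basis dual to its columns.  Choose for
  each \<open>t\<close> a point of \<open>L\<close> that norms the sum of the rows with signs \<open>t\<close> up to a factor two, and multiply it by the norm of
  this sum.  The pairing of the result \<open>f\<close> with the sum is the trace in the Lewis condition for the
  coefficients of the Rademacher projection of \<open>f\<close>, whose norm is controlled by \<open>R\<close>.
\<close>

lemma dual_position_bound:
  assumes lewis: "\<And>S. (\<Sum>i<d. mmul d B S i i) \<le> real d * position_norm S"
    and Rad: "\<And>f. (\<And>t. t \<in> Omega d \<Longrightarrow> f t \<in> RR d) \<Longrightarrow> Omega_norm d (Rad_op d f) \<le> R * Omega_norm d f"
    and R: "0 \<le> R"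
  shows "mean d (\<lambda>t. (support (mvec d (\<lambda>i j. B j i) t))\<^sup>2) \<le> (2 * real d * R)\<^sup>2"
proof -
  let ?w = "mvec d (\<lambda>i j. B j i)"
  have "\<forall>t. \<exists>y. y \<in> L \<and> support (?w t) / 2 \<le> dot d (?w t) y"
    using support_half_attained unfolding Bex_def by (rule allI)
  then obtain x where "\<forall>t. x t \<in> L \<and> support (?w t) / 2 \<le> dot d (?w t) (x t)"
    by (rule choice[THEN exE])
  then have x: "\<And>t. x t \<in> L" "\<And>t. support (?w t) / 2 \<le> dot d (?w t) (x t)"
    by blast+
  have xR: "x t \<in> RR d" for t using x(1) subset_RR by blast
  define f where "f = (\<lambda>t. support (?w t) *\<^sub>R x t)"
  have fR: "f t \<in> RR d" for t using xR by (simp add: f_def)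
  define S where "S = (\<lambda>i j. mean d (\<lambda>t. t j * f t i))"
  let ?D = "mean d (\<lambda>t. (support (?w t))\<^sup>2)"
  have D: "0 \<le> ?D" by (rule mean_nonneg) simp
  have "?D / 2 = mean d (\<lambda>t. support (?w t) * (support (?w t) / 2))"
    by (simp add: mean_real power2_eq_square sum_divide_distrib[symmetric])
  also have "\<dots> \<le> mean d (\<lambda>t. support (?w t) * dot d (?w t) (x t))"
    by (intro mean_mono mult_left_mono x support_nonneg)
  also have "\<dots> = mean d (\<lambda>t. \<Sum>i<d. \<Sum>j<d. B j i * (t j * f t i))"
    by (simp add: dot_def f_def mvec_def sum_distrib_left sum_distrib_right mult_ac)
  also have "\<dots> = (\<Sum>i<d. \<Sum>j<d. B j i * S i j)"
    by (simp only: mean_sum mean_cmult S_def)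
  also have "\<dots> = (\<Sum>j<d. mmul d B S j j)"
    unfolding mmul_def by (rule sum.swap)
  also have "\<dots> \<le> real d * position_norm S" by (rule lewis)
  also have "position_norm S = Omega_norm d (Rad_op d f)"
    unfolding position_norm_def S_def by (subst Rad_op_mvec) (auto simp: fR)
  also have "real d * \<dots> \<le> real d * (R * Omega_norm d f)"
    by (intro mult_left_mono Rad) (auto simp: fR)
  also have "Omega_norm d f \<le> sqrt ?D"
    unfolding Omega_norm_def
  proof (intro real_sqrt_le_mono mean_mono power_mono)
    fix t
    have "p (f t) = support (?w t) * p (x t)" unfolding f_def by (intro N_scale xR support_nonneg)
    also have "\<dots> \<le> support (?w t)" using gauge_le_one[OF x(1)] support_nonneg by (intro mult_left_le)
    finally show "p (f t) \<le> support (?w t)" .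
    show "0 \<le> p (f t)" by (rule N_nonneg[OF fR])
  qed
  finally have "?D / 2 \<le> real d * (R * sqrt ?D)"
    using R by (simp add: mult_left_mono)
  then have "sqrt ?D * sqrt ?D \<le> (2 * real d * R) * sqrt ?D"
    using D by simp
  then have "sqrt ?D \<le> 2 * real d * R"
  proof (cases "?D = 0")
    case False
    with D have "sqrt ?D > 0" by simp
    with \<open>sqrt ?D * sqrt ?D \<le> _\<close> show ?thesis by (rule mult_right_le_imp_le)
  qed (use R in simp)
  then have "(sqrt ?D)\<^sup>2 \<le> (2 * real d * R)\<^sup>2" using D by (intro power_mono) auto
  then show ?thesis using D by simp
qed

text \<open>
  Two volume estimates in the Lewis position \<open>A\<close> with inverse \<open>B\<close>: one for \<open>A\<close> and the norm, and one for
  \<open>J\<close> times the transpose of \<open>B\<close>, where the dual bound and the hypothesis on \<open>J\<close> combine.  The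
  determinants of \<open>A\<close> and \<open>B\<close> cancel in the product.
\<close>

lemma det_le_volume_squared:
  assumes Rad: "\<And>f. (\<And>t. t \<in> Omega d \<Longrightarrow> f t \<in> RR d) \<Longrightarrow> Omega_norm d (Rad_op d f) \<le> R * Omega_norm d f"
    and R: "0 < R" and d: "0 < d"
    and J: "mdet d J \<noteq> 0" and rho: "0 < \<rho>"
    and bound: "\<And>w. w \<in> RR d \<Longrightarrow> p (mvec d J w) \<le> \<rho> * support w"
  shows "\<bar>mdet d J\<bar> \<le> (8 * \<rho> * real d * R) ^ d * (Vol d L)\<^sup>2"
proof -
  obtain A B where A: "mdet d A \<noteq> 0" "position_norm A \<le> 1"
    and BA: "\<And>i j. i < d \<Longrightarrow> j < d \<Longrightarrow> mmul d B A i j = mone i j"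
    and lewis: "\<And>S. (\<Sum>i<d. mmul d B S i i) \<le> real d * position_norm S"
    using lewis_position by blast
  have "mdet d B * mdet d A = mdet d mone"
    unfolding mdet_mmul[symmetric] by (rule mdet_cong) (rule BA)
  then have BA1: "mdet d B * mdet d A = 1" by (simp add: mdet_mone)
  let ?Bt = "\<lambda>i j. B j i" and ?V = "measure (leb d) (sublevel 1)"
  define c where "c = \<rho> * (2 * real d * R)"
  have c: "c > 0" using rho R d by (simp add: c_def)
  have "\<bar>mdet d A\<bar> \<le> 2 ^ d * (1 ^ d * ?V)"
  proof (rule det_le_sublevel_if_signs[OF A(1)])
    fix y :: "nat \<Rightarrow> real" assume y: "\<And>i. i < d \<Longrightarrow> y i \<in> {0..1}"
    show "\<exists>t\<in>Omega d. p (mvec d A (\<lambda>i. t i * y i)) \<le> 1"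
    proof (rule exists_sign_le)
      show "mean d (\<lambda>t. (p (mvec d A t))\<^sup>2) \<le> 1\<^sup>2"
        using A(2) by (simp add: position_norm_def Omega_norm_def)
      show "y i \<in> {0..1}" if "i < d" for i using that by (rule y)
      show "p (v + w) \<le> p v + p w" if "v \<in> RR d" "w \<in> RR d" for v w using that by (rule N_add)
      show "p (c *\<^sub>R w) = c * p w" if "w \<in> RR d" "0 \<le> c" for w c using that by (rule N_scale)
    qed (rule zero_le_one)
  qed simp
  moreover have "\<bar>mdet d (mmul d J ?Bt)\<bar> \<le> 2 ^ d * (c ^ d * ?V)"
  proof (rule det_le_sublevel_if_signs)
    show "mdet d (mmul d J ?Bt) \<noteq> 0"
      using J BA1 by (auto simp: mdet_mmul mdet_transpose[of d B])
    fix y :: "nat \<Rightarrow> real" assume y: "\<And>i. i < d \<Longrightarrow> y i \<in> {0..1}"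
    have "\<exists>t\<in>Omega d. support (mvec d ?Bt (\<lambda>i. t i * y i)) \<le> 2 * real d * R"
    proof (rule exists_sign_le)
      show "mean d (\<lambda>t. (support (mvec d ?Bt t))\<^sup>2) \<le> (2 * real d * R)\<^sup>2"
        by (rule dual_position_bound[OF lewis Rad less_imp_le[OF R]])
      show "y i \<in> {0..1}" if "i < d" for i using that by (rule y)
      show "support (v + w) \<le> support v + support w" for v w by (rule support_add)
      show "support (c *\<^sub>R w) = c * support w" if "0 \<le> c" for w c using that by (rule support_scale)
      show "0 \<le> 2 * real d * R" using R by simp
    qed
    then obtain t where t: "t \<in> Omega d" "support (mvec d ?Bt (\<lambda>i. t i * y i)) \<le> 2 * real d * R" by blast
    have "p (mvec d (mmul d J ?Bt) (\<lambda>i. t i * y i)) \<le> \<rho> * support (mvec d ?Bt (\<lambda>i. t i * y i))"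
      unfolding mvec_mvec[symmetric] by (rule bound) simp
    also have "\<dots> \<le> c" unfolding c_def using t(2) rho by (intro mult_left_mono) auto
    finally show "\<exists>t\<in>Omega d. p (mvec d (mmul d J ?Bt) (\<lambda>i. t i * y i)) \<le> c" using t(1) by blast
  qed (rule c)
  ultimately have le: "\<bar>mdet d A\<bar> * \<bar>mdet d (mmul d J ?Bt)\<bar> \<le> (2 ^ d * (1 ^ d * ?V)) * (2 ^ d * (c ^ d * ?V))"
    by (rule mult_mono) (simp_all add: measure_nonneg)
  have "\<bar>mdet d J\<bar> = \<bar>mdet d A\<bar> * (\<bar>mdet d J\<bar> * \<bar>mdet d B\<bar>)"
    using BA1 by (metis abs_mult abs_one mult.commute mult.left_commute mult.right_neutral)
  also have "\<bar>mdet d J\<bar> * \<bar>mdet d B\<bar> = \<bar>mdet d (mmul d J ?Bt)\<bar>"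
    unfolding mdet_mmul mdet_transpose[of d B] by (rule abs_mult[symmetric])
  also note le
  also have "(2 ^ d * (1 ^ d * ?V)) * (2 ^ d * (c ^ d * ?V)) = (2 ^ d * 2 ^ d * c ^ d) * ?V\<^sup>2"
    by (simp add: power2_eq_square)
  also have "2 ^ d * 2 ^ d * c ^ d = (2 * 2 * c) ^ d" by (simp only: power_mult_distrib)
  also have "2 * 2 * c = 8 * \<rho> * real d * R" by (simp add: c_def)
  finally show ?thesis by (simp only: Vol_eq)
qed

end

section \<open>Linear symplectic geometry\<close>

lemma omega_add_left: "omega_st n (u + v) w = omega_st n u w + omega_st n v w"
  and omega_scale_left: "omega_st n (c *\<^sub>R u) w = c * omega_st n u w"
  by (simp_all add: omega_st_def sum.distrib sum_subtractf sum_distrib_left algebra_simps)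

lemma omega_flip: "omega_st n u v = - omega_st n v u"
  by (simp add: omega_st_def sum_negf[symmetric] mult.commute)

lemma omega_self [simp]: "omega_st n u u = 0"
  by (simp add: omega_st_def)

lemma omega_add_right: "omega_st n w (u + v) = omega_st n w u + omega_st n w v"
  and omega_diff_right: "omega_st n w (u - v) = omega_st n w u - omega_st n w v"
  and omega_scale_right: "omega_st n w (c *\<^sub>R u) = c * omega_st n w u"
  by (simp_all add: omega_st_def sum.distrib sum_subtractf sum_distrib_left algebra_simps)

lemma omega_basis_vec_one: "n \<ge> 1 \<Longrightarrow> omega_st n x (basis_vec 1) = x 0"
  and omega_basis_vec_zero: "n \<ge> 1 \<Longrightarrow> omega_st n (basis_vec 0) x = x 1"
proof -
  assume n: "n \<ge> 1"
  have "omega_st n x (basis_vec 1) = (\<Sum>j<n. if j = 0 then x 0 else 0)"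
    unfolding omega_st_def by (intro sum.cong) (auto simp: basis_vec_def)
  then show "omega_st n x (basis_vec 1) = x 0" using n by simp
  have "omega_st n (basis_vec 0) x = (\<Sum>j<n. if j = 0 then x 1 else 0)"
    unfolding omega_st_def by (intro sum.cong) (auto simp: basis_vec_def)
  then show "omega_st n (basis_vec 0) x = x 1" using n by simp
qed

lemma Sp_comp: "\<phi> \<in> Sp n \<Longrightarrow> \<psi> \<in> Sp n \<Longrightarrow> \<phi> \<circ> \<psi> \<in> Sp n"
  unfolding Sp_def by (auto simp: Pi_iff)

lemma transvection_Sp:
  assumes v: "v \<in> RR (2 * n)"
  shows "(\<lambda>x. x + (c * omega_st n x v) *\<^sub>R v) \<in> Sp n"
proof -
  let ?T = "\<lambda>x. x + (c * omega_st n x v) *\<^sub>R v"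
  have "?T (x + y) = ?T x + ?T y" for x y
    by (simp add: omega_add_left distrib_left scaleR_add_left)
  moreover have "?T (a *\<^sub>R x) = a *\<^sub>R ?T x" for a x
    by (simp add: omega_scale_left scaleR_add_right mult.left_commute)
  moreover have "omega_st n (?T x) (?T y) = omega_st n x y" for x y
    by (simp only: omega_add_left omega_add_right omega_scale_left omega_scale_right omega_self
        omega_flip[of n v y]) (simp add: algebra_simps)
  moreover have "?T \<in> RR (2 * n) \<rightarrow> RR (2 * n)" using v by auto
  ultimately show ?thesis unfolding Sp_def by blast
qed

text \<open>
  The symplectic transvection along \<open>w - u\<close>.  The points that it fixes matter when a second vector is
  moved while the first one stays.
\<close>

lemma Sp_move:
  assumes u: "u \<in> RR (2 * n)" and w: "w \<in> RR (2 * n)" and ne: "omega_st n u w \<noteq> 0"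
  shows "\<exists>\<psi>\<in>Sp n. \<psi> u = w \<and> (\<forall>z. omega_st n z u = omega_st n z w \<longrightarrow> \<psi> z = z)"
proof (intro bexI conjI allI impI)
  let ?T = "\<lambda>x. x + (1 / omega_st n u w * omega_st n x (w - u)) *\<^sub>R (w - u)"
  show "?T \<in> Sp n" by (rule transvection_Sp) (rule RR_diff[OF w u])
  show "?T u = w" using ne by (simp add: omega_diff_right)
  show "?T z = z" if "omega_st n z u = omega_st n z w" for z
    using that by (simp add: omega_diff_right)
qed

text \<open>
  One transvection suffices unless \<open>p\<close> and the target are \<open>\<omega>\<close>-orthogonal; going through a vector \<open>z\<close> that
  is orthogonal to neither works always, and one of \<open>q\<close>, \<open>f\<close>, \<open>q + f\<close> is such a vector,
  where \<open>f\<close> is the symplectic partner of the target.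
\<close>

lemma Sp_move_to_first:
  assumes n: "n \<ge> 1" and p: "p \<in> RR (2 * n)" and q: "q \<in> RR (2 * n)" and pq: "omega_st n p q = 1"
  shows "\<exists>\<psi>\<in>Sp n. \<psi> p = basis_vec 0"
proof -
  define e f where ef_def: "e = basis_vec 0" "f = basis_vec 1"
  have e: "e \<in> RR (2 * n)" "f \<in> RR (2 * n)" using n unfolding ef_def by (auto intro!: RR_basis_vec)
  have ef: "omega_st n f e = -1"
    using omega_flip[of n f e] omega_basis_vec_one[OF n, of e] by (simp add: ef_def basis_vec_def)
  have two: "\<exists>\<psi>\<in>Sp n. \<psi> p = e"
    if z: "z \<in> RR (2 * n)" "omega_st n p z \<noteq> 0" "omega_st n z e \<noteq> 0" for z
  proof -
    obtain \<phi> \<psi> where "\<phi> \<in> Sp n" "\<phi> p = z" "\<psi> \<in> Sp n" "\<psi> z = e"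
      using Sp_move[OF p z(1,2)] Sp_move[OF z(1) e(1) z(3)] by blast
    then show ?thesis by (intro bexI[of _ "\<psi> \<circ> \<phi>"] Sp_comp) auto
  qed
  have "\<exists>\<psi>\<in>Sp n. \<psi> p = e"
  proof (cases "omega_st n q e = 0")
    case False
    show ?thesis by (rule two[OF q _ False]) (simp add: pq)
  next
    case q0: True
    show ?thesis
    proof (cases "omega_st n p f = 0")
      case False
      show ?thesis by (rule two[OF e(2) False]) (simp add: ef)
    next
      case True
      have "omega_st n p (q + f) \<noteq> 0" unfolding omega_add_right pq True by simp
      moreover have "omega_st n (q + f) e \<noteq> 0" unfolding omega_add_left q0 ef by simp
      ultimately show ?thesis by (rule two[OF RR_add[OF q e(2)]])
    qed
  qed
  then show ?thesis by (simp add: ef_def)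
qed

text \<open>
  Once \<open>p\<close> is moved to \<open>e\<close>, transvections along vectors that are \<open>\<omega>\<close>-orthogonal to \<open>e\<close> bring the second
  vector into place and fix \<open>e\<close>.
\<close>

lemma Sp_pair_transitive:
  assumes n: "n \<ge> 1" and p: "p \<in> RR (2 * n)" and q: "q \<in> RR (2 * n)" and pq: "omega_st n p q = 1"
  shows "\<exists>\<psi>\<in>Sp n. \<psi> p = basis_vec 0 \<and> \<psi> q = basis_vec 1"
proof -
  define e f where ef_def: "e = basis_vec 0" "f = basis_vec 1"
  have e: "e \<in> RR (2 * n)" "f \<in> RR (2 * n)" using n unfolding ef_def by (auto intro!: RR_basis_vec)
  have ef: "omega_st n e f = 1"
    using omega_basis_vec_one[OF n, of e] by (simp add: ef_def basis_vec_def)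
  obtain \<phi> where \<phi>: "\<phi> \<in> Sp n" "\<phi> p = e" using Sp_move_to_first[OF assms] unfolding ef_def by blast
  define r where "r = \<phi> q"
  have r: "r \<in> RR (2 * n)" using \<phi>(1) q by (auto simp: Sp_def r_def)
  have er: "omega_st n e r = 1" using \<phi> p q pq by (auto simp: Sp_def r_def)
  have "\<exists>\<tau>\<in>Sp n. \<tau> r = f \<and> \<tau> e = e"
  proof (cases "omega_st n r f = 0")
    case False
    from Sp_move[OF r e(2) False] er ef show ?thesis by auto
  next
    case True
    \<comment> \<open>a detour that keeps the pairing with \<open>e\<close> equal to one, so that both transvections fix \<open>e\<close>\<close>
    let ?z = "r + e"
    have z: "?z \<in> RR (2 * n)" using r e by auto
    have "omega_st n r ?z = -1" using omega_flip[of n r e] er by (simp add: omega_add_right)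
    then obtain \<tau>1 where 1: "\<tau>1 \<in> Sp n" "\<tau>1 r = ?z" "\<forall>y. omega_st n y r = omega_st n y ?z \<longrightarrow> \<tau>1 y = y"
      using Sp_move[OF r z] by force
    have "omega_st n ?z f = 1" using True ef by (simp add: omega_add_left)
    then obtain \<tau>2 where 2: "\<tau>2 \<in> Sp n" "\<tau>2 ?z = f" "\<forall>y. omega_st n y ?z = omega_st n y f \<longrightarrow> \<tau>2 y = y"
      using Sp_move[OF z e(2)] by force
    have "\<tau>1 e = e" using 1(3) by (simp add: omega_add_right)
    moreover have "\<tau>2 e = e" using 2(3) er ef by (simp add: omega_add_right)
    ultimately show ?thesis using 1 2 by (intro bexI[of _ "\<tau>2 \<circ> \<tau>1"] Sp_comp) auto
  qed
  then obtain \<tau> where "\<tau> \<in> Sp n" "\<tau> r = f" "\<tau> e = e" by blast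
  then show ?thesis using \<phi> by (intro bexI[of _ "\<tau> \<circ> \<phi>"] Sp_comp) (auto simp: r_def ef_def)
qed

text \<open>
  A symplectic map with \<open>p \<mapsto> e\<^sub>1\<close>, \<open>q \<mapsto> f\<^sub>1\<close> has first two coordinates \<open>\<omega>(\<sqdot>, q)\<close> and
  \<open>\<omega>(p, \<sqdot>)\<close>.
\<close>

lemma cZ_lin_le:
  assumes n: "n \<ge> 1" and K: "K \<subseteq> RR (2 * n)"
    and p: "p \<in> RR (2 * n)" and q: "q \<in> RR (2 * n)" and pq: "omega_st n p q = 1"
    and bound: "\<And>x. x \<in> K \<Longrightarrow> (omega_st n x p)\<^sup>2 \<le> s" "\<And>x. x \<in> K \<Longrightarrow> (omega_st n x q)\<^sup>2 \<le> s"
    and r: "2 * s < r\<^sup>2" "r > 0"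
  shows "cZ_lin n K \<le> ereal (pi * r\<^sup>2)"
proof -
  obtain \<psi> where \<psi>: "\<psi> \<in> Sp n" "\<psi> p = basis_vec 0" "\<psi> q = basis_vec 1"
    using Sp_pair_transitive[OF n p q pq] by blast
  have "\<psi> ` K \<subseteq> Zcyl n r"
  proof
    fix y assume "y \<in> \<psi> ` K"
    then obtain x where x: "x \<in> K" "y = \<psi> x" by blast
    then have xR: "x \<in> RR (2 * n)" using K by blast
    have yR: "y \<in> RR (2 * n)" using \<psi>(1) xR by (auto simp: Sp_def x(2))
    have inv: "omega_st n (\<psi> u) (\<psi> v) = omega_st n u v" if "u \<in> RR (2 * n)" "v \<in> RR (2 * n)" for u v
      using \<psi>(1) that by (auto simp: Sp_def)
    have "y 0 = omega_st n x q"
      using inv[OF xR q] omega_basis_vec_one[OF n, of y] by (simp add: \<psi>(3) x(2))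
    moreover have "y 1 = - omega_st n x p"
      using inv[OF p xR] omega_basis_vec_zero[OF n, of y] omega_flip[of n p x] by (simp add: \<psi>(2) x(2))
    moreover have "{..<2} = {0, 1 :: nat}" by auto
    ultimately have "(\<Sum>i<2. (y i)\<^sup>2) = (omega_st n x q)\<^sup>2 + (omega_st n x p)\<^sup>2" by simp
    also have "\<dots> < r\<^sup>2" using bound[OF x(1)] r(1) by linarith
    finally have "enorm 2 y < r"
      unfolding enorm_def L2_set_def using r(2) by (intro real_less_lsqrt) auto
    then show "y \<in> Zcyl n r" using yR by (simp add: Zcyl_def)
  qed
  then show ?thesis
    unfolding cZ_lin_def using \<psi>(1) r(2) by (intro Inf_lower) blast
qed

text \<open>
  The complex structure, normalized by \<open>\<omega>(x, J w) = \<langle>w, x\<rangle>\<close>.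
\<close>

definition Jmat :: "nat \<Rightarrow> nat \<Rightarrow> real" where
  "Jmat i k = (if even i then if k = i + 1 then -1 else 0 else if k + 1 = i then 1 else 0)"

lemma mvec_Jmat:
  assumes "i < 2 * n"
  shows "mvec (2 * n) Jmat w i = (if even i then - w (i + 1) else w (i - 1))"
proof (cases "even i")
  case True
  then have lt: "i + 1 < 2 * n" using assms by presburger
  have "(\<Sum>k<2 * n. Jmat i k * w k) = (\<Sum>k<2 * n. if k = i + 1 then - w (i + 1) else 0)"
    using True by (intro sum.cong) (auto simp: Jmat_def)
  then show ?thesis using assms lt True by (simp add: mvec_def)
next
  case False
  then have i: "i > 0" by (cases i) auto
  have "(\<Sum>k<2 * n. Jmat i k * w k) = (\<Sum>k<2 * n. if k = i - 1 then w (i - 1) else 0)"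
    using False i by (intro sum.cong) (auto simp: Jmat_def)
  then show ?thesis using assms False by (simp add: mvec_def)
qed

lemma abs_mdet_Jmat: "\<bar>mdet (2 * n) Jmat\<bar> = 1"
proof -
  have "mmul (2 * n) Jmat Jmat i j = mone i j * (-1)" if "i < 2 * n" "j < 2 * n" for i j
  proof -
    have "mmul (2 * n) Jmat Jmat i j = mvec (2 * n) Jmat (\<lambda>k. Jmat k j) i"
      using that by (simp add: mmul_def mvec_def)
    also have "\<dots> = mone i j * (-1)"
      unfolding mvec_Jmat[OF that(1)] by (cases i) (auto simp: Jmat_def mone_def)
    finally show ?thesis .
  qed
  then have "mdet (2 * n) (mmul (2 * n) Jmat Jmat) = mdet (2 * n) (\<lambda>i j. mone i j * (-1))"
    by (rule mdet_cong)
  then have "mdet (2 * n) Jmat * mdet (2 * n) Jmat = 1"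
    using mdet_scale_columns[of "2 * n" mone "\<lambda>_. -1"] by (simp add: mdet_mmul mdet_mone)
  then show ?thesis
    by (metis abs_mult_self_eq abs_mult abs_one mult_cancel_left1 power2_eq_square abs_square_eq_1 power2_eq_1_iff abs_eq_iff')
qed

lemma omega_Jmat: "omega_st n x (mvec (2 * n) Jmat w) = dot (2 * n) w x"
proof -
  have split: "(\<Sum>i<2 * m. f i) = (\<Sum>j<m. f (2 * j) + f (2 * j + 1))" for m and f :: "nat \<Rightarrow> real"
    by (induction m) (auto simp: algebra_simps)
  have "omega_st n x (mvec (2 * n) Jmat w) = (\<Sum>j<n. w (2 * j) * x (2 * j) + w (2 * j + 1) * x (2 * j + 1))"
    unfolding omega_st_def
  proof (intro sum.cong refl)
    fix j assume "j \<in> {..<n}"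
    then have "mvec (2 * n) Jmat w (2 * j) = - w (2 * j + 1)" "mvec (2 * n) Jmat w (2 * j + 1) = w (2 * j)"
      by (subst mvec_Jmat; simp)+
    then show "x (2 * j) * mvec (2 * n) Jmat w (2 * j + 1) - x (2 * j + 1) * mvec (2 * n) Jmat w (2 * j)
        = w (2 * j) * x (2 * j) + w (2 * j + 1) * x (2 * j + 1)"
      by (simp only: mult_minus_right diff_minus_eq_add mult.commute)
  qed
  then show ?thesis by (simp only: dot_def split)
qed

section \<open>The capacity bound\<close>

context centered_body begin

text \<open>
  By duality some \<open>v\<close> pairs with \<open>J w\<close> to more than \<open>\<rho>\<close> times the product of the support function values.
  On \<open>L\<close> the functionals \<open>\<omega>(\<sqdot>, J w)\<close> and \<open>\<omega>(\<sqdot>, J v)\<close> are bounded by these values, and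
  suitable multiples of \<open>J w\<close> and \<open>J v\<close> form a symplectic pair.
\<close>

lemma cZ_lin_le_if_gauge_gt_support:
  assumes d: "d = 2 * n" and n: "n \<ge> 1" and sym: "\<And>x. x \<in> L \<Longrightarrow> - x \<in> L"
    and w: "w \<in> RR d" and rho: "0 < \<rho>" and gt: "p (mvec d Jmat w) > \<rho> * support w"
    and K: "K \<subseteq> L"
  shows "cZ_lin n K \<le> ereal (pi * (2 / \<rho>))"
proof -
  let ?J = "mvec d Jmat"
  obtain v where v: "v \<in> RR d" "dot d v (?J w) > \<rho> * support w * support v"
  proof (rule ccontr)
    assume "\<not> thesis"
    with that have "\<And>v. v \<in> RR d \<Longrightarrow> dot d v (?J w) \<le> \<rho> * support w * support v" by force
    then have "p (?J w) \<le> \<rho> * support w"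
      using rho support_nonneg by (intro gauge_le_if_pairing_le_support) auto
    with gt show False by simp
  qed
  define m where "m = dot d v (?J w)"
  have m: "m > \<rho> * support w * support v" using v(2) by (simp add: m_def)
  moreover have "0 \<le> \<rho> * support w * support v" using rho support_nonneg by simp
  ultimately have m0: "m > 0" by linarith
  have om: "omega_st n (?J w) (?J v) = m" unfolding d omega_Jmat by (simp add: m_def d)
  then have "dot d w (- ?J v) = m"
    using omega_flip[of n "?J v" "?J w"] unfolding d omega_Jmat by (simp add: dot_uminus_right)
  then have "m \<le> support w * p (- ?J v)" using dot_le_support_gauge[of "- ?J v" w] by simp
  with m0 support_nonneg[of w] have sw: "support w > 0" by (cases "support w = 0") auto
  have "m \<le> support v * p (?J w)" using dot_le_support_gauge[of "?J w" v] by (simp add: m_def)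
  with m0 support_nonneg[of v] have sv: "support v > 0" by (cases "support v = 0") auto
  \<comment> \<open>the multiples of \<open>w\<close> and \<open>v\<close> that have equal support function values and satisfy \<open>\<omega> = 1\<close>\<close>
  define a b where "a = sqrt (support v / (support w * m))" and "b = sqrt (support w / (support v * m))"
  define s where "s = support v * support w / m"
  have ab: "a * b = 1 / m"
  proof -
    have "a * b = sqrt (support v / (support w * m) * (support w / (support v * m)))"
      by (simp only: a_def b_def real_sqrt_mult)
    also have "support v / (support w * m) * (support w / (support v * m)) = (1 / m)\<^sup>2"
      using sw sv by (simp add: power2_eq_square)
    finally show ?thesis using m0 by simp
  qed
  have abs_dot: "(dot d u x)\<^sup>2 \<le> (support u)\<^sup>2" if "x \<in> K" for u x
  proof -
    have "x \<in> L" using that K by blast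
    then have "dot d u x \<le> support u" "- dot d u x \<le> support u"
      using dot_le_support[of x u] dot_le_support[of "- x" u] sym by (simp_all add: dot_uminus_right)
    then have "\<bar>dot d u x\<bar> \<le> support u" by linarith
    then have "\<bar>dot d u x\<bar>\<^sup>2 \<le> (support u)\<^sup>2" by (intro power_mono) auto
    then show ?thesis by simp
  qed
  have "cZ_lin n K \<le> ereal (pi * (sqrt (2 / \<rho>))\<^sup>2)"
  proof (rule cZ_lin_le[OF n])
    show "K \<subseteq> RR (2 * n)" using K subset_RR d by auto
    show "a *\<^sub>R ?J w \<in> RR (2 * n)" "b *\<^sub>R ?J v \<in> RR (2 * n)" by (auto simp: d)
    show "omega_st n (a *\<^sub>R ?J w) (b *\<^sub>R ?J v) = 1"
    proof -
      have "a * b * m = 1" using ab m0 by simp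
      then show ?thesis unfolding omega_scale_left omega_scale_right om by (simp add: mult_ac)
    qed
    fix x assume x: "x \<in> K"
    have "(omega_st n x (a *\<^sub>R ?J w))\<^sup>2 = a\<^sup>2 * (dot d w x)\<^sup>2"
      unfolding omega_scale_right d omega_Jmat by (simp add: power_mult_distrib)
    also have "\<dots> \<le> a\<^sup>2 * (support w)\<^sup>2" by (intro mult_left_mono abs_dot x) simp
    also have "\<dots> = s" using sw sv m0 by (simp add: a_def s_def power2_eq_square)
    finally show "(omega_st n x (a *\<^sub>R ?J w))\<^sup>2 \<le> s" .
    have "(omega_st n x (b *\<^sub>R ?J v))\<^sup>2 = b\<^sup>2 * (dot d v x)\<^sup>2"
      unfolding omega_scale_right d omega_Jmat by (simp add: power_mult_distrib)
    also have "\<dots> \<le> b\<^sup>2 * (support v)\<^sup>2" by (intro mult_left_mono abs_dot x) simp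
    also have "\<dots> = s" using sw sv m0 by (simp add: b_def s_def power2_eq_square)
    finally show "(omega_st n x (b *\<^sub>R ?J v))\<^sup>2 \<le> s" .
  next
    have "\<rho> * s < 1" using m m0 by (simp add: s_def divide_less_eq mult_ac)
    then have "2 * s < 2 / \<rho>" using rho by (simp add: field_simps)
    then show "2 * s < (sqrt (2 / \<rho>))\<^sup>2" using rho by simp
    show "0 < sqrt (2 / \<rho>)" using rho by simp
  qed
  then show ?thesis using rho by simp
qed

lemma gauge_uminus:
  assumes "\<And>x. x \<in> L \<Longrightarrow> - x \<in> L"
  shows "p (- x) = p x"
proof -
  have "scales (- x) = scales x"
    using assms[of "(1 / r) *\<^sub>R x" for r] assms[of "- ((1 / r) *\<^sub>R x)" for r]
    unfolding scales_def by (intro Collect_cong conj_cong refl) (metis minus_minus scaleR_minus_right)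
  then show ?thesis by (simp add: gauge_norm_eq)
qed

end

lemma powr_inverse_power: "0 \<le> x \<Longrightarrow> n \<ge> 1 \<Longrightarrow> (x ^ (2 * n)) powr (1 / real n) = x\<^sup>2"
proof -
  assume x: "0 \<le> x" and n: "n \<ge> 1"
  have "(x ^ (2 * n)) powr (1 / real n) = ((x\<^sup>2) ^ n) powr (1 / real n)" by (simp add: power_mult)
  also have "\<dots> = x\<^sup>2"
  proof (cases "x = 0")
    case False
    then have "x\<^sup>2 > 0" by simp
    then have "((x\<^sup>2) ^ n) powr (1 / real n) = (x\<^sup>2) powr (real n * (1 / real n))"
      by (simp only: powr_powr[symmetric] powr_realpow)
    then show ?thesis using n \<open>x\<^sup>2 > 0\<close> by simp
  qed (use n in simp)
  finally show ?thesis .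
qed

lemma sym_body_facts:
  assumes "centered_body d K"
  shows "centered_body d (sym_body K)" and "x \<in> sym_body K \<Longrightarrow> - x \<in> sym_body K"
    and "K \<subseteq> sym_body K" and "Vol d (sym_body K) \<le> 6 ^ d * Vol d K"
proof -
  interpret K: centered_body d K by fact
  show "centered_body d (sym_body K)"
    using assms K.centered_body_diff by (simp add: sym_body_def)
  show "x \<in> sym_body K \<Longrightarrow> - x \<in> sym_body K"
  proof (cases "uminus ` K = K")
    case True
    then show "x \<in> sym_body K \<Longrightarrow> - x \<in> sym_body K" unfolding sym_body_def by (auto dest: imageI[of x K uminus])
  next
    case False
    assume "x \<in> sym_body K"
    with False obtain y z where "x = y - z" "y \<in> K" "z \<in> K" by (auto simp: sym_body_def)
    then have "- x = z - y" "z \<in> K" "y \<in> K" by auto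
    with False show "- x \<in> sym_body K" unfolding sym_body_def by auto
  qed
  show "K \<subseteq> sym_body K"
  proof
    fix x assume "x \<in> K"
    then have "x = x - 0" "0 \<in> K" using K.zero_mem by auto
    with \<open>x \<in> K\<close> show "x \<in> sym_body K" unfolding sym_body_def by auto
  qed
  have "1 * Vol d K \<le> 6 ^ d * Vol d K"
    using K.Vol_pos by (intro mult_right_mono) auto
  then show "Vol d (sym_body K) \<le> 6 ^ d * Vol d K"
    using K.Vol_difference_le by (simp add: sym_body_def)
qed

text \<open>
  For \<open>m = 1\<close> the projection fixes the function \<open>t \<mapsto> t 0 *\<^sub>R x\<close>.
\<close>

lemma Rad_const_ge_one:
  assumes K: "centered_body d K" and d: "d > 0"
  shows "1 \<le> Rad_const d K"
proof -
  interpret L: centered_body d "sym_body K" by (rule sym_body_facts(1)[OF K])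
  let ?u = "basis_vec 0"
  have uR: "?u \<in> RR d" using d by (rule RR_basis_vec)
  obtain C where "\<And>x i. x \<in> RR d \<Longrightarrow> i < d \<Longrightarrow> \<bar>x i\<bar> \<le> C * L.p x"
    using L.N_coercive by blast
  from this[OF uR d] have "L.p ?u \<noteq> 0" by (auto simp: basis_vec_def)
  with L.N_nonneg[OF uR] have pos: "L.p ?u > 0" by simp
  define x where "x = (1 / L.p ?u) *\<^sub>R ?u"
  have xR: "x \<in> RR d" using uR by (simp add: x_def)
  have px: "L.p x = 1" unfolding x_def using pos uR by (subst L.N_scale) auto
  have pm: "L.p (- x) = 1" using L.gauge_uminus[OF sym_body_facts(2)[OF K]] px by simp
  have pt: "L.p (t 0 *\<^sub>R x) = 1" if "t \<in> Omega 1" for t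
    using Omega_sign[OF that, of 0] px pm by auto
  define f where "f = (\<lambda>t :: nat \<Rightarrow> real. t 0 *\<^sub>R x)"
  have card: "real (card (Omega 1)) = 2" by (simp add: card_Omega)
  have norm: "L2_X_norm K 1 f = 1"
    using pt card by (simp add: L2_X_norm_def X_norm_def f_def mean_real)
  have "mean 1 (\<lambda>t. t 0 *\<^sub>R f t) = mean 1 (\<lambda>t. x)"
    unfolding mean_def f_def using Omega_square[of _ 1 0] by simp
  also have "\<dots> = x"
    unfolding mean_def by (simp only: sum_constant_scaleR card) simp
  finally have "Rad_op 1 f = f" by (simp add: Rad_op_def f_def fun_eq_iff)
  then have "ereal 1 \<le> Rad_op_norm d K 1"
    unfolding Rad_op_norm_def using norm xR
    by (intro SUP_upper2[of f]) (auto simp: f_def)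
  also have "\<dots> \<le> Rad_const d K"
    unfolding Rad_const_def by (rule SUP_upper) simp
  finally show ?thesis by (simp add: one_ereal_def)
qed

text \<open>
  The definition speaks of functions of norm at most one.  Dividing by any \<open>b\<close> larger than the norm of
  \<open>f\<close>, and not by the norm itself, covers functions of norm zero as well.
\<close>

lemma Rad_const_bounds_Rad_op:
  assumes K: "centered_body d K" and d: "d > 0" and R: "Rad_const d K = ereal R"
    and f: "\<And>t. t \<in> Omega d \<Longrightarrow> f t \<in> RR d"
  shows "L2_X_norm K d (Rad_op d f) \<le> R * L2_X_norm K d f"
proof -
  interpret L: centered_body d "sym_body K" by (rule sym_body_facts(1)[OF K])
  have L2: "L2_X_norm K m g = L.Omega_norm m g" for m g
    by (simp add: L2_X_norm_def X_norm_def L.Omega_norm_def)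
  have R1: "1 \<le> R" using Rad_const_ge_one[OF K d] R by (simp add: one_ereal_def)
  have "L.Omega_norm d (Rad_op d f) \<le> R * b" if b: "b > L.Omega_norm d f" for b
  proof -
    have b0: "b > 0" using b L.Omega_norm_nonneg[of d f] by linarith
    define g where "g = (\<lambda>t. (1 / b) *\<^sub>R f t)"
    have gR: "g t \<in> RR d" if "t \<in> Omega d" for t using f[OF that] by (simp add: g_def)
    have "L.Omega_norm d g = 1 / b * L.Omega_norm d f" unfolding g_def using b0 f by (intro L.Omega_norm_scale) auto
    then have "L.Omega_norm d g \<le> 1" using b b0 by (simp add: divide_le_eq)
    then have "ereal (L.Omega_norm d (Rad_op d g)) \<le> Rad_op_norm d K d"
      unfolding Rad_op_norm_def L2 using gR by (intro SUP_upper) auto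
    also have "\<dots> \<le> Rad_const d K"
      unfolding Rad_const_def using d by (intro SUP_upper) simp
    finally have le: "L.Omega_norm d (Rad_op d g) \<le> R" by (simp add: R)
    have "(\<lambda>i j. mean d (\<lambda>t. t j * g t i)) = (\<lambda>i j. (1 / b) * mean d (\<lambda>t. t j * f t i))"
    proof (intro ext)
      fix i j
      have "mean d (\<lambda>t. t j * g t i) = mean d (\<lambda>t. (1 / b) * (t j * f t i))" by (simp add: g_def)
      then show "mean d (\<lambda>t. t j * g t i) = (1 / b) * mean d (\<lambda>t. t j * f t i)"
        by (simp only: mean_cmult)
    qed
    then have "Rad_op d g = mvec d (\<lambda>i j. (1 / b) * mean d (\<lambda>t. t j * f t i))"
      using L.Rad_op_mvec[of g] gR by simp
    then have "L.Omega_norm d (Rad_op d g) = L.position_norm (\<lambda>i j. (1 / b) * mean d (\<lambda>t. t j * f t i))"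
      by (simp only: L.position_norm_def)
    also have "\<dots> = (1 / b) * L.position_norm (\<lambda>i j. mean d (\<lambda>t. t j * f t i))"
      using b0 by (intro L.position_norm_scale) simp
    also have "L.position_norm (\<lambda>i j. mean d (\<lambda>t. t j * f t i)) = L.Omega_norm d (Rad_op d f)"
      unfolding L.position_norm_def using L.Rad_op_mvec[of f] f by simp
    finally have "L.Omega_norm d (Rad_op d f) / b \<le> R" using le by simp
    then show ?thesis using b0 by (simp add: pos_divide_le_eq)
  qed
  then have "L.Omega_norm d (Rad_op d f) / R \<le> b" if "b > L.Omega_norm d f" for b
  proof -
    have "L.Omega_norm d (Rad_op d f) \<le> R * b" using that by fact
    then show ?thesis using R1 by (subst pos_divide_le_eq) (simp_all add: mult.commute)
  qed
  then have "L.Omega_norm d (Rad_op d f) / R \<le> L.Omega_norm d f" by (rule dense_ge)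
  then show ?thesis using R1 by (simp add: L2 divide_le_eq mult.commute)
qed

text \<open>
  The value of \<open>\<rho>\<close> makes \<open>8 * \<rho> * d * R\<close> times the \<open>n\<close>-th root of the volume of \<open>L\<close> equal to \<open>1 / 2\<close>,
  which contradicts the volume estimate; the constant is \<open>4608 = 32 * 36 * 4\<close>.
\<close>

theorem cZ_lin_le_Rad_volume:
  assumes n: "n \<ge> 1" and K: "centered_body (2 * n) K" and R: "Rad_const (2 * n) K = ereal R"
  shows "cZ_lin n K \<le> ereal (pi * (4608 * (exp 1)\<^sup>2 * R *
    (Vol (2 * n) K / Vol (2 * n) (Eball (2 * n) 1)) powr (1 / real n)))"
proof -
  define d where "d = 2 * n"
  have d: "d > 0" using n by (simp add: d_def)
  let ?L = "sym_body K"
  interpret K: centered_body d K using K by (simp add: d_def)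
  interpret L: centered_body d ?L by (rule sym_body_facts(1)) (rule K.centered_body_axioms)
  note L = sym_body_facts[OF K.centered_body_axioms]
  have R1: "1 \<le> R"
    using Rad_const_ge_one[OF K.centered_body_axioms d] R by (simp add: d_def one_ereal_def)
  define V where "V = Vol d ?L powr (1 / real n)"
  have V: "V > 0" using L.Vol_pos by (simp add: V_def)
  have Vd: "V ^ d = (Vol d ?L)\<^sup>2"
  proof -
    have "V ^ d = V powr real d" using V by (simp add: powr_realpow)
    also have "\<dots> = Vol d ?L powr 2" using n by (simp add: V_def powr_powr d_def)
    finally show ?thesis using L.Vol_pos by (simp add: powr_realpow)
  qed
  define \<rho> where "\<rho> = 1 / (16 * real d * R * V)"
  have rho: "\<rho> > 0" using d R1 V by (simp add: \<rho>_def)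
  have "\<exists>w\<in>RR d. \<not> L.p (mvec d Jmat w) \<le> \<rho> * L.support w"
  proof (rule ccontr)
    assume "\<not> ?thesis"
    then have "\<bar>mdet d Jmat\<bar> \<le> (8 * \<rho> * real d * R) ^ d * (Vol d ?L)\<^sup>2"
      using abs_mdet_Jmat[of n] rho R1 d Rad_const_bounds_Rad_op[OF K.centered_body_axioms d]
      by (intro L.det_le_volume_squared)
        (auto simp: d_def R L.Omega_norm_def L2_X_norm_def X_norm_def)
    also have "\<dots> = (8 * \<rho> * real d * R * V) ^ d" by (simp add: Vd[symmetric] power_mult_distrib)
    also have "8 * \<rho> * real d * R * V = 1 / 2" using d R1 V by (simp add: \<rho>_def)
    also have "(1 / 2) ^ d < (1 :: real)" using d by (simp add: power_less_one_iff)
    finally show False using abs_mdet_Jmat[of n] by (simp add: d_def)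
  qed
  then obtain w where "w \<in> RR d" "L.p (mvec d Jmat w) > \<rho> * L.support w" by (auto simp: not_le)
  then have "cZ_lin n K \<le> ereal (pi * (2 / \<rho>))"
    using rho n L(2,3) by (intro L.cZ_lin_le_if_gauge_gt_support[OF d_def]) auto
  also have "2 / \<rho> = 32 * real d * R * V" by (simp add: \<rho>_def)
  also have "ereal (pi * (32 * real d * R * V)) \<le> ereal (pi * (4608 * (exp 1)\<^sup>2 * R * (Vol d K / Vol d (Eball d 1)) powr (1 / real n)))"
  proof -
    let ?B = "Vol d (Eball d 1) powr (1 / real n)" and ?v = "Vol d K powr (1 / real n)"
    have "V \<le> (6 ^ d * Vol d K) powr (1 / real n)"
      unfolding V_def using L(4) L.Vol_pos by (intro powr_mono2) auto
    also have "\<dots> = (6 ^ d) powr (1 / real n) * ?v" using K.Vol_pos by (simp add: powr_mult)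
    also have "(6 ^ d) powr (1 / real n) = (36 :: real)"
      unfolding d_def using powr_inverse_power[of 6 n] n by simp
    finally have V_le: "V \<le> 36 * ?v" .
    have "?B \<le> ((exp 1 * 2 / sqrt (real d)) ^ d) powr (1 / real n)"
      using Vol_Eball_pos[of d] Vol_Eball_le[OF d] by (intro powr_mono2) auto
    also have "\<dots> = (exp 1 * 2 / sqrt (real d))\<^sup>2"
      unfolding d_def using n by (intro powr_inverse_power) auto
    also have "\<dots> = 4 * (exp 1)\<^sup>2 / real d" by (simp add: power_divide power_mult_distrib)
    finally have B_le: "real d * ?B \<le> 4 * (exp 1)\<^sup>2" using d by (simp add: field_simps)
    have B: "?B > 0" using Vol_Eball_pos[of d] by simp
    have "real d * V \<le> real d * (36 * ?v)" using V_le by (intro mult_left_mono) auto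
    also have "\<dots> = (real d * ?B) * (36 * (?v / ?B))" using B by simp
    also have "\<dots> \<le> (4 * (exp 1)\<^sup>2) * (36 * (?v / ?B))" using B_le by (intro mult_right_mono) auto
    also have "?v / ?B = (Vol d K / Vol d (Eball d 1)) powr (1 / real n)"
      using K.Vol_pos Vol_Eball_pos[of d] by (simp add: powr_divide)
    finally have "(32 * R) * (real d * V) \<le> (32 * R) * ((4 * (exp 1)\<^sup>2) * (36 * (Vol d K / Vol d (Eball d 1)) powr (1 / real n)))"
      using R1 by (intro mult_left_mono) auto
    then have "32 * real d * R * V \<le> 4608 * (exp 1)\<^sup>2 * R * (Vol d K / Vol d (Eball d 1)) powr (1 / real n)"
      by (simp add: mult_ac)
    then show ?thesis by (simp add: mult_left_mono)
  qed
  finally show ?thesis unfolding d_def .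
qed

theorem theorem1p7:
  shows "\<exists>A\<^sub>2::real. A\<^sub>2 > 0 \<and>
    (\<forall>(n::nat) (K::(nat \<Rightarrow> real) set).
       n \<ge> 1 \<longrightarrow> convex_body (2 * n) K \<longrightarrow> 0 \<in> Euclidean_space (2 * n) interior_of K \<longrightarrow>
       cZ_lin n K / cap_unit_ball n
         \<le> ereal A\<^sub>2 * (Rad_const (2 * n) K)\<^sup>2 *
            ereal ((Vol (2 * n) K / Vol (2 * n) (Eball (2 * n) 1)) powr (1 / real n)))"
proof (intro exI[of _ "4608 * (exp 1)\<^sup>2"] conjI allI impI)
  show "0 < 4608 * (exp 1 :: real)\<^sup>2" by simp
  fix n :: nat and K :: "(nat \<Rightarrow> real) set"
  assume n: "n \<ge> 1" and body: "convex_body (2 * n) K" "0 \<in> Euclidean_space (2 * n) interior_of K"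
  have K: "centered_body (2 * n) K" by (rule centered_body.intro[OF body])
  interpret K: centered_body "2 * n" K by (rule K)
  let ?q = "(Vol (2 * n) K / Vol (2 * n) (Eball (2 * n) 1)) powr (1 / real n)"
  let ?A = "4608 * (exp 1 :: real)\<^sup>2"
  have q: "?q > 0" using K.Vol_pos Vol_Eball_pos[of "2 * n"] by simp
  have ge: "1 \<le> Rad_const (2 * n) K" using n by (intro Rad_const_ge_one[OF K]) simp
  show "cZ_lin n K / cap_unit_ball n \<le> ereal ?A * (Rad_const (2 * n) K)\<^sup>2 * ereal ?q"
  proof (cases "Rad_const (2 * n) K")
    case (real R)
    have R1: "1 \<le> R" using ge real by (simp add: one_ereal_def)
    have "cZ_lin n K / cap_unit_ball n \<le> ereal (pi * (?A * R * ?q)) / ereal pi"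
      unfolding cap_unit_ball_def
      by (intro ereal_divide_right_mono cZ_lin_le_Rad_volume[OF n K real]) simp
    also have "\<dots> = ereal (?A * R * ?q)" by simp
    also have "\<dots> \<le> ereal (?A * R\<^sup>2 * ?q)"
    proof -
      have "R * 1 \<le> R * R" using R1 by (intro mult_left_mono) auto
      then show ?thesis using q by (simp add: power2_eq_square mult_left_mono mult_right_mono)
    qed
    also have "\<dots> = ereal ?A * (Rad_const (2 * n) K)\<^sup>2 * ereal ?q" by (simp add: real)
    finally show ?thesis .
  next
    case PInf
    have "ereal ?A * (Rad_const (2 * n) K)\<^sup>2 * ereal ?q = \<infinity>"
      using q by (simp add: PInf power2_eq_square)
    then show ?thesis by simp
  next
    case MInf
    then show ?thesis using ge by simp
  qed
qed

end
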